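(* (Lie's 3rd Theorem) Let $\mathcal{H}_2(\Gamma)\subset\mathcal{U}_2$ be an affine PHG on a smooth manifold $M$ with structure object $\Gamma=(\Gamma^i_{jk}(x))$, linearization $H_2(\Gamma)\to M$, integrability object $I(\Gamma)$, nonlinear curvature $\mathcal{R}$ and linear curvature $\mathfrak{R}$. The following conditions are equivalent: 1) $\mathcal{R}=0$ on $\mathcal{U}_1$. 2) $\mathcal{H}_2(\Gamma)$ is uniquely locally integrable. 3) $\mathcal{H}_2(\Gamma)$, which leaves $\Gamma$ invariant by definition, also leaves $I(\Gamma)$ invariant. 4) $I(\Gamma)=0$ on $M$. 5) $\mathfrak{R}=0$. 6) $H_2(\Gamma)\to M$ is uniquely locally integrable. 7) $\mathcal{L}_{\varepsilon\xi_1}I(\Gamma)=0$ for all $\xi_1\in H_1(\Gamma)=J_1(T)$.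
   Context: Summation over repeated indices is used; $[rj]$ denotes alternation, $[A_{rj}]_{[rj]}=A_{rj}-A_{jr}$. $M$ is a smooth manifold, $T=T(M)$; $J_k(T)\to M$ is the bundle of $k$-jets of vector fields, with elements $(\xi^i,\xi^i_j)$ for $k=1$ and $(\xi^i,\xi^i_j,\xi^i_{jk})$, $\xi^i_{jk}=\xi^i_{kj}$, for $k=2$. $\mathcal{U}_k$ is the groupoid of $k$-jets ($k$-arrows) of local diffeomorphisms of $M$; a $2$-arrow is written $(\overline x^i,\overline y^i,\overline f^i_j,\overline f^i_{jk})$, $\overline f^i_{jk}=\overline f^i_{kj}$. **Structure object and affine PHG.** $\Gamma$ is a smooth geometric object with components $\Gamma^i_{jk}(x)=\Gamma^i_{kj}(x)$, transforming under a coordinate change $x\mapsto f(x)$ by $$\Gamma^i_{ab}(f(x))\frac{\partial f^a}{\partial x^j}\frac{\partial f^b}{\partial x^k}=\Gamma^a_{jk}(x)\frac{\partial f^i}{\partial x^a}+\frac{\partial^2f^i}{\partial x^j\partial x^k}$$ (so $-\Gamma^i_{jk}$ are the connection coefficients, in the usual sign convention, of a torsion-free affine connection). The affine PHG $\mathcal{H}_2(\Gamma)\subset\mathcal{U}_2$ is the subgroupoid of $2$-arrows with $$\overline f^i_{jk}=\Gamma^i_{ab}(\overline y)\overline f^a_j\overline f^b_k-\Gamma^a_{jk}(\overline x)\overline f^i_a ;$$ above each $1$-arrow there is exactly one $2$-arrow of $\mathcal{H}_2(\Gamma)$, and $\mathcal{H}_1(\Gamma)=\mathcal{U}_1$. **Unique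 local integrability of $\mathcal{H}_2(\Gamma)$.** Every $2$-arrow of $\mathcal{H}_2(\Gamma)$, with source $\overline x$ say, is the $2$-jet at $\overline x$ of a local diffeomorphism $f$ near $\overline x$, with unique germ at $\overline x$, whose $2$-jets at all points near $\overline x$ belong to $\mathcal{H}_2(\Gamma)$. **Integrability object and nonlinear curvature.** $$I^i_{rj,k}(\Gamma;x)=\Big[\frac{\partial\Gamma^i_{jk}(x)}{\partial x^r}+\Gamma^i_{ja}(x)\Gamma^a_{rk}(x)\Big]_{[rj]}$$ is a $(1,3)$-tensor $I(\Gamma)$. For a $1$-arrow $(x,y,f_1)\in\mathcal{U}_1$, $g_1=f_1^{-1}$, $$\mathcal{R}^i_{rj,k}(x,y,f_1)=I^i_{rj,k}(\Gamma;y)-g^c_r\,g^a_j\,g^d_k\,I^e_{ca,d}(\Gamma;x)\,f^i_e .$$ $\mathcal{H}_2(\Gamma)$ leaves $I(\Gamma)$ invariant if, for every $2$-arrow of $\mathcal{H}_2(\Gamma)$ from $x$ to $y$, with underlying $1$-arrow $(x,y,f_1)$, the tensorial transport of $I(\Gamma;x)$ by $f_1$ equals $I(\Gamma;y)$. **Linearization.** $H_1(\Gamma)=J_1(T)$, and $H_2(\Gamma)\subset J_2(T)$ is the vector subbundle of all $(\xi^i,\xi^i_j,\xi^i_{jk})$ with $\xi^i_{jk}=P^i_{jk}(x,\xi_1)$, where for $\xi_1=(\xi^i,\xi^i_j)$ $$P^i_{jk}(x,\xi_1)=\frac{\partial\Gamma^i_{jk}}{\partial x^a}\xi^a+\Gamma^i_{ka}\xi^a_j+\Gamma^i_{ja}\xi^a_k-\xi^i_a\Gamma^a_{jk}.$$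 $H_2(\Gamma)$ is uniquely locally integrable if every element of every fiber $H_2(\Gamma)^{\overline x}$ is the $2$-jet at $\overline x$ of a vector field near $\overline x$, with unique germ at $\overline x$, whose $2$-jets at all points near $\overline x$ lie in $H_2(\Gamma)$. **Linear curvature.** $\mathfrak{R}$ is the integrability condition of the first order linear system $\partial\xi^i/\partial x^j=\xi^i_j$, $\partial\xi^i_j/\partial x^k=P^i_{jk}(x,\xi_1)$: it is the expression, linear in $\xi_1\in J_1(T)$, $$\mathfrak{R}(\xi_1)^i_{rj,k}=[D_rP^i_{jk}]_{[rj]},\qquad D_r=\frac{\partial}{\partial x^r}+\xi^a_r\frac{\partial}{\partial\xi^a}+P^a_{br}\frac{\partial}{\partial\xi^a_b}.$$ $\mathfrak{R}=0$ means $\mathfrak{R}(\xi_1)=0$ for all $\xi_1\in J_1(T)$. **Formal Lie derivative.** $\mathcal{L}_{\varepsilon\xi_1}I(\Gamma)$ is obtained from the coordinate formula of the ordinary Lie derivative of the tensor $I(\Gamma)$ along $\xi$ by replacing $\partial\xi^i/\partial x^j$ with $\xi^i_j$: $$(\mathcal{L}_{\varepsilon\xi_1}I)^i_{rj,k}=\xi^a\frac{\partial I^i_{rj,k}}{\partial x^a}-\xi^i_aI^a_{rj,k}+\xi^a_rI^i_{aj,k}+\xi^a_jI^i_{ra,k}+\xi^a_kI^i_{rj,a}.$$ *)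

theory Defs
  imports "HOL-Analysis.Analysis"
begin

primrec Ck_on :: "nat \<Rightarrow> 'a::real_normed_vector set \<Rightarrow> ('a \<Rightarrow> 'b::real_normed_vector) \<Rightarrow> bool" where
  "Ck_on 0 S f \<longleftrightarrow> continuous_on S f"
| "Ck_on (Suc k) S f \<longleftrightarrow>
     (\<forall>x\<in>S. f differentiable (at x)) \<and> (\<forall>v. Ck_on k S (\<lambda>x. frechet_derivative f (at x) v))"

text \<open>Only meaningful for open \<open>S\<close>, because derivatives are taken with respect to full neighbourhoods.\<close>

definition smooth_on :: "'a::real_normed_vector set \<Rightarrow> ('a \<Rightarrow> 'b::real_normed_vector) \<Rightarrow> bool" where
  "smooth_on S f \<longleftrightarrow> (\<forall>k. Ck_on k S f)"

definition pd :: "'n::finite \<Rightarrow> (real^'n \<Rightarrow> real) \<Rightarrow> real^'n \<Rightarrow> real" where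
  "pd j h x = frechet_derivative h (at x) (axis j 1)"

text \<open>In all component arrays the upper index comes first: \<open>jac F x $ i $ j\<close> is the
  \<open>j\<close>-th partial derivative of \<open>F\<^sup>i\<close>.\<close>

definition jac :: "(real^'n \<Rightarrow> real^'n) \<Rightarrow> real^'n \<Rightarrow> real^'n^'n" where
  "jac F x = (\<chi> i j. pd j (\<lambda>z. F z $ i) x)"

definition hess :: "(real^'n \<Rightarrow> real^'n) \<Rightarrow> real^'n \<Rightarrow> real^'n^'n^'n" where
  "hess F x = (\<chi> i j k. pd k (\<lambda>z. pd j (\<lambda>w. F w $ i) z) x)"

text \<open>A chart is an open domain together with its coordinate map; the values of the
  coordinate map outside the domain are irrelevant.\<close>

type_synonym ('m, 'n) chart = "'m set \<times> ('m \<Rightarrow> real^'n)"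

abbreviation dom_of :: "('m, 'n) chart \<Rightarrow> 'm set" where
  "dom_of c \<equiv> fst c"

abbreviation coord :: "('m, 'n) chart \<Rightarrow> 'm \<Rightarrow> real^'n" where
  "coord c \<equiv> snd c"

abbreviation point :: "('m, 'n) chart \<Rightarrow> real^'n \<Rightarrow> 'm" where
  "point c \<equiv> inv_into (dom_of c) (coord c)"

definition is_chart :: "('m::topological_space, 'n::finite) chart \<Rightarrow> bool" where
  "is_chart c \<longleftrightarrow> open (dom_of c) \<and> open (coord c ` dom_of c) \<and>
     homeomorphism (dom_of c) (coord c ` dom_of c) (coord c) (point c)"

text \<open>The manifold is given by a smooth atlas \<open>A\<close>, its underlying space is the union of the
  chart domains. The Hausdorff and second countability axioms are the sort constraints.
  The atlas need not be maximal.\<close>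

definition carrier_of :: "('m, 'n) chart set \<Rightarrow> 'm set" where
  "carrier_of A = (\<Union>c\<in>A. dom_of c)"

definition transition :: "('m, 'n) chart \<Rightarrow> ('m, 'n) chart \<Rightarrow> real^'n \<Rightarrow> real^'n" where
  "transition c d = coord d \<circ> point c"

definition smooth_manifold ::
  "('m::{t2_space, second_countable_topology}, 'n::finite) chart set \<Rightarrow> bool" where
  "smooth_manifold A \<longleftrightarrow> (\<forall>c\<in>A. is_chart c) \<and>
     (\<forall>c\<in>A. \<forall>d\<in>A. smooth_on (coord c ` (dom_of c \<inter> dom_of d)) (transition c d))"

definition in_charts ::
  "('m, 'n) chart \<Rightarrow> ('m, 'n) chart \<Rightarrow> ('m \<Rightarrow> 'm) \<Rightarrow> real^'n \<Rightarrow> real^'n" where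
  "in_charts c d f = coord d \<circ> f \<circ> point c"

definition smooth_map_on ::
  "('m::topological_space, 'n::finite) chart set \<Rightarrow> 'm set \<Rightarrow> ('m \<Rightarrow> 'm) \<Rightarrow> bool" where
  "smooth_map_on A W f \<longleftrightarrow> continuous_on W f \<and>
     (\<forall>c\<in>A. \<forall>d\<in>A. smooth_on (coord c ` {p \<in> W \<inter> dom_of c. f p \<in> dom_of d}) (in_charts c d f))"

definition diffeo_on ::
  "('m::topological_space, 'n::finite) chart set \<Rightarrow> 'm set \<Rightarrow> ('m \<Rightarrow> 'm) \<Rightarrow> bool" where
  "diffeo_on A W f \<longleftrightarrow>
     open W \<and> W \<subseteq> carrier_of A \<and> open (f ` W) \<and> f ` W \<subseteq> carrier_of A \<and> inj_on f W \<and>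
     smooth_map_on A W f \<and> smooth_map_on A (f ` W) (inv_into W f)"

definition local_diffeo_at ::
  "('m::topological_space, 'n::finite) chart set \<Rightarrow> 'm \<Rightarrow> ('m \<Rightarrow> 'm) \<Rightarrow> bool" where
  "local_diffeo_at A p f \<longleftrightarrow> (\<exists>W. p \<in> W \<and> diffeo_on A W f)"

text \<open>A geometric object is given by its components in every chart of the atlas:
  \<open>\<Gamma> c x $ i $ j $ k\<close> is the component with upper index \<open>i\<close> and lower indices \<open>j\<close>, \<open>k\<close> in the
  chart \<open>c\<close>, at the point of the manifold with \<open>c\<close>-coordinates \<open>x\<close>.\<close>

type_synonym ('m, 'n) gamma = "('m, 'n) chart \<Rightarrow> real^'n \<Rightarrow> real^'n^'n^'n"

definition structure_object ::
  "('m::topological_space, 'n::finite) chart set \<Rightarrow> ('m, 'n) gamma \<Rightarrow> bool" where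
  "structure_object A \<Gamma> \<longleftrightarrow>
     (\<forall>c\<in>A. smooth_on (coord c ` dom_of c) (\<Gamma> c) \<and>
        (\<forall>x\<in>coord c ` dom_of c. \<forall>i j k. \<Gamma> c x $ i $ j $ k = \<Gamma> c x $ i $ k $ j)) \<and>
     (\<forall>c\<in>A. \<forall>d\<in>A. \<forall>x\<in>coord c ` (dom_of c \<inter> dom_of d). \<forall>i j k.
        let f = transition c d in
          (\<Sum>a\<in>UNIV. \<Sum>b\<in>UNIV. \<Gamma> d (f x) $ i $ a $ b * jac f x $ a $ j * jac f x $ b $ k)
          = (\<Sum>a\<in>UNIV. \<Gamma> c x $ a $ j $ k * jac f x $ i $ a) + hess f x $ i $ j $ k)"

text \<open>\<open>integrability_object \<Gamma> c x $ i $ r $ j $ k\<close> is \<open>I\<^sup>i\<close> with lower indices \<open>r j , k\<close>.\<close>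

definition integrability_object ::
  "('m, 'n::finite) gamma \<Rightarrow> ('m, 'n) chart \<Rightarrow> real^'n \<Rightarrow> real^'n^'n^'n^'n" where
  "integrability_object \<Gamma> c x = (\<chi> i r j k.
     (let B = (\<lambda>r j. pd r (\<lambda>z. \<Gamma> c z $ i $ j $ k) x
                   + (\<Sum>a\<in>UNIV. \<Gamma> c x $ i $ j $ a * \<Gamma> c x $ a $ r $ k))
      in B r j - B j r))"

definition integrability_object_vanishes ::
  "('m, 'n::finite) chart set \<Rightarrow> ('m, 'n) gamma \<Rightarrow> bool" where
  "integrability_object_vanishes A \<Gamma> \<longleftrightarrow>
     (\<forall>c\<in>A. \<forall>x\<in>coord c ` dom_of c. integrability_object \<Gamma> c x = 0)"

text \<open>Arrows are recorded by their coordinates with respect to a chart \<open>c\<close> around the source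
  and a chart \<open>d\<close> around the target.\<close>

type_synonym 'n arrow1 = "(real^'n) \<times> (real^'n) \<times> (real^'n^'n)"
type_synonym 'n arrow2 = "(real^'n) \<times> (real^'n) \<times> (real^'n^'n) \<times> (real^'n^'n^'n)"

definition jet1 ::
  "('m, 'n::finite) chart \<Rightarrow> ('m, 'n) chart \<Rightarrow> ('m \<Rightarrow> 'm) \<Rightarrow> 'm \<Rightarrow> 'n arrow1" where
  "jet1 c d f p = (coord c p, coord d (f p), jac (in_charts c d f) (coord c p))"

definition jet2 ::
  "('m, 'n::finite) chart \<Rightarrow> ('m, 'n) chart \<Rightarrow> ('m \<Rightarrow> 'm) \<Rightarrow> 'm \<Rightarrow> 'n arrow2" where
  "jet2 c d f p = (coord c p, coord d (f p), jac (in_charts c d f) (coord c p),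
     hess (in_charts c d f) (coord c p))"

definition U1 :: "('m::topological_space, 'n::finite) chart set \<Rightarrow>
    ('m, 'n) chart \<Rightarrow> ('m, 'n) chart \<Rightarrow> 'n arrow1 set" where
  "U1 A c d = {jet1 c d f p | f p. p \<in> dom_of c \<and> f p \<in> dom_of d \<and> local_diffeo_at A p f}"

definition U2 :: "('m::topological_space, 'n::finite) chart set \<Rightarrow>
    ('m, 'n) chart \<Rightarrow> ('m, 'n) chart \<Rightarrow> 'n arrow2 set" where
  "U2 A c d = {jet2 c d f p | f p. p \<in> dom_of c \<and> f p \<in> dom_of d \<and> local_diffeo_at A p f}"

definition affine_PHG :: "('m::topological_space, 'n::finite) chart set \<Rightarrow> ('m, 'n) gamma \<Rightarrow>
    ('m, 'n) chart \<Rightarrow> ('m, 'n) chart \<Rightarrow> 'n arrow2 set" where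
  "affine_PHG A \<Gamma> c d = {(x, y, f1, f2) \<in> U2 A c d. \<forall>i j k.
     f2 $ i $ j $ k =
       (\<Sum>a\<in>UNIV. \<Sum>b\<in>UNIV. \<Gamma> d y $ i $ a $ b * f1 $ a $ j * f1 $ b $ k)
       - (\<Sum>a\<in>UNIV. \<Gamma> c x $ a $ j $ k * f1 $ i $ a)}"

text \<open>Near the source point of an arrow, all points lie in \<open>c\<close> and their images in \<open>d\<close>, so the
  nearby 2-jets can be tested in the same two charts. By the transformation rule of \<open>\<Gamma>\<close>,
  membership in the PHG does not depend on the charts.\<close>

definition PHG_solution :: "('m::topological_space, 'n::finite) chart set \<Rightarrow> ('m, 'n) gamma \<Rightarrow>
    ('m, 'n) chart \<Rightarrow> ('m, 'n) chart \<Rightarrow> 'n arrow2 \<Rightarrow> ('m \<Rightarrow> 'm) \<Rightarrow> bool" where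
  "PHG_solution A \<Gamma> c d \<alpha> f \<longleftrightarrow>
     (let p = point c (fst \<alpha>) in
        local_diffeo_at A p f \<and> f p \<in> dom_of d \<and> jet2 c d f p = \<alpha> \<and>
        (\<forall>\<^sub>F q in nhds p. q \<in> dom_of c \<and> f q \<in> dom_of d \<and> jet2 c d f q \<in> affine_PHG A \<Gamma> c d))"

definition PHG_uniquely_locally_integrable ::
  "('m::topological_space, 'n::finite) chart set \<Rightarrow> ('m, 'n) gamma \<Rightarrow> bool" where
  "PHG_uniquely_locally_integrable A \<Gamma> \<longleftrightarrow>
     (\<forall>c\<in>A. \<forall>d\<in>A. \<forall>\<alpha>\<in>affine_PHG A \<Gamma> c d.
        (\<exists>f. PHG_solution A \<Gamma> c d \<alpha> f) \<and>
        (\<forall>f g. PHG_solution A \<Gamma> c d \<alpha> f \<longrightarrow> PHG_solution A \<Gamma> c d \<alpha> g \<longrightarrow>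
           (\<forall>\<^sub>F q in nhds (point c (fst \<alpha>)). f q = g q)))"

definition transport :: "real^'n^'n \<Rightarrow> real^'n^'n^'n^'n \<Rightarrow> real^'n^'n^'n^'n" where
  "transport f1 T = (let g = matrix_inv f1 in
     \<chi> i r j k. \<Sum>c\<in>UNIV. \<Sum>a\<in>UNIV. \<Sum>d\<in>UNIV. \<Sum>e\<in>UNIV.
        g $ c $ r * g $ a $ j * g $ d $ k * T $ e $ c $ a $ d * f1 $ i $ e)"

definition nonlinear_curvature :: "('m, 'n::finite) gamma \<Rightarrow>
    ('m, 'n) chart \<Rightarrow> ('m, 'n) chart \<Rightarrow> 'n arrow1 \<Rightarrow> real^'n^'n^'n^'n" where
  "nonlinear_curvature \<Gamma> c d = (\<lambda>(x, y, f1).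
     integrability_object \<Gamma> d y - transport f1 (integrability_object \<Gamma> c x))"

definition nonlinear_curvature_vanishes ::
  "('m::topological_space, 'n::finite) chart set \<Rightarrow> ('m, 'n) gamma \<Rightarrow> bool" where
  "nonlinear_curvature_vanishes A \<Gamma> \<longleftrightarrow>
     (\<forall>c\<in>A. \<forall>d\<in>A. \<forall>\<alpha>\<in>U1 A c d. nonlinear_curvature \<Gamma> c d \<alpha> = 0)"

definition PHG_leaves_integrability_object_invariant ::
  "('m::topological_space, 'n::finite) chart set \<Rightarrow> ('m, 'n) gamma \<Rightarrow> bool" where
  "PHG_leaves_integrability_object_invariant A \<Gamma> \<longleftrightarrow>
     (\<forall>c\<in>A. \<forall>d\<in>A. \<forall>(x, y, f1, f2)\<in>affine_PHG A \<Gamma> c d.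
        transport f1 (integrability_object \<Gamma> c x) = integrability_object \<Gamma> d y)"

text \<open>A vector field is given by its components \<open>X c\<close> in every chart \<open>c\<close> of the atlas, as
  functions of the \<open>c\<close>-coordinates.\<close>

type_synonym ('m, 'n) vfield = "('m, 'n) chart \<Rightarrow> real^'n \<Rightarrow> real^'n"

definition vector_field_on ::
  "('m::topological_space, 'n::finite) chart set \<Rightarrow> 'm set \<Rightarrow> ('m, 'n) vfield \<Rightarrow> bool" where
  "vector_field_on A W X \<longleftrightarrow> open W \<and> W \<subseteq> carrier_of A \<and>
     (\<forall>c\<in>A. smooth_on (coord c ` (W \<inter> dom_of c)) (X c)) \<and>
     (\<forall>c\<in>A. \<forall>d\<in>A. \<forall>x\<in>coord c ` (W \<inter> dom_of c \<inter> dom_of d).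
        X d (transition c d x) = jac (transition c d) x *v X c x)"

definition local_vector_field_at ::
  "('m::topological_space, 'n::finite) chart set \<Rightarrow> 'm \<Rightarrow> ('m, 'n) vfield \<Rightarrow> bool" where
  "local_vector_field_at A p X \<longleftrightarrow> (\<exists>W. p \<in> W \<and> vector_field_on A W X)"

text \<open>Elements of the jet bundles are recorded by their coordinates, the first one being the base
  point.\<close>

type_synonym 'n vjet1 = "(real^'n) \<times> (real^'n) \<times> (real^'n^'n)"
type_synonym 'n vjet2 = "(real^'n) \<times> (real^'n) \<times> (real^'n^'n) \<times> (real^'n^'n^'n)"

definition vjet1 :: "('m, 'n::finite) chart \<Rightarrow> ('m, 'n) vfield \<Rightarrow> 'm \<Rightarrow> 'n vjet1" where
  "vjet1 c X p = (coord c p, X c (coord c p), jac (X c) (coord c p))"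

definition vjet2 :: "('m, 'n::finite) chart \<Rightarrow> ('m, 'n) vfield \<Rightarrow> 'm \<Rightarrow> 'n vjet2" where
  "vjet2 c X p = (coord c p, X c (coord c p), jac (X c) (coord c p), hess (X c) (coord c p))"

definition J1T ::
  "('m::topological_space, 'n::finite) chart set \<Rightarrow> ('m, 'n) chart \<Rightarrow> 'n vjet1 set" where
  "J1T A c = {vjet1 c X p | X p. p \<in> dom_of c \<and> local_vector_field_at A p X}"

definition J2T ::
  "('m::topological_space, 'n::finite) chart set \<Rightarrow> ('m, 'n) chart \<Rightarrow> 'n vjet2 set" where
  "J2T A c = {vjet2 c X p | X p. p \<in> dom_of c \<and> local_vector_field_at A p X}"

definition P_lin :: "('m, 'n::finite) gamma \<Rightarrow> ('m, 'n) chart \<Rightarrow>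
    real^'n \<Rightarrow> real^'n \<Rightarrow> real^'n^'n \<Rightarrow> real^'n^'n^'n" where
  "P_lin \<Gamma> c x \<xi> \<xi>1 = (\<chi> i j k.
     (\<Sum>a\<in>UNIV. pd a (\<lambda>z. \<Gamma> c z $ i $ j $ k) x * \<xi> $ a)
     + (\<Sum>a\<in>UNIV. \<Gamma> c x $ i $ k $ a * \<xi>1 $ a $ j)
     + (\<Sum>a\<in>UNIV. \<Gamma> c x $ i $ j $ a * \<xi>1 $ a $ k)
     - (\<Sum>a\<in>UNIV. \<xi>1 $ i $ a * \<Gamma> c x $ a $ j $ k))"

definition linearization :: "('m::topological_space, 'n::finite) chart set \<Rightarrow>
    ('m, 'n) gamma \<Rightarrow> ('m, 'n) chart \<Rightarrow> 'n vjet2 set" where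
  "linearization A \<Gamma> c = {(x, \<xi>, \<xi>1, \<xi>2) \<in> J2T A c. \<xi>2 = P_lin \<Gamma> c x \<xi> \<xi>1}"

definition linear_solution :: "('m::topological_space, 'n::finite) chart set \<Rightarrow>
    ('m, 'n) gamma \<Rightarrow> ('m, 'n) chart \<Rightarrow> 'n vjet2 \<Rightarrow> ('m, 'n) vfield \<Rightarrow> bool" where
  "linear_solution A \<Gamma> c \<alpha> X \<longleftrightarrow>
     (let p = point c (fst \<alpha>) in
        local_vector_field_at A p X \<and> vjet2 c X p = \<alpha> \<and>
        (\<forall>\<^sub>F q in nhds p. q \<in> dom_of c \<and> vjet2 c X q \<in> linearization A \<Gamma> c))"

definition linearization_uniquely_locally_integrable ::
  "('m::topological_space, 'n::finite) chart set \<Rightarrow> ('m, 'n) gamma \<Rightarrow> bool" where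
  "linearization_uniquely_locally_integrable A \<Gamma> \<longleftrightarrow>
     (\<forall>c\<in>A. \<forall>\<alpha>\<in>linearization A \<Gamma> c.
        (\<exists>X. linear_solution A \<Gamma> c \<alpha> X) \<and>
        (\<forall>X Y. linear_solution A \<Gamma> c \<alpha> X \<longrightarrow> linear_solution A \<Gamma> c \<alpha> Y \<longrightarrow>
           (\<forall>\<^sub>F q in nhds (point c (fst \<alpha>)).
              \<forall>d\<in>A. q \<in> dom_of d \<longrightarrow> X d (coord d q) = Y d (coord d q))))"

text \<open>The matrix \<open>axis a (axis b 1)\<close> has its only nonzero entry in row \<open>a\<close>, column \<open>b\<close>, so the last
  summand differentiates with respect to the variable \<open>\<xi>1 $ a $ b\<close>.\<close>

definition total_derivative :: "('m, 'n::finite) gamma \<Rightarrow> ('m, 'n) chart \<Rightarrow> 'n \<Rightarrow>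
    (real^'n \<Rightarrow> real^'n \<Rightarrow> real^'n^'n \<Rightarrow> real) \<Rightarrow> real^'n \<Rightarrow> real^'n \<Rightarrow> real^'n^'n \<Rightarrow> real" where
  "total_derivative \<Gamma> c r F x \<xi> \<xi>1 =
     pd r (\<lambda>z. F z \<xi> \<xi>1) x
     + (\<Sum>a\<in>UNIV. \<xi>1 $ a $ r * pd a (\<lambda>\<eta>. F x \<eta> \<xi>1) \<xi>)
     + (\<Sum>a\<in>UNIV. \<Sum>b\<in>UNIV. P_lin \<Gamma> c x \<xi> \<xi>1 $ a $ b $ r *
          frechet_derivative (\<lambda>\<eta>1. F x \<xi> \<eta>1) (at \<xi>1) (axis a (axis b 1)))"

definition linear_curvature ::
  "('m, 'n::finite) gamma \<Rightarrow> ('m, 'n) chart \<Rightarrow> 'n vjet1 \<Rightarrow> real^'n^'n^'n^'n" where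
  "linear_curvature \<Gamma> c = (\<lambda>(x, \<xi>, \<xi>1). \<chi> i r j k.
     total_derivative \<Gamma> c r (\<lambda>z \<eta> \<eta>1. P_lin \<Gamma> c z \<eta> \<eta>1 $ i $ j $ k) x \<xi> \<xi>1
     - total_derivative \<Gamma> c j (\<lambda>z \<eta> \<eta>1. P_lin \<Gamma> c z \<eta> \<eta>1 $ i $ r $ k) x \<xi> \<xi>1)"

definition linear_curvature_vanishes ::
  "('m::topological_space, 'n::finite) chart set \<Rightarrow> ('m, 'n) gamma \<Rightarrow> bool" where
  "linear_curvature_vanishes A \<Gamma> \<longleftrightarrow>
     (\<forall>c\<in>A. \<forall>\<xi>\<in>J1T A c. linear_curvature \<Gamma> c \<xi> = 0)"

definition formal_Lie_derivative ::
  "('m, 'n::finite) gamma \<Rightarrow> ('m, 'n) chart \<Rightarrow> 'n vjet1 \<Rightarrow> real^'n^'n^'n^'n" where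
  "formal_Lie_derivative \<Gamma> c = (\<lambda>(x, \<xi>, \<xi>1). let T = integrability_object \<Gamma> c in
     \<chi> i r j k.
       (\<Sum>a\<in>UNIV. \<xi> $ a * pd a (\<lambda>z. T z $ i $ r $ j $ k) x)
       - (\<Sum>a\<in>UNIV. \<xi>1 $ i $ a * T x $ a $ r $ j $ k)
       + (\<Sum>a\<in>UNIV. \<xi>1 $ a $ r * T x $ i $ a $ j $ k)
       + (\<Sum>a\<in>UNIV. \<xi>1 $ a $ j * T x $ i $ r $ a $ k)
       + (\<Sum>a\<in>UNIV. \<xi>1 $ a $ k * T x $ i $ r $ j $ a))"

definition formal_Lie_derivative_vanishes ::
  "('m::topological_space, 'n::finite) chart set \<Rightarrow> ('m, 'n) gamma \<Rightarrow> bool" where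
  "formal_Lie_derivative_vanishes A \<Gamma> \<longleftrightarrow>
     (\<forall>c\<in>A. \<forall>\<xi>\<in>J1T A c. formal_Lie_derivative \<Gamma> c \<xi> = 0)"

end

theory Submission
  imports Defs
begin

text \<open>All seven conditions are equivalent to the vanishing of \<open>I(\<Gamma>)\<close>. For the algebraic ones it suffices
  to look at dilations: a 1-arrow \<open>(x, x, 2 id)\<close> multiplies a (1,3)-tensor by \<open>1/4\<close>, and on the 1-jet
  \<open>(x, 0, id)\<close> the formal Lie derivative of \<open>I(\<Gamma>)\<close> is \<open>2 I(\<Gamma>)\<close>.

  Both \<open>H\<^sub>2(\<Gamma>)\<close> and its nonlinear counterpart are systems \<open>hess y = H (x, y, jac y)\<close>. Symmetry of the third
  derivatives of a solution forces the total derivatives \<open>D\<^sub>r H\<^sub>j\<^sub>k\<close> to be symmetric in \<open>r, j\<close>; the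
  defect of this symmetry is \<open>I(y)(pu, pv, pw) - p I(x)(u, v, w)\<close> in the nonlinear case and the formal
  Lie derivative of \<open>I(\<Gamma>)\<close> in the linear case, so dilations again give \<open>I(\<Gamma>) = 0\<close>. Conversely, if the
  symmetry holds everywhere, the Frobenius theorem gives unique local solutions. It is proved by
  Picard iteration along rays: the error \<open>dy\<^sub>m - F(x, y\<^sub>m)\<close> of an iterate is, up to a term tending to
  \<open>0\<close>, at most half of the previous one on a small ball, because under the symmetry condition only the
  error contributes to the failure of \<open>F(x, y\<^sub>m)\<close> to be a closed 1-form.\<close>

section \<open>Smooth maps\<close>

text \<open>The usual proof of the Frobenius theorem solves an ordinary differential equation along
  each ray and must then differentiate the solution with respect to the end point. Iterating on
  whole balls avoids this: every iterate is a radial integral, differentiated under the integral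
  sign, and the derivatives converge uniformly together with the iterates. The limit is at first
  only differentiable; it becomes smooth by bootstrapping, because the derivative of its graph is a
  smooth function of the graph.

  Membership in a jet space means being the jet of some map or field, so the dilations have to be
  realized by actual local diffeomorphisms. A quadratic polynomial realizes every symmetric 2-jet,
  and the inverse function theorem makes it a diffeomorphism when its linear part is invertible. The
  factor 2 works because the integrability object has three lower indices and one upper index: with
  \<open>p = 2 id\<close> the two sides of \<open>I(pu, pv, pw) = p I(u, v, w)\<close> carry the
  factors 8 and 2, and the linearized count is 3 - 1 = 2.\<close>

lemma Ck_on_cong:
  assumes "open S" "\<And>x. x \<in> S \<Longrightarrow> f x = g x" "Ck_on k S f"
  shows "Ck_on k S g"
  using assms(2,3)
proof (induction k arbitrary: f g)
  case 0
  then show ?case by (auto cong: continuous_on_cong)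
next
  case (Suc k)
  have der: "(g has_derivative frechet_derivative f (at x)) (at x)" if "x \<in> S" for x
  proof -
    have "(f has_derivative frechet_derivative f (at x)) (at x)"
      using Suc.prems(2) that frechet_derivative_works by (metis Ck_on.simps(2))
    then show ?thesis
      using Suc.prems(1) by (rule has_derivative_transform_within_open[OF _ assms(1) that])
  qed
  have eq: "frechet_derivative f (at x) = frechet_derivative g (at x)" if "x \<in> S" for x
    using frechet_derivative_at[OF der[OF that]] .
  have "Ck_on k S (\<lambda>x. frechet_derivative g (at x) v)" for v
    by (rule Suc.IH[of "\<lambda>x. frechet_derivative f (at x) v"])
      (use Suc.prems(2) eq in simp_all)
  then show ?case
    using der unfolding Ck_on.simps by (blast intro: differentiableI)
qed

lemma Ck_on_subset: "Ck_on k S f \<Longrightarrow> T \<subseteq> S \<Longrightarrow> Ck_on k T f"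
  by (induction k arbitrary: f) (auto intro: continuous_on_subset)

lemma Ck_on_Suc_imp: "Ck_on (Suc k) S f \<Longrightarrow> Ck_on k S f"
proof (induction k arbitrary: f)
  case 0
  then show ?case
    by (auto intro!: continuous_at_imp_continuous_on differentiable_imp_continuous_within)
next
  case (Suc k)
  from Suc.prems have "\<forall>x\<in>S. f differentiable at x"
    and "\<And>v. Ck_on (Suc k) S (\<lambda>x. frechet_derivative f (at x) v)"
    unfolding Ck_on.simps(2)[of "Suc k"] by blast+
  with Suc.IH show ?case by simp
qed

text \<open>Allows any explicit formula for the derivative in place of the choice term
  \<open>frechet_derivative\<close>. Linear images, sums, products, compositions and reciprocals are
  all treated this way: compute the derivative, then apply the induction hypothesis to it.\<close>

lemma Ck_on_SucI:
  assumes "open S" "\<And>x. x \<in> S \<Longrightarrow> (f has_derivative f' x) (at x)"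
    "\<And>v. Ck_on k S (\<lambda>x. f' x v)"
  shows "Ck_on (Suc k) S f"
  unfolding Ck_on.simps
proof (intro conjI ballI allI)
  show "f differentiable at x" if "x \<in> S" for x
    using assms(2)[OF that] by (rule differentiableI)
  show "Ck_on k S (\<lambda>x. frechet_derivative f (at x) v)" for v
  proof (rule Ck_on_cong[OF assms(1) _ assms(3)[of v]])
    show "f' x v = frechet_derivative f (at x) v" if "x \<in> S" for x
      using frechet_derivative_at[OF assms(2)[OF that]] by (rule fun_cong)
  qed
qed

lemma Ck_on_SucD:
  assumes "Ck_on (Suc k) S f" "x \<in> S"
  shows "(f has_derivative frechet_derivative f (at x)) (at x)"
  using assms unfolding Ck_on.simps by (metis frechet_derivative_works)

section \<open>Stability of the classes C^k under algebraic operations and composition\<close>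

lemma Ck_on_const: "Ck_on k S (\<lambda>x. c)"
  by (induction k arbitrary: c) simp_all

lemma Ck_on_ident: "Ck_on k S (\<lambda>x. x)"
  by (cases k) (simp_all add: Ck_on_const)

lemma Ck_on_bounded_linear:
  assumes "open S" "bounded_linear L" "Ck_on k S f"
  shows "Ck_on k S (\<lambda>x. L (f x))"
  using assms(3)
proof (induction k arbitrary: f)
  case 0
  then show ?case using assms(2) by (simp add: bounded_linear.continuous_on)
next
  case (Suc k)
  show ?case
    by (rule Ck_on_SucI[OF assms(1), where f' = "\<lambda>x v. L (frechet_derivative f (at x) v)"])
      (use Suc in \<open>auto intro!: bounded_linear.has_derivative[OF assms(2)] Ck_on_SucD\<close>)
qed

lemma Ck_on_add:
  assumes "open S" "Ck_on k S f" "Ck_on k S g"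
  shows "Ck_on k S (\<lambda>x. f x + g x)"
  using assms(2,3)
proof (induction k arbitrary: f g)
  case 0
  then show ?case by (simp add: continuous_on_add)
next
  case (Suc k)
  show ?case
    by (rule Ck_on_SucI[OF assms(1), where
          f' = "\<lambda>x v. frechet_derivative f (at x) v + frechet_derivative g (at x) v"])
      (use Suc in \<open>auto intro!: has_derivative_add Ck_on_SucD\<close>)
qed

lemma Ck_on_sum:
  assumes "open S" "\<And>i. i \<in> I \<Longrightarrow> Ck_on k S (f i)"
  shows "Ck_on k S (\<lambda>x. \<Sum>i\<in>I. f i x)"
  using assms(2)
  by (induction I rule: infinite_finite_induct) (auto intro!: Ck_on_const Ck_on_add[OF assms(1)])

lemma Ck_on_bounded_bilinear:
  assumes "open S" "bounded_bilinear prd" "Ck_on k S f" "Ck_on k S g"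
  shows "Ck_on k S (\<lambda>x. prd (f x) (g x))"
  using assms(3,4)
proof (induction k arbitrary: f g)
  case 0
  then show ?case using assms(2) by (simp add: bounded_bilinear.continuous_on)
next
  case (Suc k)
  show ?case
  proof (rule Ck_on_SucI[OF assms(1)])
    show "((\<lambda>x. prd (f x) (g x)) has_derivative
        (\<lambda>v. prd (f x) (frechet_derivative g (at x) v) + prd (frechet_derivative f (at x) v) (g x))) (at x)"
      if "x \<in> S" for x
      using that Suc.prems by (intro bounded_bilinear.FDERIV[OF assms(2)] Ck_on_SucD)
    \<comment> \<open>The product rule pairs each derivative with the other, undifferentiated
      factor, so the factors themselves are lowered to class k before the induction hypothesis
      applies.\<close>
    have "Ck_on k S f" "Ck_on k S g"
      using Suc.prems Ck_on_Suc_imp by blast+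
    then show "Ck_on k S (\<lambda>x. prd (f x) (frechet_derivative g (at x) v)
        + prd (frechet_derivative f (at x) v) (g x))" for v
      using Suc by (intro Ck_on_add[OF assms(1)] Suc.IH) auto
  qed
qed

text \<open>\<open>Ck_on\<close> only sees derivatives in fixed directions, but the chain rule
  differentiates \<open>g\<close> in a direction that moves with \<open>x\<close>. Expanding this
  direction in the standard basis turns the derivative into a finite sum of products of class k,
  which is why the middle space is Euclidean.\<close>

lemma Ck_on_compose:
  fixes f :: "'a::real_normed_vector \<Rightarrow> 'b::euclidean_space" and g :: "'b \<Rightarrow> 'c::real_normed_vector"
  assumes "open S" "open T" "f ` S \<subseteq> T" "Ck_on k S f" "Ck_on k T g"
  shows "Ck_on k S (\<lambda>x. g (f x))"
  using assms(4,5)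
proof (induction k arbitrary: g)
  case 0
  then show ?case using assms(3)
    by (auto intro: continuous_on_compose2)
next
  case (Suc k)
  let ?D = "\<lambda>x v. \<Sum>b\<in>Basis. (frechet_derivative f (at x) v \<bullet> b) *\<^sub>R frechet_derivative g (at (f x)) b"
  show ?case
  proof (rule Ck_on_SucI[OF assms(1)])
    fix x assume x: "x \<in> S"
    then have fx: "f x \<in> T" using assms(3) by auto
    have dg: "(g has_derivative frechet_derivative g (at (f x))) (at (f x))"
      using Ck_on_SucD[OF Suc.prems(2) fx] .
    have comp: "((\<lambda>x. g (f x)) has_derivative
        (\<lambda>v. frechet_derivative g (at (f x)) (frechet_derivative f (at x) v))) (at x)"
      using has_derivative_compose[OF Ck_on_SucD[OF Suc.prems(1) x] dg] .
    have lin: "frechet_derivative g (at (f x)) w =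
        (\<Sum>b\<in>Basis. (w \<bullet> b) *\<^sub>R frechet_derivative g (at (f x)) b)" for w
    proof -
      have "linear (frechet_derivative g (at (f x)))"
        using dg has_derivative_linear by blast
      then have "frechet_derivative g (at (f x)) (\<Sum>b\<in>Basis. (w \<bullet> b) *\<^sub>R b) =
        (\<Sum>b\<in>Basis. (w \<bullet> b) *\<^sub>R frechet_derivative g (at (f x)) b)"
        by (simp add: linear_sum linear_scale)
      then show ?thesis by (simp add: euclidean_representation)
    qed
    from comp show "((\<lambda>x. g (f x)) has_derivative ?D x) (at x)"
      by (rule has_derivative_eq_rhs) (rule ext, rule lin)
  next
    fix v
    have f: "Ck_on k S f" using Suc.prems Ck_on_Suc_imp by blast
    show "Ck_on k S (\<lambda>x. ?D x v)"
    proof (intro Ck_on_sum Ck_on_bounded_bilinear[OF _ bounded_bilinear_scaleR] assms(1))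
      fix b :: 'b
      show "Ck_on k S (\<lambda>x. frechet_derivative f (at x) v \<bullet> b)"
        using Suc.prems(1)
        by (intro Ck_on_bounded_linear[OF assms(1) bounded_linear_inner_left]) auto
      show "Ck_on k S (\<lambda>x. frechet_derivative g (at (f x)) b)"
        using Suc.prems(2) by (intro Suc.IH f) auto
    qed
  qed
qed

text \<open>The derivative of 1/f contains 1/f again, and the induction hypothesis already covers
  that factor in class k.\<close>

lemma Ck_on_inverse:
  fixes f :: "'a::real_normed_vector \<Rightarrow> real"
  assumes "open S" "\<And>x. x \<in> S \<Longrightarrow> f x \<noteq> 0" "Ck_on k S f"
  shows "Ck_on k S (\<lambda>x. inverse (f x))"
  using assms(3)
proof (induction k)
  case 0
  then show ?case using assms(2) by (auto intro!: continuous_on_inverse)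
next
  case (Suc k)
  show ?case
  proof (rule Ck_on_SucI[OF assms(1)])
    show "((\<lambda>x. inverse (f x)) has_derivative
        (\<lambda>v. - (inverse (f x) * frechet_derivative f (at x) v * inverse (f x)))) (at x)"
      if "x \<in> S" for x
      using that assms(2) Ck_on_SucD[OF Suc.prems that] by (intro Deriv.has_derivative_inverse) auto
    have "Ck_on k S f" using Suc.prems Ck_on_Suc_imp by blast
    then have i: "Ck_on k S (\<lambda>x. inverse (f x))" by (rule Suc.IH)
    show "Ck_on k S (\<lambda>x. - (inverse (f x) * frechet_derivative f (at x) v * inverse (f x)))" for v
      using Suc.prems i
      by (intro Ck_on_bounded_linear[OF assms(1) bounded_linear_minus[OF bounded_linear_ident]]
          Ck_on_bounded_bilinear[OF assms(1) bounded_bilinear_mult]) auto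
  qed
qed

section \<open>Passage from C^k maps to smooth maps\<close>

lemma smooth_on_imp_differentiable: "smooth_on S f \<Longrightarrow> x \<in> S \<Longrightarrow> f differentiable at x"
  unfolding smooth_on_def by (metis Ck_on.simps(2))

lemma smooth_on_has_derivative:
  "smooth_on S f \<Longrightarrow> x \<in> S \<Longrightarrow> (f has_derivative frechet_derivative f (at x)) (at x)"
  using smooth_on_imp_differentiable frechet_derivative_works by blast

lemma smooth_on_imp_continuous_on: "smooth_on S f \<Longrightarrow> continuous_on S f"
  unfolding smooth_on_def by (metis Ck_on.simps(1))

lemma smooth_on_frechet_derivative:
  "smooth_on S f \<Longrightarrow> smooth_on S (\<lambda>x. frechet_derivative f (at x) v)"
  unfolding smooth_on_def by (metis Ck_on.simps(2))

lemma smooth_on_subset: "smooth_on S f \<Longrightarrow> T \<subseteq> S \<Longrightarrow> smooth_on T f"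
  unfolding smooth_on_def using Ck_on_subset by blast

lemma smooth_on_cong: "open S \<Longrightarrow> (\<And>x. x \<in> S \<Longrightarrow> f x = g x) \<Longrightarrow> smooth_on S f \<Longrightarrow> smooth_on S g"
  unfolding smooth_on_def using Ck_on_cong by blast

lemma smooth_on_const: "smooth_on S (\<lambda>x. c)"
  by (simp add: smooth_on_def Ck_on_const)

lemma smooth_on_ident: "smooth_on S (\<lambda>x. x)"
  by (simp add: smooth_on_def Ck_on_ident)

lemma smooth_on_bounded_linear:
  "open S \<Longrightarrow> bounded_linear L \<Longrightarrow> smooth_on S f \<Longrightarrow> smooth_on S (\<lambda>x. L (f x))"
  by (simp add: smooth_on_def Ck_on_bounded_linear)

lemma smooth_on_add:
  "open S \<Longrightarrow> smooth_on S f \<Longrightarrow> smooth_on S g \<Longrightarrow> smooth_on S (\<lambda>x. f x + g x)"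
  by (simp add: smooth_on_def Ck_on_add)

lemma smooth_on_diff:
  assumes "open S" "smooth_on S f" "smooth_on S g"
  shows "smooth_on S (\<lambda>x. f x - g x)"
  using smooth_on_add[OF assms(1,2) smooth_on_bounded_linear[OF assms(1)
      bounded_linear_minus[OF bounded_linear_ident] assms(3)]] by simp

lemma smooth_on_sum:
  "open S \<Longrightarrow> (\<And>i. i \<in> I \<Longrightarrow> smooth_on S (f i)) \<Longrightarrow> smooth_on S (\<lambda>x. \<Sum>i\<in>I. f i x)"
  by (simp add: smooth_on_def Ck_on_sum)

lemma smooth_on_bounded_bilinear:
  "open S \<Longrightarrow> bounded_bilinear prd \<Longrightarrow> smooth_on S f \<Longrightarrow> smooth_on S g \<Longrightarrow>
    smooth_on S (\<lambda>x. prd (f x) (g x))"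
  by (simp add: smooth_on_def Ck_on_bounded_bilinear)

lemmas smooth_on_mult = smooth_on_bounded_bilinear[OF _ bounded_bilinear_mult]
lemmas smooth_on_scaleR = smooth_on_bounded_bilinear[OF _ bounded_bilinear_scaleR]

lemma smooth_on_prod:
  fixes f :: "'i \<Rightarrow> 'a::real_normed_vector \<Rightarrow> real"
  assumes "open S" "\<And>i. i \<in> I \<Longrightarrow> smooth_on S (f i)"
  shows "smooth_on S (\<lambda>x. \<Prod>i\<in>I. f i x)"
  using assms(2)
  by (induction I rule: infinite_finite_induct)
    (auto intro!: smooth_on_const smooth_on_mult[OF assms(1)])

lemma smooth_on_compose:
  fixes f :: "'a::real_normed_vector \<Rightarrow> 'b::euclidean_space"
  shows "open S \<Longrightarrow> open T \<Longrightarrow> f ` S \<subseteq> T \<Longrightarrow> smooth_on S f \<Longrightarrow> smooth_on T g \<Longrightarrow>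
    smooth_on S (\<lambda>x. g (f x))"
  by (simp add: smooth_on_def Ck_on_compose)

lemma smooth_on_inverse:
  fixes f :: "'a::real_normed_vector \<Rightarrow> real"
  shows "open S \<Longrightarrow> (\<And>x. x \<in> S \<Longrightarrow> f x \<noteq> 0) \<Longrightarrow> smooth_on S f \<Longrightarrow> smooth_on S (\<lambda>x. inverse (f x))"
  unfolding smooth_on_def using Ck_on_inverse by blast

lemma smooth_on_vec_nth: "open S \<Longrightarrow> smooth_on S f \<Longrightarrow> smooth_on S (\<lambda>x. f x $ i)"
  by (rule smooth_on_bounded_linear[OF _ bounded_linear_vec_nth])

lemma bounded_linear_axis: "bounded_linear (axis i :: 'b::euclidean_space \<Rightarrow> 'b^'n)"
  by (auto intro!: linear_conv_bounded_linear[THEN iffD1] linearI simp: vec_eq_iff axis_def)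

lemma Ck_on_vec_lambda:
  fixes f :: "'n::finite \<Rightarrow> 'a::real_normed_vector \<Rightarrow> 'b::euclidean_space"
  assumes "open S" "\<And>i. Ck_on k S (f i)"
  shows "Ck_on k S (\<lambda>x. \<chi> i. f i x)"
proof -
  have "(\<chi> i. f i x) = (\<Sum>i\<in>UNIV. axis i (f i x))" for x
    by (simp add: vec_eq_iff axis_def if_distrib cong: if_cong)
  then show ?thesis
    using assms by (auto intro!: Ck_on_sum Ck_on_bounded_linear[OF _ bounded_linear_axis])
qed

lemma smooth_on_vec_lambda:
  fixes f :: "'n::finite \<Rightarrow> 'a::real_normed_vector \<Rightarrow> 'b::euclidean_space"
  shows "open S \<Longrightarrow> (\<And>i. smooth_on S (f i)) \<Longrightarrow> smooth_on S (\<lambda>x. \<chi> i. f i x)"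
  by (simp add: smooth_on_def Ck_on_vec_lambda)

lemma Ck_on_Pair:
  assumes "open S" "Ck_on k S f" "Ck_on k S g"
  shows "Ck_on k S (\<lambda>x. (f x, g x))"
  using Ck_on_add[OF assms(1) Ck_on_bounded_linear[OF assms(1) _ assms(2), of "\<lambda>y. (y, 0)"]
      Ck_on_bounded_linear[OF assms(1) _ assms(3), of "\<lambda>y. (0, y)"]]
  by (simp add: bounded_linear_Pair bounded_linear_ident bounded_linear_zero)

lemma smooth_on_Pair:
  "open S \<Longrightarrow> smooth_on S f \<Longrightarrow> smooth_on S g \<Longrightarrow> smooth_on S (\<lambda>x. (f x, g x))"
  by (simp add: smooth_on_def Ck_on_Pair)

lemma smooth_on_fst: "open S \<Longrightarrow> smooth_on S f \<Longrightarrow> smooth_on S (\<lambda>x. fst (f x))"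
  by (rule smooth_on_bounded_linear[OF _ bounded_linear_fst])

lemma smooth_on_snd: "open S \<Longrightarrow> smooth_on S f \<Longrightarrow> smooth_on S (\<lambda>x. snd (f x))"
  by (rule smooth_on_bounded_linear[OF _ bounded_linear_snd])

lemma smooth_on_matrix_vector_mult:
  fixes M :: "'a::real_normed_vector \<Rightarrow> real^'n^'m"
  assumes "open S" "smooth_on S M" "smooth_on S f"
  shows "smooth_on S (\<lambda>x. M x *v f x)"
  unfolding matrix_vector_mult_def
  by (intro smooth_on_vec_lambda smooth_on_sum smooth_on_mult smooth_on_vec_nth assms)

lemmas smooth_intros = smooth_on_const smooth_on_ident smooth_on_add smooth_on_diff smooth_on_sum
  smooth_on_mult smooth_on_scaleR smooth_on_vec_nth smooth_on_vec_lambda smooth_on_Pair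
  smooth_on_fst smooth_on_snd smooth_on_matrix_vector_mult smooth_on_frechet_derivative

text \<open>Cramer's rule writes each component of \<open>g\<close> as a polynomial in the entries
  of \<open>M\<close> and \<open>b\<close> divided by \<open>det M\<close>. This gives the
  smoothness of the inverse of a Jacobian in \<open>smooth_local_inverse\<close>.\<close>

lemma smooth_on_cramer:
  fixes M :: "'a::real_normed_vector \<Rightarrow> real^'n^'n"
  assumes S: "open S" and M: "smooth_on S M" and b: "smooth_on S b"
    and det: "\<And>x. x \<in> S \<Longrightarrow> det (M x) \<noteq> 0" and eq: "\<And>x. x \<in> S \<Longrightarrow> M x *v g x = b x"
  shows "smooth_on S g"
proof -
  have sdet: "smooth_on S (\<lambda>x. det (N x))" if "\<And>i j. smooth_on S (\<lambda>x. N x $ i $ j)"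
    for N :: "'a \<Rightarrow> real^'n^'n"
    unfolding det_def by (intro smooth_on_sum smooth_on_mult smooth_on_prod smooth_on_const S that)
  have "smooth_on S (\<lambda>x. \<chi> k. det (\<chi> i j. if j = k then b x $ i else M x $ i $ j) * inverse (det (M x)))"
  proof (intro smooth_on_vec_lambda smooth_on_mult smooth_on_inverse sdet S)
    show "smooth_on S (\<lambda>x. (\<chi> i j. if j = k then b x $ i else M x $ i $ j) $ i $ j)" for k i j
      by (cases "j = k") (auto intro!: smooth_intros S M b)
  qed (use det S M in \<open>auto intro!: smooth_intros\<close>)
  then show ?thesis
  proof (rule smooth_on_cong[OF S, rotated])
    fix x assume "x \<in> S"
    then show "(\<chi> k. det (\<chi> i j. if j = k then b x $ i else M x $ i $ j) * inverse (det (M x))) = g x"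
      using cramer[OF det, of x "g x" "b x"] eq[of x] by (simp add: divide_inverse)
  qed
qed

text \<open>Bootstrapping: if \<open>y\<close> is of class k, then so is its derivative
  \<open>D (y x)\<close>, hence \<open>y\<close> is of class k + 1. In the applications
  \<open>D\<close> is the right-hand side of a differential equation or the inverse Jacobian of a
  map whose inverse is \<open>y\<close>.\<close>

lemma smooth_on_chain:
  fixes y :: "'a::real_normed_vector \<Rightarrow> 'b::euclidean_space"
  assumes S: "open S" and T: "open T" and yT: "y ` S \<subseteq> T"
    and der: "\<And>x. x \<in> S \<Longrightarrow> (y has_derivative D (y x)) (at x)"
    and D: "\<And>v. smooth_on T (\<lambda>z. D z v)"
  shows "smooth_on S y"
proof -
  have "Ck_on k S y" for k
  proof (induction k)
    case 0
    show ?case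
      using der by (auto intro!: continuous_at_imp_continuous_on has_derivative_continuous)
  next
    case (Suc k)
    show ?case
      using D by (intro Ck_on_SucI[OF S der] Ck_on_compose[OF S T yT Suc]) (auto simp: smooth_on_def)
  qed
  then show ?thesis by (simp add: smooth_on_def)
qed

text \<open>Radial integration and the inverse function theorem ask for a derivative that is
  continuous in operator norm. On a Euclidean space this follows from continuity on each basis
  vector.\<close>

lemma smooth_on_blinfun_derivative:
  fixes f :: "'a::euclidean_space \<Rightarrow> 'b::real_normed_vector"
  assumes "smooth_on S f"
  obtains f' where "\<And>x. x \<in> S \<Longrightarrow> (f has_derivative blinfun_apply (f' x)) (at x)"
    "continuous_on S f'"
proof
  let ?f' = "\<lambda>x. Blinfun (frechet_derivative f (at x))"
  have eq: "blinfun_apply (?f' x) = frechet_derivative f (at x)" if "x \<in> S" for x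
    using smooth_on_has_derivative[OF assms that]
    by (intro bounded_linear_Blinfun_apply has_derivative_bounded_linear)
  show "(f has_derivative blinfun_apply (?f' x)) (at x)" if "x \<in> S" for x
    using smooth_on_has_derivative[OF assms that] eq[OF that] by simp
  show "continuous_on S ?f'"
  proof (rule continuous_on_blinfun_componentwise)
    fix i :: 'a
    show "continuous_on S (\<lambda>x. blinfun_apply (?f' x) i)"
      using smooth_on_imp_continuous_on[OF smooth_on_frechet_derivative[OF assms, of i]] eq
      by (simp cong: continuous_on_cong)
  qed
qed

section \<open>The Frobenius theorem\<close>

lemma second_difference_mvt:
  fixes f :: "'a::real_normed_vector \<Rightarrow> real"
  assumes f: "smooth_on S f" and h: "0 < h"
    and seg: "\<And>s t. s \<in> {0..h} \<Longrightarrow> t \<in> {0..h} \<Longrightarrow> x + s *\<^sub>R u + t *\<^sub>R v \<in> S"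
  shows "\<exists>s t. s \<in> {0..h} \<and> t \<in> {0..h} \<and>
    f (x + h *\<^sub>R u + h *\<^sub>R v) - f (x + h *\<^sub>R u) - f (x + h *\<^sub>R v) + f x =
    h * (h * frechet_derivative (\<lambda>z. frechet_derivative f (at z) u) (at (x + s *\<^sub>R u + t *\<^sub>R v)) v)"
proof -
  have line: "DERIV (\<lambda>s. g (p + s *\<^sub>R w)) s :> frechet_derivative g (at (p + s *\<^sub>R w)) w"
    if "smooth_on S g" "p + s *\<^sub>R w \<in> S" for g :: "'a \<Rightarrow> real" and p w s
  proof -
    have g: "(g has_derivative frechet_derivative g (at (p + s *\<^sub>R w))) (at (p + s *\<^sub>R w))"
      using smooth_on_has_derivative[OF that] .
    have "((\<lambda>s. p + s *\<^sub>R w) has_derivative (\<lambda>r. r *\<^sub>R w)) (at s)"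
      by (auto intro!: derivative_eq_intros)
    from has_derivative_compose[OF this g]
    have "((\<lambda>s. g (p + s *\<^sub>R w)) has_derivative
        (\<lambda>r. frechet_derivative g (at (p + s *\<^sub>R w)) (r *\<^sub>R w))) (at s)" .
    then show ?thesis
      by (simp add: has_field_derivative_def linear_scale[OF has_derivative_linear[OF g]]
          mult.commute[of _ "frechet_derivative g _ w"] mult_commute_abs)
  qed
  let ?fu = "\<lambda>z. frechet_derivative f (at z) u"
  \<comment> \<open>The second difference is an increment in direction \<open>u\<close> of the
    difference of two parallel restrictions of \<open>f\<close>. The mean value theorem in
    \<open>u\<close> and then in \<open>v\<close> brings out the two factors
    \<open>h\<close>.\<close>
  have "DERIV (\<lambda>s. f (x + h *\<^sub>R v + s *\<^sub>R u) - f (x + s *\<^sub>R u)) s :>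
      ?fu (x + h *\<^sub>R v + s *\<^sub>R u) - ?fu (x + s *\<^sub>R u)" if "0 \<le> s" "s \<le> h" for s
    using that seg[of s h] seg[of s 0] h
    by (intro DERIV_diff line[OF f]) (auto simp: algebra_simps)
  from MVT2[OF h this] obtain s where s: "0 < s" "s < h" and
    1: "f (x + h *\<^sub>R v + h *\<^sub>R u) - f (x + h *\<^sub>R u) - (f (x + h *\<^sub>R v) - f x) =
      h * (?fu (x + h *\<^sub>R v + s *\<^sub>R u) - ?fu (x + s *\<^sub>R u))"
    by auto
  have "DERIV (\<lambda>t. ?fu (x + s *\<^sub>R u + t *\<^sub>R v)) t :>
      frechet_derivative ?fu (at (x + s *\<^sub>R u + t *\<^sub>R v)) v" if "0 \<le> t" "t \<le> h" for t
    using that seg[of s t] s by (intro line[OF smooth_on_frechet_derivative[OF f]]) auto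
  from MVT2[OF h this] obtain t where "0 < t" "t < h" and
    2: "?fu (x + s *\<^sub>R u + h *\<^sub>R v) - ?fu (x + s *\<^sub>R u) =
      h * frechet_derivative ?fu (at (x + s *\<^sub>R u + t *\<^sub>R v)) v"
    by auto
  with s 1 2 show ?thesis
    by (intro exI[of _ s] exI[of _ t]) (simp add: algebra_simps)
qed

lemma frechet_derivative_symmetric:
  fixes f :: "'a::real_normed_vector \<Rightarrow> real"
  assumes S: "open S" "x \<in> S" and f: "smooth_on S f"
  shows "frechet_derivative (\<lambda>z. frechet_derivative f (at z) u) (at x) v =
    frechet_derivative (\<lambda>z. frechet_derivative f (at z) v) (at x) u" (is "?A x = ?B x")
proof (rule ccontr)
  assume ne: "?A x \<noteq> ?B x"
  \<comment> \<open>Half of the gap: a value of \<open>?A\<close> and an equal value of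
    \<open>?B\<close>, each within \<open>e\<close> of its value at \<open>x\<close>, would put
    these two values closer together than they are.\<close>
  define e where "e = \<bar>?A x - ?B x\<bar> / 2"
  have e: "e > 0" using ne by (simp add: e_def)
  have "continuous_on S ?A" "continuous_on S ?B"
    by (intro smooth_on_imp_continuous_on smooth_on_frechet_derivative f)+
  then have "isCont ?A x" "isCont ?B x"
    using S by (simp_all add: continuous_on_eq_continuous_at)
  then obtain d1 d2 where d1: "d1 > 0" "\<And>z. dist z x < d1 \<Longrightarrow> dist (?A z) (?A x) < e"
    and d2: "d2 > 0" "\<And>z. dist z x < d2 \<Longrightarrow> dist (?B z) (?B x) < e"
    unfolding continuous_at_eps_delta using e by metis
  obtain d3 where d3: "d3 > 0" "ball x d3 \<subseteq> S"
    using S open_contains_ball by blast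
  define d where "d = min d1 (min d2 d3)"
  \<comment> \<open>Every \<open>x + s u + t v\<close> with \<open>0 \<le> s, t \<le> h\<close> is
    then closer to \<open>x\<close> than \<open>d\<close>; the summand 1 keeps the denominator
    positive when both directions are zero.\<close>
  define h where "h = d / (norm u + norm v + 1)"
  have d: "d > 0" "d \<le> d1" "d \<le> d2" "d \<le> d3" using d1 d2 d3 by (auto simp: d_def)
  have pos: "norm u + norm v + 1 > 0" by (smt (verit) norm_ge_zero)
  have h: "h > 0" using d pos by (simp add: h_def)
  have near: "dist (x + s *\<^sub>R u + t *\<^sub>R v) x < d" if "s \<in> {0..h}" "t \<in> {0..h}" for s t
  proof -
    have "norm (s *\<^sub>R u + t *\<^sub>R v) \<le> \<bar>s\<bar> * norm u + \<bar>t\<bar> * norm v"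
      by (metis norm_scaleR norm_triangle_ineq)
    also have "\<dots> \<le> h * norm u + h * norm v"
      using that by (intro add_mono mult_right_mono) auto
    also have "\<dots> < h * (norm u + norm v + 1)"
      using h by (simp add: algebra_simps)
    also have "\<dots> = d" using pos by (simp add: h_def)
    finally show ?thesis by (simp add: dist_norm add.assoc)
  qed
  have sub: "x + s *\<^sub>R u + t *\<^sub>R v \<in> S" if "s \<in> {0..h}" "t \<in> {0..h}" for s t
    using near[OF that] d d3 by (auto simp: dist_commute)
  have sub': "x + s *\<^sub>R v + t *\<^sub>R u \<in> S" if "s \<in> {0..h}" "t \<in> {0..h}" for s t
    using sub[OF that(2,1)] by (simp add: algebra_simps)
  obtain s t where st: "s \<in> {0..h}" "t \<in> {0..h}" and
    1: "f (x + h *\<^sub>R u + h *\<^sub>R v) - f (x + h *\<^sub>R u) - f (x + h *\<^sub>R v) + f x =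
      h * (h * ?A (x + s *\<^sub>R u + t *\<^sub>R v))"
    using second_difference_mvt[OF f h sub] by blast
  obtain s' t' where st': "s' \<in> {0..h}" "t' \<in> {0..h}" and
    2: "f (x + h *\<^sub>R v + h *\<^sub>R u) - f (x + h *\<^sub>R v) - f (x + h *\<^sub>R u) + f x =
      h * (h * ?B (x + s' *\<^sub>R v + t' *\<^sub>R u))"
    using second_difference_mvt[OF f h sub'] by blast
  \<comment> \<open>Both second differences are the same number, so the two mixed derivatives agree
    at some pair of nearby points.\<close>
  have "h * (h * ?A (x + s *\<^sub>R u + t *\<^sub>R v)) = h * (h * ?B (x + s' *\<^sub>R v + t' *\<^sub>R u))"
    unfolding 1[symmetric] 2[symmetric] by (simp add: algebra_simps)
  then have "?A (x + s *\<^sub>R u + t *\<^sub>R v) = ?B (x + s' *\<^sub>R v + t' *\<^sub>R u)"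
    using h by simp
  moreover have "dist (?A (x + s *\<^sub>R u + t *\<^sub>R v)) (?A x) < e"
    using near[OF st] d by (intro d1) auto
  moreover have "dist (?B (x + s' *\<^sub>R v + t' *\<^sub>R u)) (?B x) < e"
    using near[OF st'(2,1)] d by (intro d2) (auto simp: algebra_simps)
  ultimately show False
    by (simp add: e_def dist_real_def abs_if split: if_splits)
qed

section \<open>Radial primitives and local bounds\<close>

lemma segment_in_ball:
  fixes x :: "'a::real_normed_vector"
  assumes "x \<in> ball x0 r" "t \<in> cbox 0 1"
  shows "x0 + t *\<^sub>R (x - x0) \<in> ball x0 r"
proof -
  have "norm (t *\<^sub>R (x - x0)) \<le> 1 * norm (x - x0)"
    using assms by (simp only: norm_scaleR, intro mult_right_mono) auto
  then show ?thesis using assms by (auto simp: dist_norm norm_minus_commute)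
qed

text \<open>The Poincare lemma with an error term: the radial primitive of a 1-form that is closed up to \<open>c\<close>.\<close>

lemma Poincare_defect:
  fixes \<Phi> :: "'a::euclidean_space \<Rightarrow> 'a \<Rightarrow>\<^sub>L 'b::euclidean_space"
  assumes d\<Phi>: "\<And>x. x \<in> ball x0 r \<Longrightarrow> (\<Phi> has_derivative blinfun_apply (\<Phi>' x)) (at x)"
    and cont: "continuous_on (ball x0 r) \<Phi>'"
  obtains Z where
    "\<And>x. x \<in> ball x0 r \<Longrightarrow> ((\<lambda>x. integral (cbox 0 1) (\<lambda>t. \<Phi> (x0 + t *\<^sub>R (x - x0)) (x - x0)))
        has_derivative blinfun_apply (Z x)) (at x)"
    "continuous_on (ball x0 r) Z"
    "\<And>c x. 0 \<le> c \<Longrightarrow> (\<And>x u v. x \<in> ball x0 r \<Longrightarrow> norm (\<Phi>' x u v - \<Phi>' x v u) \<le> c * norm u * norm v) \<Longrightarrow>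
        x \<in> ball x0 r \<Longrightarrow> norm (Z x - \<Phi> x) \<le> c * r"
proof -
  let ?B = "ball x0 r"
  define seg where "seg x t = x0 + t *\<^sub>R (x - x0)" for x and t :: real
  \<comment> \<open>The derivative in \<open>x\<close> of the integrand
    \<open>\<Phi> (seg x t) (x - x0)\<close>; the factor \<open>t\<close> comes from the dependence
    of \<open>seg x t\<close> on \<open>x\<close>.\<close>
  define fx where "fx x t = \<Phi> (seg x t) + t *\<^sub>R (blinfun.prod_left (x - x0) o\<^sub>L \<Phi>' (seg x t))" for x t
  have seg: "seg x t \<in> ?B" if "x \<in> ?B" "t \<in> cbox 0 1" for x t
    unfolding seg_def by (rule segment_in_ball[OF that])
  have c\<Phi>: "continuous_on ?B \<Phi>"
    using d\<Phi> by (auto intro!: continuous_at_imp_continuous_on has_derivative_continuous)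
  have cseg: "continuous_on T (\<lambda>p. seg (fst p) (snd p))" for T
    unfolding seg_def by (intro continuous_intros)
  have c1: "continuous_on (?B \<times> cbox 0 1) (\<lambda>p. \<Phi> (seg (fst p) (snd p)))"
    by (rule continuous_on_compose2[OF c\<Phi> cseg]) (use seg in auto)
  have c2: "continuous_on (?B \<times> cbox 0 1) (\<lambda>p. \<Phi>' (seg (fst p) (snd p)))"
    by (rule continuous_on_compose2[OF cont cseg]) (use seg in auto)
  have cfx: "continuous_on (?B \<times> cbox 0 1) (\<lambda>p. fx (fst p) (snd p))"
    unfolding fx_def
    by (intro continuous_intros c1 c2 bounded_linear.continuous_on[OF blinfun.bounded_linear_prod_left])
  have slice: "continuous_on (cbox 0 1) (\<lambda>t. g x t)"
    if "continuous_on (?B \<times> cbox 0 1) (\<lambda>p. g (fst p) (snd p))" "x \<in> ?B"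
    for g :: "'a \<Rightarrow> real \<Rightarrow> 'c::topological_space" and x
  proof -
    have "continuous_on (cbox 0 1) (\<lambda>t. g (fst (x, t)) (snd (x, t)))"
      by (rule continuous_on_compose2[OF that(1)]) (use that(2) in \<open>auto intro!: continuous_intros\<close>)
    then show ?thesis by simp
  qed
  have s1: "continuous_on (cbox 0 1) (\<lambda>t. \<Phi> (seg x t))" if "x \<in> ?B" for x
    using slice[of "\<lambda>x t. \<Phi> (seg x t)", OF c1 that] .
  have s2: "continuous_on (cbox 0 1) (\<lambda>t. \<Phi>' (seg x t))" if "x \<in> ?B" for x
    using slice[of "\<lambda>x t. \<Phi>' (seg x t)", OF c2 that] .
  have s3: "continuous_on (cbox 0 1) (fx x)" if "x \<in> ?B" for x
    using slice[of fx, OF cfx that] .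
  define Z where "Z x = integral (cbox 0 1) (fx x)" for x
  have 1: "((\<lambda>x. integral (cbox 0 1) (\<lambda>t. \<Phi> (seg x t) (x - x0))) has_derivative blinfun_apply (Z x)) (at x)"
    if x: "x \<in> ?B" for x
  proof -
    have "((\<lambda>x. integral (cbox 0 1) (\<lambda>t. \<Phi> (seg x t) (x - x0))) has_derivative
        blinfun_apply (integral (cbox 0 1) (fx x))) (at x within ?B)"
    proof (rule leibniz_rule)
      fix x t assume xt: "x \<in> ?B" "t \<in> cbox (0::real) 1"
      have "((\<lambda>x. seg x t) has_derivative (\<lambda>w. t *\<^sub>R w)) (at x)"
        unfolding seg_def by (auto intro!: derivative_eq_intros)
      from has_derivative_compose[OF this d\<Phi>[OF seg[OF xt]]]
      have "((\<lambda>x. \<Phi> (seg x t)) has_derivative (\<lambda>w. \<Phi>' (seg x t) (t *\<^sub>R w))) (at x)" .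
      then have "((\<lambda>x. \<Phi> (seg x t) (x - x0)) has_derivative
          (\<lambda>w. \<Phi> (seg x t) w + \<Phi>' (seg x t) (t *\<^sub>R w) (x - x0))) (at x)"
        by (rule blinfun.FDERIV) (auto intro!: derivative_eq_intros)
      moreover have "(\<lambda>w. \<Phi> (seg x t) w + \<Phi>' (seg x t) (t *\<^sub>R w) (x - x0)) = blinfun_apply (fx x t)"
        by (simp add: fun_eq_iff fx_def blinfun.bilinear_simps scaleR_diff_right)
      ultimately show "((\<lambda>x. \<Phi> (seg x t) (x - x0)) has_derivative blinfun_apply (fx x t)) (at x within ?B)"
        by (simp only: has_derivative_at_withinI)
    next
      show "(\<lambda>t. \<Phi> (seg x t) (x - x0)) integrable_on cbox 0 1" if "x \<in> ?B" for x
        by (intro integrable_continuous continuous_intros s1 that)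
      show "continuous_on (?B \<times> cbox 0 1) (\<lambda>(x, t). fx x t)"
        using cfx by (simp add: case_prod_unfold)
    qed (use x in auto)
    then show ?thesis unfolding Z_def at_within_open[OF x open_ball] .
  qed
  have 2: "continuous_on ?B Z"
    unfolding Z_def using cfx by (intro integral_continuous_on_param) (simp add: case_prod_unfold)
  have 3: "norm (Z x - \<Phi> x) \<le> c * r"
    if c: "0 \<le> c" and defect: "\<And>x u v. x \<in> ?B \<Longrightarrow> norm (\<Phi>' x u v - \<Phi>' x v u) \<le> c * norm u * norm v"
      and x: "x \<in> ?B" for c x
  proof -
    \<comment> \<open>The derivative of \<open>t \<Phi>(seg x t)\<close>, so its integral over [0,1]
      is exactly \<open>\<Phi> x\<close>. The comparison with \<open>fx\<close> leaves only
      \<open>t\<close> times the antisymmetric part of \<open>\<Phi>'\<close>, with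
      \<open>x - x0\<close> in one slot.\<close>
    define k where "k t = \<Phi> (seg x t) + t *\<^sub>R \<Phi>' (seg x t) (x - x0)" for t
    have vd: "((\<lambda>t. t *\<^sub>R \<Phi> (seg x t)) has_vector_derivative k t) (at t within {0..1})"
      if "t \<in> {0..1}" for t
    proof -
      have "((\<lambda>t. seg x t) has_derivative (\<lambda>s. s *\<^sub>R (x - x0))) (at t)"
        unfolding seg_def by (auto intro!: derivative_eq_intros)
      from has_derivative_compose[OF this d\<Phi>[OF seg]] x that
      have "((\<lambda>t. \<Phi> (seg x t)) has_derivative (\<lambda>s. \<Phi>' (seg x t) (s *\<^sub>R (x - x0)))) (at t)"
        by simp
      then have "((\<lambda>t. t *\<^sub>R \<Phi> (seg x t)) has_derivative
          (\<lambda>s. t *\<^sub>R \<Phi>' (seg x t) (s *\<^sub>R (x - x0)) + s *\<^sub>R \<Phi> (seg x t))) (at t)"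
        by (auto intro!: derivative_eq_intros)
      moreover have "(\<lambda>s. t *\<^sub>R \<Phi>' (seg x t) (s *\<^sub>R (x - x0)) + s *\<^sub>R \<Phi> (seg x t)) = (\<lambda>s. s *\<^sub>R k t)"
        by (rule ext) (simp add: k_def blinfun.scaleR_right scaleR_add_right scaleR_left_commute add.commute)
      ultimately show ?thesis unfolding has_vector_derivative_def
        by (simp only: has_derivative_at_withinI)
    qed
    have "(k has_integral 1 *\<^sub>R \<Phi> (seg x 1) - 0 *\<^sub>R \<Phi> (seg x 0)) {0..1}"
      by (rule fundamental_theorem_of_calculus[OF _ vd]) auto
    then have k: "(k has_integral \<Phi> x) {0..1}" by (simp add: seg_def)
    have "(fx x has_integral Z x) {0..1}"
      using s3[OF x] unfolding Z_def by (metis box_real(2) integrable_continuous integrable_integral)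
    from has_integral_diff[OF this k] have int: "((\<lambda>t. fx x t - k t) has_integral Z x - \<Phi> x) {0..1}" .
    have bnd: "norm (fx x t - k t) \<le> c * r" if t: "t \<in> {0..1}" for t
    proof (rule norm_blinfun_bound)
      have r: "norm (x - x0) \<le> r" "0 \<le> r"
        using x zero_le_dist[of x0 x] unfolding mem_ball by (simp_all only: dist_norm norm_minus_commute[of x0 x])
      then show "0 \<le> c * r" using c by simp
      fix w
      have "norm (blinfun_apply (fx x t - k t) w) =
          \<bar>t\<bar> * norm (\<Phi>' (seg x t) w (x - x0) - \<Phi>' (seg x t) (x - x0) w)"
        by (simp add: fx_def k_def blinfun.bilinear_simps norm_scaleR[symmetric] scaleR_diff_right[symmetric]
            del: norm_scaleR)
      also have "\<dots> \<le> 1 * (c * norm w * norm (x - x0))"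
        using t x by (intro mult_mono defect seg) auto
      also have "\<dots> \<le> c * r * norm w"
        using r c by (simp add: mult.assoc mult.commute[of r] mult_left_mono mult_right_mono)
      finally show "norm (blinfun_apply (fx x t - k t) w) \<le> c * r * norm w" .
    qed
    have "norm (integral {0..1} (\<lambda>t. fx x t - k t)) \<le> c * r * (1 - 0)"
      unfolding k_def using s1[OF x] s2[OF x] s3[OF x]
      by (intro integral_bound bnd[unfolded k_def] continuous_intros) auto
    then show ?thesis using integral_unique[OF int] by simp
  qed
  show ?thesis
    using that[of Z] 1 2 3 unfolding seg_def by blast
qed

lemma C1_local_bounds:
  fixes F :: "'a::euclidean_space \<times> 'b::euclidean_space \<Rightarrow> 'c::real_normed_vector"
  assumes \<Omega>: "open \<Omega>" "(x0, y0) \<in> \<Omega>"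
    and dF: "\<And>z. z \<in> \<Omega> \<Longrightarrow> (F has_derivative blinfun_apply (F' z)) (at z)"
    and cF': "continuous_on \<Omega> F'"
  obtains \<rho> K where "0 < \<rho>" "0 < K" "cball x0 \<rho> \<times> cball y0 \<rho> \<subseteq> \<Omega>"
    "\<And>x y. x \<in> cball x0 \<rho> \<Longrightarrow> y \<in> cball y0 \<rho> \<Longrightarrow> norm (F (x, y)) \<le> K"
    "\<And>x y. x \<in> cball x0 \<rho> \<Longrightarrow> y \<in> cball y0 \<rho> \<Longrightarrow> norm (F' (x, y)) \<le> K"
    "\<And>x y y'. x \<in> cball x0 \<rho> \<Longrightarrow> y \<in> cball y0 \<rho> \<Longrightarrow> y' \<in> cball y0 \<rho> \<Longrightarrow>
      norm (F (x, y) - F (x, y')) \<le> K * norm (y - y')"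
proof -
  obtain e where e: "0 < e" "cball (x0, y0) e \<subseteq> \<Omega>"
    using \<Omega> open_contains_cball by blast
  \<comment> \<open>Half the radius, because the product distance is at most the sum of the two
    component distances.\<close>
  let ?C = "cball x0 (e/2) \<times> cball y0 (e/2)"
  have sub: "?C \<subseteq> \<Omega>"
  proof clarify
    fix x y assume "x \<in> cball x0 (e/2)" "y \<in> cball y0 (e/2)"
    then have "dist (x0, y0) (x, y) \<le> e"
      using sqrt_sum_squares_le_sum[of "dist x0 x" "dist y0 y"] by (simp add: dist_Pair_Pair)
    then show "(x, y) \<in> \<Omega>" using e by auto
  qed
  have comp: "compact ?C" by (intro compact_Times compact_cball)
  have cF: "continuous_on ?C F"
    using dF sub by (auto intro!: continuous_at_imp_continuous_on has_derivative_continuous)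
  have "bounded (F ` ?C)" "bounded (F' ` ?C)"
    using comp cF continuous_on_subset[OF cF' sub]
    by (auto intro!: compact_imp_bounded compact_continuous_image)
  then obtain K1 K2 where K1: "\<And>z. z \<in> ?C \<Longrightarrow> norm (F z) \<le> K1" and K2: "\<And>z. z \<in> ?C \<Longrightarrow> norm (F' z) \<le> K2"
    unfolding bounded_iff by (metis imageI)
  \<comment> \<open>The value 1 keeps \<open>K\<close> positive, so that it may serve as a
    denominator in the choice of radii.\<close>
  define K where "K = max 1 (max K1 K2)"
  have b: "norm (F z) \<le> K" "norm (F' z) \<le> K" if "z \<in> ?C" for z
    using K1[OF that] K2[OF that] by (auto simp: K_def)
  have lip: "norm (F (x, y) - F (x, y')) \<le> K * norm (y - y')"
    if "x \<in> cball x0 (e/2)" "y \<in> cball y0 (e/2)" "y' \<in> cball y0 (e/2)" for x y y'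
  proof -
    have "norm (F (x, y) - F (x, y')) \<le> K * norm ((x, y) - (x, y'))"
    proof (rule differentiable_bound[of ?C F "\<lambda>z. blinfun_apply (F' z)"])
      show "(F has_derivative blinfun_apply (F' z)) (at z within ?C)" if "z \<in> ?C" for z
        using that sub dF by (blast intro: has_derivative_at_withinI)
      show "onorm (blinfun_apply (F' z)) \<le> K" if "z \<in> ?C" for z
        using b(2)[OF that] by (simp add: norm_blinfun.rep_eq)
    qed (use that in \<open>auto intro!: convex_Times convex_cball\<close>)
    then show ?thesis by (simp add: norm_Pair)
  qed
  show ?thesis
    using e sub b lip by (intro that[of "e/2" K]) (auto simp: K_def)
qed

text \<open>Once \<open>dy = F(x, y)\<close>, the term \<open>F' z (u, F z u)\<close> is the
  derivative of \<open>F(x, y x)\<close> in direction \<open>u\<close>; \<open>compat\<close> is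
  therefore the symmetry of the second derivative that a solution would have. A fixed point of the
  radial integral operator solves the system along rays only; control of the errors of the iterates
  yields the equation in every direction.\<close>

theorem Frobenius_existence:
  fixes F :: "'a::euclidean_space \<times> 'b::euclidean_space \<Rightarrow> 'a \<Rightarrow>\<^sub>L 'b"
  assumes \<Omega>: "open \<Omega>" "(x0, y0) \<in> \<Omega>"
    and dF: "\<And>z. z \<in> \<Omega> \<Longrightarrow> (F has_derivative blinfun_apply (F' z)) (at z)"
    and cF': "continuous_on \<Omega> F'"
    and compat: "\<And>z u v. z \<in> \<Omega> \<Longrightarrow> F' z (u, F z u) v = F' z (v, F z v) u"
  obtains r y where "0 < r" "y x0 = y0" "\<And>x. x \<in> ball x0 r \<Longrightarrow> (x, y x) \<in> \<Omega>"
    "\<And>x. x \<in> ball x0 r \<Longrightarrow> (y has_derivative blinfun_apply (F (x, y x))) (at x)"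
proof -
  obtain \<rho> K where \<rho>: "0 < \<rho>" and K: "0 < K" and sub: "cball x0 \<rho> \<times> cball y0 \<rho> \<subseteq> \<Omega>"
    and F: "\<And>x y. x \<in> cball x0 \<rho> \<Longrightarrow> y \<in> cball y0 \<rho> \<Longrightarrow> norm (F (x, y)) \<le> K"
    and F': "\<And>x y. x \<in> cball x0 \<rho> \<Longrightarrow> y \<in> cball y0 \<rho> \<Longrightarrow> norm (F' (x, y)) \<le> K"
    and lip: "\<And>x y y'. x \<in> cball x0 \<rho> \<Longrightarrow> y \<in> cball y0 \<rho> \<Longrightarrow> y' \<in> cball y0 \<rho> \<Longrightarrow>
      norm (F (x, y) - F (x, y')) \<le> K * norm (y - y')"
    using C1_local_bounds[OF \<Omega> dF cF'] by blast
  \<comment> \<open>\<open>r \<le> \<rho>\<close> and \<open>K r \<le> \<rho>\<close> keep the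
    iterates inside the region where the bounds hold. \<open>K r \<le> 1/4\<close> makes
    \<open>T\<close> contract by 1/4 and makes the factor \<open>2 K r\<close> of the error estimate
    at most 1/2.\<close>
  define r where "r = min \<rho> (min (\<rho> / K) (1 / (4 * K)))"
  have r: "0 < r" "r \<le> \<rho>" using \<rho> K by (auto simp: r_def)
  have "r \<le> \<rho> / K" "r \<le> 1 / (4 * K)" by (auto simp: r_def)
  then have Kr: "K * r \<le> \<rho>" "K * r \<le> 1/4" using K by (auto simp: field_simps)
  let ?B = "ball x0 r"
  have B\<rho>: "x \<in> cball x0 \<rho>" if "x \<in> ?B" for x using that r by auto
  define seg where "seg x t = x0 + t *\<^sub>R (x - x0)" for x and t :: real
  have seg: "seg x t \<in> ?B" if "x \<in> ?B" "t \<in> cbox 0 1" for x t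
    unfolding seg_def by (rule segment_in_ball[OF that])
  define T where "T Y x = y0 + integral (cbox 0 1) (\<lambda>t. F (seg x t, Y (seg x t)) (x - x0))" for Y x
  define good where "good Y \<longleftrightarrow> continuous_on ?B Y \<and> Y ` ?B \<subseteq> cball y0 \<rho>" for Y
  have goodD: "(x, Y x) \<in> \<Omega>" "Y x \<in> cball y0 \<rho>" if "good Y" "x \<in> ?B" for Y x
  proof -
    show "Y x \<in> cball y0 \<rho>" using that unfolding good_def by (metis image_subset_iff)
    with B\<rho>[OF that(2)] show "(x, Y x) \<in> \<Omega>" using sub by (metis SigmaI subsetD)
  qed
  have cF: "continuous_on \<Omega> F"
    using dF by (auto intro!: continuous_at_imp_continuous_on has_derivative_continuous)
  have cseg: "continuous_on (cbox 0 1) (\<lambda>t. F (seg x t, Y (seg x t)) (x - x0))"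
    if Y: "good Y" and x: "x \<in> ?B" for Y x
  proof -
    have s: "continuous_on (cbox 0 1) (seg x)" unfolding seg_def by (intro continuous_intros)
    have Ys: "continuous_on (cbox 0 1) (\<lambda>t. Y (seg x t))"
      by (rule continuous_on_compose2[OF _ s]) (use Y x seg in \<open>auto simp: good_def\<close>)
    have "continuous_on (cbox 0 1) (\<lambda>t. F (seg x t, Y (seg x t)))"
      by (rule continuous_on_compose2[OF cF continuous_on_Pair[OF s Ys]])
        (use goodD(1)[OF Y] seg[OF x] in auto)
    then show ?thesis by (intro continuous_intros)
  qed
  have step_le: "norm (F (seg x t, Y (seg x t)) (x - x0)) \<le> K * r"
    if "good Y" "x \<in> ?B" "t \<in> {0..1}" for Y x t
  proof -
    have "norm (F (seg x t, Y (seg x t))) \<le> K"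
      using that seg[of x t] by (intro F B\<rho> goodD) auto
    moreover have "norm (x - x0) \<le> r" using that by (auto simp: dist_norm norm_minus_commute)
    ultimately show ?thesis
      using K by (intro order_trans[OF norm_blinfun] mult_mono) auto
  qed
  have Tbound: "T Y x \<in> cball y0 \<rho>" if "good Y" "x \<in> ?B" for Y x
  proof -
    have "norm (integral {0..1} (\<lambda>t. F (seg x t, Y (seg x t)) (x - x0))) \<le> K * r * (1 - 0)"
      using cseg[OF that] step_le[OF that] by (intro integral_bound) auto
    then show ?thesis using Kr by (simp add: T_def dist_norm)
  qed
  have Tdiff: "norm (T Y x - T Y' x) \<le> 1/4 * c"
    if Y: "good Y" "good Y'" and x: "x \<in> ?B" and c: "\<And>x. x \<in> ?B \<Longrightarrow> norm (Y x - Y' x) \<le> c" for Y Y' x c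
  proof -
    let ?G = "\<lambda>t. F (seg x t, Y (seg x t)) (x - x0) - F (seg x t, Y' (seg x t)) (x - x0)"
    have "norm (?G t) \<le> K * c * r" if t: "t \<in> {0..1}" for t
    proof -
      have s: "seg x t \<in> ?B" using seg x t by auto
      have "norm (F (seg x t, Y (seg x t)) - F (seg x t, Y' (seg x t))) \<le> K * norm (Y (seg x t) - Y' (seg x t))"
        using s Y by (intro lip B\<rho> goodD)
      also have "\<dots> \<le> K * c" using c[OF s] K by simp
      finally have "norm (F (seg x t, Y (seg x t)) - F (seg x t, Y' (seg x t))) * norm (x - x0) \<le> K * c * r"
        using x by (intro mult_mono) (auto simp: dist_norm norm_minus_commute intro: order_trans[OF norm_ge_zero])
      then show ?thesis
        unfolding blinfun.diff_left[symmetric] by (rule order_trans[OF norm_blinfun])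
    qed
    then have "norm (integral {0..1} ?G) \<le> K * c * r * (1 - 0)"
      using cseg[OF Y(1) x] cseg[OF Y(2) x] by (intro integral_bound continuous_on_diff) auto
    moreover have "T Y x - T Y' x = integral {0..1} ?G"
      unfolding T_def using cseg[OF Y(1) x] cseg[OF Y(2) x]
      by (subst integral_diff) (auto intro!: integrable_continuous_interval)
    moreover have "0 \<le> c" using c[OF x] order_trans[OF norm_ge_zero] by blast
    then have "K * r * c \<le> 1/4 * c" using Kr by (intro mult_right_mono) auto
    ultimately show ?thesis by (simp add: mult_ac)
  qed
  define almost where "almost Y w \<longleftrightarrow> good Y \<and> (\<exists>Y'. continuous_on ?B Y' \<and>
      (\<forall>x\<in>?B. (Y has_derivative blinfun_apply (Y' x)) (at x) \<and> norm (Y' x - F (x, Y x)) \<le> w))" for Y w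
  \<comment> \<open>The derivative of \<open>T Y\<close> is compared with \<open>F\<close> along
    \<open>Y\<close> by the Poincare estimate, at a cost of \<open>2 K w r \<le> w/2\<close>; then
    \<open>F\<close> along \<open>Y\<close> is compared with \<open>F\<close> along
    \<open>T Y\<close> by the Lipschitz bound, at a cost of \<open>K c\<close>.\<close>
  have Talmost: "almost (T Y) (w/2 + K * c)"
    if Y: "almost Y w" and c: "\<And>x. x \<in> ?B \<Longrightarrow> norm (T Y x - Y x) \<le> c" for Y w c
  proof -
    have gY: "good Y" using Y by (simp add: almost_def)
    obtain Y' where cY': "continuous_on ?B Y'"
      and dY: "\<And>x. x \<in> ?B \<Longrightarrow> (Y has_derivative blinfun_apply (Y' x)) (at x)"
      and defY: "\<And>x. x \<in> ?B \<Longrightarrow> norm (Y' x - F (x, Y x)) \<le> w"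
      using Y unfolding almost_def by blast
    have w0: "0 \<le> w" using defY[of x0] r order_trans[OF norm_ge_zero] by fastforce
    \<comment> \<open>The two inclusions express the derivative
      \<open>u \<mapsto> (u, Y' x u)\<close> of the graph as an operator, so that continuity of
      \<open>\<Phi>'\<close> in operator norm reduces to that of \<open>F'\<close> and
      \<open>Y'\<close>.\<close>
    define E1 :: "'a \<Rightarrow>\<^sub>L ('a \<times> 'b)" where "E1 = Blinfun (\<lambda>u. (u, 0))"
    define E2 :: "'b \<Rightarrow>\<^sub>L ('a \<times> 'b)" where "E2 = Blinfun (\<lambda>y. (0, y))"
    have [simp]: "blinfun_apply E1 u = (u, 0)" for u
      unfolding E1_def by (subst bounded_linear_Blinfun_apply)
        (auto intro!: bounded_linear_Pair bounded_linear_ident bounded_linear_zero)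
    have [simp]: "blinfun_apply E2 u = (0, u)" for u
      unfolding E2_def by (subst bounded_linear_Blinfun_apply)
        (auto intro!: bounded_linear_Pair bounded_linear_ident bounded_linear_zero)
    define \<Phi> where "\<Phi> x = F (x, Y x)" for x
    define \<Phi>' where "\<Phi>' x = F' (x, Y x) o\<^sub>L (E1 + (E2 o\<^sub>L Y' x))" for x
    have \<Phi>'_apply: "blinfun_apply (\<Phi>' x) u = F' (x, Y x) (u, Y' x u)" for x u
      by (simp add: \<Phi>'_def plus_blinfun.rep_eq)
    have d\<Phi>: "(\<Phi> has_derivative blinfun_apply (\<Phi>' x)) (at x)" if x: "x \<in> ?B" for x
    proof -
      have "((\<lambda>x. (x, Y x)) has_derivative (\<lambda>u. (u, Y' x u))) (at x)"
        by (intro has_derivative_Pair has_derivative_ident dY x)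
      from has_derivative_compose[OF this dF[OF goodD(1)[OF gY x]]]
      show ?thesis by (simp add: \<Phi>_def[abs_def] \<Phi>'_apply[abs_def])
    qed
    have cY: "continuous_on ?B Y" using gY by (simp add: good_def)
    have "continuous_on ?B (\<lambda>x. F' (x, Y x))"
      by (rule continuous_on_compose2[OF cF']) (use goodD(1)[OF gY] cY in \<open>auto intro!: continuous_intros\<close>)
    then have c\<Phi>': "continuous_on ?B \<Phi>'"
      unfolding \<Phi>'_def by (intro continuous_intros cY')
    obtain Z where
      Z: "\<And>x. x \<in> ?B \<Longrightarrow> ((\<lambda>x. integral (cbox 0 1) (\<lambda>t. \<Phi> (x0 + t *\<^sub>R (x - x0)) (x - x0)))
        has_derivative blinfun_apply (Z x)) (at x)" and
      cZ: "continuous_on ?B Z" and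
      defZ: "\<And>c x. 0 \<le> c \<Longrightarrow> (\<And>x u v. x \<in> ?B \<Longrightarrow> norm (\<Phi>' x u v - \<Phi>' x v u) \<le> c * norm u * norm v) \<Longrightarrow>
        x \<in> ?B \<Longrightarrow> norm (Z x - \<Phi> x) \<le> c * r"
      using Poincare_defect[OF d\<Phi> c\<Phi>'] by blast
    have dT: "(T Y has_derivative blinfun_apply (Z x)) (at x)" if "x \<in> ?B" for x
      using has_derivative_add[OF has_derivative_const[of y0] Z[OF that]]
      by (simp add: T_def[abs_def] \<Phi>_def seg_def)
    have gT: "good (T Y)"
      unfolding good_def using Tbound[OF gY] dT
      by (auto intro!: continuous_at_imp_continuous_on has_derivative_continuous)
    \<comment> \<open>By \<open>compat\<close>, only the defect of \<open>Y\<close> contributes to the antisymmetric part of \<open>\<Phi>'\<close>.\<close>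
    have anti: "norm (\<Phi>' x u v - \<Phi>' x v u) \<le> 2 * K * w * norm u * norm v" if x: "x \<in> ?B" for x u v
    proof -
      have half: "norm (F' (x, Y x) (0, Y' x u - F (x, Y x) u) v) \<le> K * (w * norm u) * norm v" for u v
      proof -
        have "norm (Y' x u - F (x, Y x) u) \<le> w * norm u"
          using norm_blinfun[of "Y' x - F (x, Y x)" u] defY[OF x] mult_right_mono[OF defY[OF x], of "norm u"]
          by (simp add: blinfun.diff_left)
        moreover have "norm (F' (x, Y x)) \<le> K" using x by (intro F' B\<rho> goodD(2)[OF gY])
        ultimately have "norm (F' (x, Y x) (0, Y' x u - F (x, Y x) u)) \<le> K * (w * norm u)"
          using K by (intro order_trans[OF norm_blinfun] mult_mono) (auto simp: norm_Pair)
        then show ?thesis by (rule order_trans[OF norm_blinfun mult_right_mono]) simp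
      qed
      have split: "F' (x, Y x) (u, Y' x u) = F' (x, Y x) (u, F (x, Y x) u) + F' (x, Y x) (0, Y' x u - F (x, Y x) u)" for u
        by (simp add: blinfun.add_right[symmetric])
      have "\<Phi>' x u v - \<Phi>' x v u = F' (x, Y x) (0, Y' x u - F (x, Y x) u) v
          - F' (x, Y x) (0, Y' x v - F (x, Y x) v) u"
        using compat[OF goodD(1)[OF gY x], of u v]
        by (simp add: \<Phi>'_apply split[of u] split[of v] blinfun.add_left)
      also have "norm \<dots> \<le> K * (w * norm u) * norm v + K * (w * norm v) * norm u"
        by (intro order_trans[OF norm_triangle_ineq4] add_mono half)
      finally show ?thesis by (simp add: algebra_simps)
    qed
    have "norm (Z x - F (x, T Y x)) \<le> w/2 + K * c" if x: "x \<in> ?B" for x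
    proof -
      have "norm (Z x - \<Phi> x) \<le> 2 * K * w * r"
        using K w0 by (intro defZ anti x) auto
      also have "\<dots> \<le> w/2" using mult_right_mono[OF Kr(2) w0] by (simp add: algebra_simps)
      finally have 1: "norm (Z x - \<Phi> x) \<le> w/2" .
      have "norm (\<Phi> x - F (x, T Y x)) \<le> K * norm (Y x - T Y x)"
        unfolding \<Phi>_def by (intro lip B\<rho> x goodD(2)[OF gY] goodD(2)[OF gT])
      also have "\<dots> \<le> K * c" using c[OF x] K by (simp add: norm_minus_commute)
      finally have "norm (\<Phi> x - F (x, T Y x)) \<le> K * c" .
      with 1 show ?thesis
        using norm_triangle_ineq[of "Z x - \<Phi> x" "\<Phi> x - F (x, T Y x)"] by simp
    qed
    with dT cZ gT show ?thesis unfolding almost_def by blast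
  qed
  define Y where "Y m = (T ^^ m) (\<lambda>_. y0)" for m
  have Y0: "Y 0 = (\<lambda>_. y0)" and YS: "Y (Suc m) = T (Y m)" for m
    by (simp_all add: Y_def)
  \<comment> \<open>A bound compatible with the recursion
    \<open>w \<mapsto> w/2 + K/4 (1/2)^m\<close>: halving reproduces the geometric factor, and the
    growing factor \<open>m + 1\<close> absorbs the new term. The product still tends to 0.\<close>
  define W where "W m = 2 * K * (real m + 1) * (1/2)^m" for m
  have inv: "almost (Y m) (W m) \<and> (\<forall>x\<in>?B. norm (T (Y m) x - Y m x) \<le> 1/4 * (1/2)^m)" for m
  proof (induction m)
    case 0
    have g: "good (Y 0)" using \<rho> by (auto simp: good_def Y0)
    have "norm (F (x, y0)) \<le> 2 * K" if "x \<in> ?B" for x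
      using F[OF B\<rho>[OF that], of y0] \<rho> K by auto
    then have "almost (Y 0) (W 0)"
      using g unfolding almost_def by (intro conjI exI[of _ "\<lambda>_. 0"]) (auto simp: Y0 W_def zero_blinfun.rep_eq)
    moreover have "norm (T (Y 0) x - Y 0 x) \<le> 1/4 * (1/2)^0" if "x \<in> ?B" for x
    proof -
      have "norm (integral {0..1} (\<lambda>t. F (seg x t, Y 0 (seg x t)) (x - x0))) \<le> K * r * (1 - 0)"
        using cseg[OF g that] step_le[OF g that] by (intro integral_bound) auto
      then show ?thesis using Kr by (simp add: T_def Y0)
    qed
    ultimately show ?case by blast
  next
    case (Suc m)
    then have IH: "almost (Y m) (W m)" "\<And>x. x \<in> ?B \<Longrightarrow> norm (T (Y m) x - Y m x) \<le> 1/4 * (1/2)^m"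
      by auto
    have a: "almost (Y (Suc m)) (W m / 2 + K * (1/4 * (1/2)^m))"
      unfolding YS by (rule Talmost[OF IH])
    have le: "W m / 2 + K * (1/4 * (1/2)^m) \<le> W (Suc m)"
      using K by (simp add: W_def field_simps)
    have "almost (Y (Suc m)) (W (Suc m))"
      using a le unfolding almost_def by (meson order_trans)
    moreover have "norm (T (Y (Suc m)) x - Y (Suc m) x) \<le> 1/4 * (1/2)^Suc m" if "x \<in> ?B" for x
    proof -
      have "norm (T (Y (Suc m)) x - T (Y m) x) \<le> 1/4 * (1/4 * (1/2)^m)"
        using a IH(1) IH(2) that by (intro Tdiff) (auto simp: almost_def YS)
      also have "\<dots> \<le> 1/4 * (1/2)^Suc m" by simp
      finally show ?thesis by (simp only: YS)
    qed
    ultimately show ?case by blast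
  qed
  have good: "good (Y m)" for m using inv by (simp add: almost_def)
  have "\<exists>Y'. \<forall>m. \<forall>x\<in>?B. (Y m has_derivative blinfun_apply (Y' m x)) (at x) \<and> norm (Y' m x - F (x, Y m x)) \<le> W m"
    using inv unfolding almost_def by metis
  then obtain Y' where dY: "\<And>m x. x \<in> ?B \<Longrightarrow> (Y m has_derivative blinfun_apply (Y' m x)) (at x)"
    and defY: "\<And>m x. x \<in> ?B \<Longrightarrow> norm (Y' m x - F (x, Y m x)) \<le> W m" by blast
  \<comment> \<open>The limit of the iterates, written as a telescoping series that is dominated by
    the geometric series of the step sizes.\<close>
  define y where "y x = y0 + (\<Sum>m. Y (Suc m) x - Y m x)" for x
  have "uniform_limit ?B (\<lambda>n x. \<Sum>i<n. Y (Suc i) x - Y i x) (\<lambda>x. \<Sum>i. Y (Suc i) x - Y i x) sequentially"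
  proof (rule Weierstrass_m_test)
    show "norm (Y (Suc n) x - Y n x) \<le> 1/4 * (1/2)^n" if "x \<in> ?B" for n x
      using inv that by (simp add: YS)
    show "summable (\<lambda>n. 1/4 * (1/2::real)^n)" by (intro summable_mult summable_geometric) auto
  qed
  moreover have "(\<Sum>i<n. Y (Suc i) x - Y i x) = Y n x - y0" for n x
    using sum_lessThan_telescope[of "\<lambda>i. Y i x" n] by (simp add: Y0)
  ultimately have ul: "uniform_limit ?B (\<lambda>n x. Y n x - y0) (\<lambda>x. y x - y0) sequentially"
    by (simp add: y_def)
  have uY: "\<forall>\<^sub>F n in sequentially. \<forall>x\<in>?B. norm (Y n x - y x) < e" if "0 < e" for e
    using uniform_limitD[OF ul that] by (simp add: dist_norm)
  have lim: "(\<lambda>n. Y n x) \<longlonglongrightarrow> y x" if "x \<in> ?B" for x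
    unfolding tendsto_iff dist_norm
  proof (intro allI impI)
    fix e :: real assume "0 < e"
    from uY[OF this] show "\<forall>\<^sub>F n in sequentially. norm (Y n x - y x) < e"
      by (rule eventually_mono) (use that in blast)
  qed
  have y\<rho>: "y x \<in> cball y0 \<rho>" if "x \<in> ?B" for x
    using closed_sequentially[OF closed_cball _ lim[OF that]] goodD(2)[OF good that] by blast
  \<comment> \<open>The derivatives \<open>Y' n\<close> converge uniformly to \<open>F\<close> along
    \<open>y\<close>: their errors \<open>W n\<close> tend to 0, and \<open>F\<close> is Lipschitz
    in its second argument. Hence the limit has the prescribed derivative in all directions.\<close>
  have "\<exists>g. \<forall>x\<in>?B. (\<lambda>n. Y n x) \<longlonglongrightarrow> g x \<and> (g has_derivative blinfun_apply (F (x, y x))) (at x within ?B)"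
  proof (rule has_derivative_sequence)
    show "(Y n has_derivative blinfun_apply (Y' n x)) (at x within ?B)" if "x \<in> ?B" for n x
      using dY[OF that] by (rule has_derivative_at_withinI)
    show "\<forall>\<^sub>F n in sequentially. \<forall>x\<in>?B. \<forall>h. norm (Y' n x h - F (x, y x) h) \<le> e * norm h" if e: "0 < e" for e
    proof -
      have "W \<longlonglongrightarrow> 0"
      proof -
        have "(\<lambda>n. 2 * K * ((real n * (1/2)^n) + (1/2)^n)) \<longlonglongrightarrow> 2 * K * (0 + 0)"
          by (intro tendsto_intros powser_times_n_limit_0[of "1/2::real"] LIMSEQ_power_zero) auto
        then show ?thesis by (simp add: W_def[abs_def] algebra_simps)
      qed
      then have "\<forall>\<^sub>F n in sequentially. W n < e/2"
        using e by (intro order_tendstoD) auto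
      moreover have "\<forall>\<^sub>F n in sequentially. \<forall>x\<in>?B. norm (Y n x - y x) < e / (2 * K)"
        using e K by (intro uY) auto
      ultimately show ?thesis
      proof eventually_elim
        case (elim n)
        show ?case
        proof (intro ballI allI)
          fix x and h :: 'a assume x: "x \<in> ?B"
          have "norm (F (x, Y n x) - F (x, y x)) \<le> K * norm (Y n x - y x)"
            using x by (intro lip B\<rho> y\<rho> goodD(2)[OF good])
          also have "\<dots> \<le> e/2"
            using elim(2) x K by (force simp: field_simps)
          finally have "norm (Y' n x - F (x, y x)) \<le> e"
            using norm_triangle_ineq[of "Y' n x - F (x, Y n x)" "F (x, Y n x) - F (x, y x)"]
              defY[OF x, of n] elim(1) by simp
          then have "norm (Y' n x - F (x, y x)) * norm h \<le> e * norm h"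
            by (rule mult_right_mono) simp
          then show "norm (Y' n x h - F (x, y x) h) \<le> e * norm h"
            using norm_blinfun[of "Y' n x - F (x, y x)" h] by (simp add: blinfun.diff_left)
        qed
      qed
    qed
    show "x0 \<in> ?B" "(\<lambda>n. Y n x0) \<longlonglongrightarrow> y x0" using r lim[of x0] by auto
  qed auto
  then obtain g where g: "\<And>x. x \<in> ?B \<Longrightarrow> (\<lambda>n. Y n x) \<longlonglongrightarrow> g x"
    "\<And>x. x \<in> ?B \<Longrightarrow> (g has_derivative blinfun_apply (F (x, y x))) (at x within ?B)"
    by blast
  have gy: "g x = y x" if "x \<in> ?B" for x
    using LIMSEQ_unique[OF g(1) lim] that by blast
  have dy: "(y has_derivative blinfun_apply (F (x, y x))) (at x)" if "x \<in> ?B" for x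
  proof -
    have "(g has_derivative blinfun_apply (F (x, y x))) (at x)"
      using g(2)[OF that] unfolding at_within_open[OF that open_ball] .
    then show ?thesis
      by (rule has_derivative_transform_within_open[OF _ open_ball that]) (rule gy)
  qed
  have "Y n x0 = y0" for n by (induction n) (simp_all add: Y0 YS T_def)
  then have "y x0 = y0" by (simp add: y_def)
  then show ?thesis
  proof (rule that[OF r(1)])
    show "(x, y x) \<in> \<Omega>" if "x \<in> ?B" for x
      using y\<rho>[OF that] B\<rho>[OF that] sub by (metis SigmaI subsetD)
  qed (rule dy)
qed

text \<open>The difference of two solutions vanishes at \<open>x0\<close>, and its derivative is
  bounded by \<open>K\<close> times its own size. On a ball with \<open>K r \<le> 1/2\<close> its
  maximal norm is therefore at most half of itself.\<close>

theorem Frobenius_uniqueness: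
  fixes F :: "'a::euclidean_space \<times> 'b::euclidean_space \<Rightarrow> 'a \<Rightarrow>\<^sub>L 'b"
  assumes \<Omega>: "open \<Omega>" "(x0, y0) \<in> \<Omega>"
    and dF: "\<And>z. z \<in> \<Omega> \<Longrightarrow> (F has_derivative blinfun_apply (F' z)) (at z)"
    and cF': "continuous_on \<Omega> F'"
    and S: "open S" "x0 \<in> S"
    and y1: "y1 x0 = y0" "\<And>x. x \<in> S \<Longrightarrow> (y1 has_derivative blinfun_apply (F (x, y1 x))) (at x)"
    and y2: "y2 x0 = y0" "\<And>x. x \<in> S \<Longrightarrow> (y2 has_derivative blinfun_apply (F (x, y2 x))) (at x)"
  shows "\<forall>\<^sub>F x in nhds x0. y1 x = y2 x"
proof -
  obtain \<rho> K where \<rho>: "0 < \<rho>" and K: "0 < K"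
    and lip: "\<And>x y y'. x \<in> cball x0 \<rho> \<Longrightarrow> y \<in> cball y0 \<rho> \<Longrightarrow> y' \<in> cball y0 \<rho> \<Longrightarrow>
      norm (F (x, y) - F (x, y')) \<le> K * norm (y - y')"
    using C1_local_bounds[OF \<Omega> dF cF'] by metis
  have near: "\<forall>\<^sub>F x in nhds x0. y x \<in> cball y0 \<rho>" if "y x0 = y0" "isCont y x0" for y
    using that(2)[unfolded isCont_def, THEN tendstoD, OF \<rho>] that(1) \<rho>
    by (auto simp: eventually_at_filter dist_commute elim!: eventually_mono)
  have "\<forall>\<^sub>F x in nhds x0. x \<in> S \<and> y1 x \<in> cball y0 \<rho> \<and> y2 x \<in> cball y0 \<rho>"
    using S y1 y2 by (intro eventually_conj near has_derivative_continuous eventually_nhds_in_open)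
  then obtain s where s: "0 < s" "\<And>x. dist x x0 < s \<Longrightarrow> x \<in> S \<and> y1 x \<in> cball y0 \<rho> \<and> y2 x \<in> cball y0 \<rho>"
    unfolding eventually_nhds_metric by blast
  define r where "r = min \<rho> (min (s/2) (1 / (2 * K)))"
  have r: "0 < r" "r \<le> \<rho>" "r < s" using \<rho> K s by (auto simp: r_def)
  have "r \<le> 1 / (2 * K)" by (simp add: r_def)
  then have Kr: "K * r \<le> 1/2" using K by (simp add: field_simps)
  let ?B = "cball x0 r"
  have B: "x \<in> S" "y1 x \<in> cball y0 \<rho>" "y2 x \<in> cball y0 \<rho>" "x \<in> cball x0 \<rho>" if "x \<in> ?B" for x
    using s(2)[of x] that r by (auto simp: dist_commute)
  let ?d = "\<lambda>x. y1 x - y2 x"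
  have dd: "(?d has_derivative blinfun_apply (F (x, y1 x) - F (x, y2 x))) (at x)" if "x \<in> ?B" for x
    using has_derivative_diff[OF y1(2) y2(2)] B(1)[OF that] by (simp add: minus_blinfun.rep_eq)
  have "continuous_on ?B (\<lambda>x. norm (?d x))"
    by (intro continuous_on_norm continuous_at_imp_continuous_on ballI has_derivative_continuous[OF dd])
  then obtain xm where xm: "xm \<in> ?B" "\<And>x. x \<in> ?B \<Longrightarrow> norm (?d x) \<le> norm (?d xm)"
    using continuous_attains_sup[of ?B "\<lambda>x. norm (?d x)"] r by auto
  have "norm (?d xm - ?d x0) \<le> (K * norm (?d xm)) * norm (xm - x0)"
  proof (rule differentiable_bound[of ?B])
    show "(?d has_derivative blinfun_apply (F (x, y1 x) - F (x, y2 x))) (at x within ?B)" if "x \<in> ?B" for x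
      using dd[OF that] by (rule has_derivative_at_withinI)
    show "onorm (blinfun_apply (F (x, y1 x) - F (x, y2 x))) \<le> K * norm (?d xm)" if x: "x \<in> ?B" for x
    proof -
      have "norm (F (x, y1 x) - F (x, y2 x)) \<le> K * norm (?d x)" using B[OF x] by (intro lip)
      also have "\<dots> \<le> K * norm (?d xm)" using xm(2)[OF x] K by simp
      finally show ?thesis by (simp add: norm_blinfun.rep_eq)
    qed
  qed (use xm r in auto)
  also have "\<dots> \<le> (K * norm (?d xm)) * r"
    using xm(1) K by (intro mult_left_mono) (auto simp: dist_norm norm_minus_commute)
  also have "\<dots> \<le> 1/2 * norm (?d xm)"
    using mult_right_mono[OF Kr, of "norm (?d xm)"] by (simp add: mult_ac)
  finally have "norm (?d xm) \<le> 0" using y1(1) y2(1) by simp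
  then have eq: "y1 x = y2 x" if "x \<in> ?B" for x
    using xm(2)[OF that] by simp
  have "\<forall>\<^sub>F x in nhds x0. x \<in> ball x0 r"
    using r(1) by (intro eventually_nhds_in_open) auto
  then show ?thesis
    by (rule eventually_mono) (rule eq, simp)
qed

section \<open>Second order systems in closed form\<close>

lemma smooth_on_Blinfun:
  fixes f :: "'c::real_normed_vector \<Rightarrow> 'a::euclidean_space \<Rightarrow> 'b::real_normed_vector"
  assumes S: "open S" and f: "\<And>v. smooth_on S (\<lambda>z. f z v)" and lin: "\<And>z. linear (f z)"
  shows "smooth_on S (\<lambda>z. Blinfun (f z))"
proof -
  \<comment> \<open>The rank-one operator \<open>u \<mapsto> (u \<bullet> b) y\<close>, linear in
    \<open>y\<close>. It reduces smoothness of the operator to smoothness of its values on the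
    basis.\<close>
  let ?L = "\<lambda>b y. blinfun_scaleR_left y o\<^sub>L blinfun_inner_left b"
  have "Blinfun (f z) = (\<Sum>b\<in>Basis. ?L b (f z b))" for z
  proof (rule blinfun_eqI)
    fix u
    have "f z u = f z (\<Sum>b\<in>Basis. (u \<bullet> b) *\<^sub>R b)"
      by (simp only: euclidean_representation)
    also have "\<dots> = (\<Sum>b\<in>Basis. (u \<bullet> b) *\<^sub>R f z b)"
      using lin by (simp add: linear_sum linear_scale)
    finally show "blinfun_apply (Blinfun (f z)) u = blinfun_apply (\<Sum>b\<in>Basis. ?L b (f z b)) u"
      using lin by (simp add: bounded_linear_Blinfun_apply linear_conv_bounded_linear
          blinfun.sum_left inner_commute)
  qed
  moreover have "bounded_linear (?L b)" for b
    by (intro bounded_linear_intros)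
  then have "smooth_on S (\<lambda>z. \<Sum>b\<in>Basis. ?L b (f z b))"
    by (intro smooth_on_sum S smooth_on_bounded_linear[OF S _ f])
  ultimately show ?thesis by simp
qed

section \<open>Partial derivatives, Jacobians and Hessians\<close>

lemma pd_eq: "(h has_derivative D) (at x) \<Longrightarrow> pd j h x = D (axis j 1)"
  unfolding pd_def by (metis frechet_derivative_at)

text \<open>\<open>frechet_derivative\<close> is a choice from the set of derivatives, and functions
  that agree near \<open>x\<close> have the same set. This also covers points where neither function
  is differentiable.\<close>

lemma pd_cong:
  assumes "open S" "x \<in> S" "\<And>z. z \<in> S \<Longrightarrow> h z = g z"
  shows "pd j h x = pd j g x"
proof -
  have "(h has_derivative D) (at x) \<longleftrightarrow> (g has_derivative D) (at x)" for D
    using has_derivative_transform_within_open[OF _ assms(1,2)] assms(3) by metis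
  then show ?thesis by (simp only: pd_def frechet_derivative_def)
qed

lemma smooth_on_pd: "smooth_on S h \<Longrightarrow> smooth_on S (pd j h)"
  unfolding pd_def[abs_def] by (rule smooth_on_frechet_derivative)

lemma vec_as_axis_sum: "(u::real^'n) = (\<Sum>k\<in>UNIV. u $ k *\<^sub>R axis k 1)"
  by (simp add: vec_eq_iff axis_def if_distrib cong: if_cong)

lemma linear_axis_sum: "linear f \<Longrightarrow> f (u::real^'n) = (\<Sum>k\<in>UNIV. u $ k *\<^sub>R f (axis k 1))"
  by (subst vec_as_axis_sum[of u]) (simp add: linear_sum linear_scale)

lemma has_derivative_pd:
  assumes "(h has_derivative D) (at x)"
  shows "D u = (\<Sum>k\<in>UNIV. pd k h x * u $ k)"
  using linear_axis_sum[OF has_derivative_linear[OF assms], of u] pd_eq[OF assms]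
  by (simp add: mult.commute)

lemma has_derivative_vec_nth:
  "(f has_derivative D) F \<Longrightarrow> ((\<lambda>x. f x $ i) has_derivative (\<lambda>v. D v $ i)) F"
  by (rule bounded_linear.has_derivative[OF bounded_linear_vec_nth])

lemma jac_eq:
  assumes "(F has_derivative D) (at x)"
  shows "jac F x $ i $ j = D (axis j 1) $ i"
  using pd_eq[OF has_derivative_vec_nth[OF assms]] by (simp add: jac_def)

lemma jac_has_derivative:
  assumes "F differentiable at x"
  shows "(F has_derivative (\<lambda>v. jac F x *v v)) (at x)"
proof -
  obtain D where D: "(F has_derivative D) (at x)" using assms by (auto simp: differentiable_def)
  have "D v $ i = (jac F x *v v) $ i" for v i
    using arg_cong[OF linear_axis_sum[OF has_derivative_linear[OF D], of v], of "\<lambda>w. w $ i"]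
    by (simp add: matrix_vector_mult_def jac_eq[OF D] sum_component mult.commute)
  then have "D = (\<lambda>v. jac F x *v v)" by (simp add: fun_eq_iff vec_eq_iff)
  with D show ?thesis by simp
qed

lemma smooth_on_jac: "open S \<Longrightarrow> smooth_on S F \<Longrightarrow> smooth_on S (jac F)"
  unfolding jac_def[abs_def] by (intro smooth_on_vec_lambda smooth_on_pd smooth_on_vec_nth)

lemma jac_cong: "open S \<Longrightarrow> x \<in> S \<Longrightarrow> (\<And>z. z \<in> S \<Longrightarrow> F z = G z) \<Longrightarrow> jac F x = jac G x"
  unfolding jac_def by (intro arg_cong[of _ _ vec_lambda] ext pd_cong) auto

lemma hess_eq_pd_jac: "hess F x $ i $ j $ k = pd k (\<lambda>z. jac F z $ i $ j) x"
  by (simp add: hess_def jac_def)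

lemma hess_cong:
  assumes "open S" "x \<in> S" "\<And>z. z \<in> S \<Longrightarrow> F z = G z"
  shows "hess F x = hess G x"
proof -
  have "jac F z = jac G z" if "z \<in> S" for z using jac_cong[OF assms(1) that assms(3)] .
  then have "hess F x $ i $ j $ k = hess G x $ i $ j $ k" for i j k
    unfolding hess_eq_pd_jac by (intro pd_cong[OF assms(1,2)]) simp
  then show ?thesis by (simp add: vec_eq_iff)
qed

text \<open>The vector goes into the last index because \<open>hess\<close> records the second
  differentiation there: \<open>contract (hess F x) u\<close> is the derivative of
  \<open>jac F\<close> in direction \<open>u\<close>.\<close>

definition contract :: "real^'n^'n^'n \<Rightarrow> real^'n \<Rightarrow> real^'n^'n" where
  "contract T u = (\<chi> i j. \<Sum>k\<in>UNIV. T $ i $ j $ k * u $ k)"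

lemma jac_has_derivative_hess:
  assumes S: "open S" "x \<in> S" and F: "smooth_on S F"
  shows "(jac F has_derivative contract (hess F x)) (at x)"
proof -
  let ?D = "frechet_derivative (jac F) (at x)"
  have D: "(jac F has_derivative ?D) (at x)"
    using smooth_on_has_derivative[OF smooth_on_jac[OF S(1) F] S(2)] .
  have "?D u = contract (hess F x) u" for u
    using has_derivative_pd[OF has_derivative_vec_nth[OF has_derivative_vec_nth[OF D]]]
    by (simp add: vec_eq_iff contract_def hess_eq_pd_jac)
  then have "?D = contract (hess F x)" by (rule ext)
  with D show ?thesis by simp
qed

lemma pd_commute:
  assumes "open S" "x \<in> S" "smooth_on S h"
  shows "pd j (pd k h) x = pd k (pd j h) x"
  using frechet_derivative_symmetric[OF assms] unfolding pd_def[abs_def] .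

lemma symmetric_derivative:
  fixes T :: "'a::real_normed_vector \<Rightarrow> real^'n^'n^'n"
  assumes U: "open U" and T: "smooth_on U T"
    and sym: "\<And>z i j k. z \<in> U \<Longrightarrow> T z $ i $ j $ k = T z $ i $ k $ j" and x: "x \<in> U"
  shows "frechet_derivative T (at x) u $ i $ j $ k = frechet_derivative T (at x) u $ i $ k $ j"
proof -
  have d: "((\<lambda>z. T z $ i $ j $ k) has_derivative (\<lambda>w. frechet_derivative T (at x) w $ i $ j $ k)) (at x)" for i j k
    by (intro has_derivative_vec_nth smooth_on_has_derivative[OF T x])
  have "((\<lambda>z. T z $ i $ j $ k) has_derivative (\<lambda>w. frechet_derivative T (at x) w $ i $ k $ j)) (at x)"
    by (rule has_derivative_transform_within_open[OF d U x]) (rule sym)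
  from has_derivative_unique[OF d this] show ?thesis by (rule fun_cong)
qed

lemma pd_hess_symmetric:
  assumes S: "open S" "x \<in> S" and F: "smooth_on S F"
  shows "pd r (\<lambda>z. hess F z $ i $ j $ k) x = pd j (\<lambda>z. hess F z $ i $ r $ k) x"
proof -
  \<comment> \<open>The indices \<open>j\<close> and \<open>k\<close> are exchanged first, so that
    \<open>r\<close> and \<open>j\<close> become the two outer derivatives of a smooth function, the
    \<open>k\<close>-th partial derivative of a component of \<open>F\<close>.\<close>
  have "pd r (\<lambda>z. hess F z $ i $ j $ k) x = pd r (\<lambda>z. pd j (pd k (\<lambda>w. F w $ i)) z) x"
    by (rule pd_cong[OF S]) (simp add: hess_def pd_commute[OF S(1) _ smooth_on_vec_nth[OF S(1) F]])
  also have "\<dots> = pd j (\<lambda>z. pd r (pd k (\<lambda>w. F w $ i)) z) x"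
    by (rule pd_commute[OF S smooth_on_pd[OF smooth_on_vec_nth[OF S(1) F]]])
  also have "\<dots> = pd j (\<lambda>z. hess F z $ i $ r $ k) x"
    by (rule pd_cong[OF S]) (simp add: hess_def pd_commute[OF S(1) _ smooth_on_vec_nth[OF S(1) F]])
  finally show ?thesis .
qed

text \<open>A second order system \<open>hess y = H (x, y, jac y)\<close> in closed form; \<open>prolongation H z u\<close> is the
  derivative in direction \<open>u\<close> of the 1-jet of a solution passing through \<open>z\<close>, and \<open>compatible H z\<close>
  says that the total derivatives \<open>D\<^sub>r H\<^sub>j\<^sub>k\<close> are symmetric in \<open>r\<close> and \<open>j\<close> at \<open>z\<close>.\<close>

type_synonym 'n jet_fun = "'n arrow1 \<Rightarrow> real^'n^'n^'n"

definition prolongation :: "'n::finite jet_fun \<Rightarrow> 'n arrow1 \<Rightarrow> real^'n \<Rightarrow>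
    'n arrow1" where
  "prolongation H z u = (u, snd (snd z) *v u, contract (H z) u)"

definition compatible :: "'n::finite jet_fun \<Rightarrow> 'n arrow1 \<Rightarrow> bool" where
  "compatible H z \<longleftrightarrow> (\<forall>i r j k.
     frechet_derivative H (at z) (prolongation H z (axis r 1)) $ i $ j $ k =
     frechet_derivative H (at z) (prolongation H z (axis j 1)) $ i $ r $ k)"

lemma linear_contract: "linear (contract T)"
  by (rule linearI) (simp_all add: contract_def vec_eq_iff algebra_simps sum.distrib sum_distrib_left)

lemma linear_contract_left: "linear (\<lambda>T. contract T u)"
  by (rule linearI) (simp_all add: contract_def vec_eq_iff algebra_simps sum.distrib sum_distrib_left)

lemma linear_prolongation: "linear (prolongation H z)"
  by (rule linearI) (simp_all add: prolongation_def matrix_vector_right_distrib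
      matrix_vector_mult_scaleR linear_add[OF linear_contract] linear_scale[OF linear_contract])

lemma contract_axis: "contract T (axis k 1) $ i $ j = T $ i $ j $ k"
  by (simp add: contract_def axis_def if_distrib cong: if_cong)

lemma smooth_on_contract:
  "open S \<Longrightarrow> smooth_on S T \<Longrightarrow> smooth_on S (\<lambda>z. contract (T z) u)"
  by (rule smooth_on_bounded_linear) (auto intro!: linear_contract_left[unfolded linear_conv_bounded_linear])

lemma smooth_on_prolongation:
  "open S \<Longrightarrow> smooth_on S H \<Longrightarrow> smooth_on S (\<lambda>z. prolongation H z u)"
  unfolding prolongation_def by (intro smooth_intros smooth_on_contract)

section \<open>Solvability of closed second order systems\<close>

context
  fixes H :: "'n::finite jet_fun" and \<Omega> :: "'n arrow1 set"
  assumes \<Omega>: "open \<Omega>" and H: "smooth_on \<Omega> H"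
begin

text \<open>Reduction of order: the unknown becomes the pair of a map and its Jacobian, and
  \<open>F\<close> collects the derivatives of this pair. It is operator-valued because the
  Frobenius theorem asks for that form.\<close>

lemma first_order_form:
  obtains F F' where "\<And>z v. blinfun_apply (F z) v = snd (prolongation H z v)"
    "\<And>z. z \<in> \<Omega> \<Longrightarrow> (F has_derivative blinfun_apply (F' z)) (at z)" "continuous_on \<Omega> F'"
    "\<And>z w v. z \<in> \<Omega> \<Longrightarrow> F' z w v = (snd (snd w) *v v, contract (frechet_derivative H (at z) w) v)"
proof -
  define F where "F z = Blinfun (\<lambda>v. snd (prolongation H z v))" for z
  have lin: "linear (\<lambda>v. snd (prolongation H z v))" for z
    using linear_compose[OF linear_prolongation linear_snd] by (simp add: o_def)
  have F: "blinfun_apply (F z) v = snd (prolongation H z v)" for z v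
    unfolding F_def using lin by (simp add: bounded_linear_Blinfun_apply linear_conv_bounded_linear)
  have "smooth_on \<Omega> F"
    unfolding F_def by (intro smooth_on_Blinfun smooth_intros smooth_on_prolongation \<Omega> H lin)
  then obtain F' where F': "\<And>z. z \<in> \<Omega> \<Longrightarrow> (F has_derivative blinfun_apply (F' z)) (at z)" "continuous_on \<Omega> F'"
    using smooth_on_blinfun_derivative by blast
  have app: "F' z w v = (snd (snd w) *v v, contract (frechet_derivative H (at z) w) v)" if z: "z \<in> \<Omega>" for z w v
  proof -
    have 1: "((\<lambda>z. F z v) has_derivative (\<lambda>w. F' z w v)) (at z)"
      using bounded_linear.has_derivative[OF blinfun.bounded_linear_left F'(1)[OF z]] .
    have 2: "((\<lambda>z. F z v) has_derivative (\<lambda>w. (snd (snd w) *v v, contract (frechet_derivative H (at z) w) v))) (at z)"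
      unfolding F prolongation_def snd_conv
    proof (intro has_derivative_Pair)
      have "bounded_linear (\<lambda>w :: 'n arrow1. snd (snd w) *v v)"
        by (intro linear_conv_bounded_linear[THEN iffD1] linearI)
          (simp_all add: matrix_vector_mult_add_rdistrib scaleR_matrix_vector_assoc)
      then show "((\<lambda>z. snd (snd z) *v v) has_derivative (\<lambda>w. snd (snd w) *v v)) (at z)"
        by (rule bounded_linear_imp_has_derivative)
      show "((\<lambda>z. contract (H z) v) has_derivative (\<lambda>w. contract (frechet_derivative H (at z) w) v)) (at z)"
        by (rule bounded_linear.has_derivative[OF linear_contract_left[unfolded linear_conv_bounded_linear]
              smooth_on_has_derivative[OF H z]])
    qed
    show ?thesis using has_derivative_unique[OF 1 2] by (rule fun_cong)
  qed
  show ?thesis by (rule that[OF F F' app])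
qed

lemma has_derivative_1jet:
  assumes "open S" "x \<in> S" "smooth_on S f" "hess f x = H (x, f x, jac f x)"
  shows "((\<lambda>x. (x, f x, jac f x)) has_derivative prolongation H (x, f x, jac f x)) (at x)"
proof -
  have "((\<lambda>x. (x, f x, jac f x)) has_derivative (\<lambda>v. (v, jac f x *v v, contract (hess f x) v))) (at x)"
    by (intro has_derivative_Pair has_derivative_ident jac_has_derivative
        smooth_on_imp_differentiable[OF assms(3,2)] jac_has_derivative_hess[OF assms(1-3)])
  then show ?thesis by (simp add: prolongation_def[abs_def] assms(4))
qed

text \<open>The Frobenius condition for the pair of map and Jacobian splits in two: its first
  component is the symmetry of \<open>H\<close> in the lower indices, and the second combines this
  symmetry with \<open>compatible\<close>.\<close>

lemma second_order_existence:
  assumes z: "(x0, y0, p0) \<in> \<Omega>"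
    and sym: "\<And>z i j k. z \<in> \<Omega> \<Longrightarrow> H z $ i $ j $ k = H z $ i $ k $ j"
    and compat: "\<And>z. z \<in> \<Omega> \<Longrightarrow> compatible H z"
  obtains r f where "0 < r" "smooth_on (ball x0 r) f" "f x0 = y0" "jac f x0 = p0"
    "\<And>x. x \<in> ball x0 r \<Longrightarrow> (x, f x, jac f x) \<in> \<Omega> \<and> hess f x = H (x, f x, jac f x)"
proof -
  obtain F F' where F: "\<And>z v. blinfun_apply (F z) v = snd (prolongation H z v)"
    and dF: "\<And>z. z \<in> \<Omega> \<Longrightarrow> (F has_derivative blinfun_apply (F' z)) (at z)" and cF': "continuous_on \<Omega> F'"
    and F': "\<And>z w v. z \<in> \<Omega> \<Longrightarrow> F' z w v = (snd (snd w) *v v, contract (frechet_derivative H (at z) w) v)"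
    using first_order_form by blast
  have comm: "F' z (u, F z u) v = F' z (v, F z v) u" if z: "z \<in> \<Omega>" for z u v
  proof -
    let ?D = "frechet_derivative H (at z)"
    have D: "(H has_derivative ?D) (at z)" using smooth_on_has_derivative[OF H z] .
    have eq: "(u, F z u) = prolongation H z u" for u by (simp add: F prolongation_def)
    have symD: "?D w $ i $ j $ k = ?D w $ i $ k $ j" for w i j k
      by (rule symmetric_derivative[OF \<Omega> H sym z])
    have cD: "?D (prolongation H z (axis r 1)) $ i $ j $ k = ?D (prolongation H z (axis j 1)) $ i $ r $ k" for i r j k
      using compat[OF z] by (simp add: compatible_def)
    define T where "T r = ?D (prolongation H z (axis r 1))" for r
    \<comment> \<open>\<open>compatible\<close> exchanges \<open>r\<close> with the first lower
      index, and \<open>symD\<close> exchanges the two lower indices. Together they exchange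
      \<open>r\<close> with the last index; these are the slots that receive the directions
      \<open>u\<close> and \<open>v\<close>.\<close>
    have tot: "T r $ i $ j $ k = T k $ i $ j $ r" for i r j k
      unfolding T_def symD[of _ i j k] cD[of r i k j] by (rule symD)
    have lin: "linear (\<lambda>u. ?D (prolongation H z u))"
      using linear_compose[OF linear_prolongation has_derivative_linear[OF D]] by (simp add: o_def)
    have "?D (prolongation H z u) = (\<Sum>r\<in>UNIV. u $ r *\<^sub>R T r)" for u
      unfolding T_def by (rule linear_axis_sum[OF lin])
    then have "contract (?D (prolongation H z u)) v $ i $ j =
        (\<Sum>k\<in>UNIV. \<Sum>r\<in>UNIV. u $ r * v $ k * T r $ i $ j $ k)" for u v i j
      by (simp add: contract_def sum_distrib_left sum_distrib_right sum_component mult_ac)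
    moreover have "(\<Sum>k\<in>UNIV. \<Sum>r\<in>UNIV. u $ r * v $ k * T r $ i $ j $ k) =
        (\<Sum>k\<in>UNIV. \<Sum>r\<in>UNIV. v $ r * u $ k * T r $ i $ j $ k)" for i j
      by (subst sum.swap) (intro sum.cong refl, subst tot, simp add: mult_ac)
    ultimately have 1: "contract (?D (prolongation H z u)) v = contract (?D (prolongation H z v)) u"
      by (simp add: vec_eq_iff)
    have expand: "(contract (H z) u *v v) $ i = (\<Sum>j\<in>UNIV. \<Sum>k\<in>UNIV. H z $ i $ j $ k * u $ k * v $ j)" for u v i
      by (simp add: matrix_vector_mult_def contract_def sum_distrib_right)
    have "(\<Sum>j\<in>UNIV. \<Sum>k\<in>UNIV. H z $ i $ j $ k * u $ k * v $ j) = (\<Sum>j\<in>UNIV. \<Sum>k\<in>UNIV. H z $ i $ j $ k * v $ k * u $ j)" for i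
      by (subst sum.swap) (intro sum.cong refl, subst sym[OF z], simp add: mult_ac)
    then have 2: "contract (H z) u *v v = contract (H z) v *v u"
      by (simp add: vec_eq_iff expand)
    show ?thesis unfolding F'[OF z] eq using 1 2 by (simp add: prolongation_def)
  qed
  obtain r w where r: "0 < r" and w: "w x0 = (y0, p0)" "\<And>x. x \<in> ball x0 r \<Longrightarrow> (x, w x) \<in> \<Omega>"
    "\<And>x. x \<in> ball x0 r \<Longrightarrow> (w has_derivative blinfun_apply (F (x, w x))) (at x)"
    using Frobenius_existence[OF \<Omega> z dF cF' comm] by blast
  let ?B = "ball x0 r"
  have graph: "((\<lambda>x. (x, w x)) has_derivative prolongation H (x, w x)) (at x)" if "x \<in> ?B" for x
  proof -
    have "((\<lambda>x. (x, w x)) has_derivative (\<lambda>v. (v, F (x, w x) v))) (at x)"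
      by (intro has_derivative_Pair has_derivative_ident w(3) that)
    moreover have "(\<lambda>v. (v, blinfun_apply (F (x, w x)) v)) = prolongation H (x, w x)"
      by (simp add: fun_eq_iff F prolongation_def)
    ultimately show ?thesis by simp
  qed
  \<comment> \<open>The whole graph, rather than \<open>w\<close> alone, is bootstrapped: its
    derivative is the smooth map \<open>prolongation H\<close> evaluated on the graph
    itself.\<close>
  have sg: "smooth_on ?B (\<lambda>x. (x, w x))"
  proof (rule smooth_on_chain[OF open_ball \<Omega>, where D = "prolongation H"])
    show "(\<lambda>x. (x, w x)) ` ball x0 r \<subseteq> \<Omega>" using w(2) by auto
  qed (use graph in \<open>auto intro: smooth_on_prolongation \<Omega> H\<close>)
  define f where "f x = fst (w x)" for x
  have f: "smooth_on ?B f"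
    unfolding f_def using smooth_on_fst[OF open_ball smooth_on_snd[OF open_ball sg]] by simp
  have df: "(f has_derivative (\<lambda>v. snd (w x) *v v)) (at x)" if "x \<in> ?B" for x
    using has_derivative_fst[OF has_derivative_snd[OF graph[OF that]]]
    by (simp add: f_def[abs_def] prolongation_def)
  have "jac f x $ i $ j = snd (w x) $ i $ j" if "x \<in> ?B" for x i j
    by (subst jac_eq[OF df[OF that]]) (simp add: matrix_vector_mult_basis column_def)
  then have jac: "jac f x = snd (w x)" if "x \<in> ?B" for x
    using that by (simp add: vec_eq_iff)
  have hess: "hess f x = H (x, w x)" if x: "x \<in> ?B" for x
  proof -
    have dp: "((\<lambda>x. snd (w x)) has_derivative contract (H (x, w x))) (at x)"
      using has_derivative_snd[OF has_derivative_snd[OF graph[OF x]]]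
      by (simp add: prolongation_def)
    have "hess f x $ i $ j $ k = H (x, w x) $ i $ j $ k" for i j k
    proof -
      have "hess f x $ i $ j $ k = pd k (\<lambda>z. snd (w z) $ i $ j) x"
        unfolding hess_eq_pd_jac by (rule pd_cong[OF open_ball x]) (simp add: jac)
      then show ?thesis
        by (simp add: pd_eq[OF has_derivative_vec_nth[OF has_derivative_vec_nth[OF dp]]] contract_axis)
    qed
    then show ?thesis by (simp add: vec_eq_iff)
  qed
  have pair: "(f x, jac f x) = w x" if "x \<in> ?B" for x using jac[OF that] by (simp add: f_def)
  show ?thesis
  proof (rule that[OF r f])
    show "f x0 = y0" "jac f x0 = p0" using r w(1) jac[of x0] by (auto simp: f_def)
    show "(x, f x, jac f x) \<in> \<Omega> \<and> hess f x = H (x, f x, jac f x)" if "x \<in> ball x0 r" for x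
      using pair[OF that] w(2)[OF that] hess[OF that] by simp
  qed
qed

lemma second_order_uniqueness:
  assumes S: "open S" "x0 \<in> S"
    and f: "smooth_on S f" "\<And>x. x \<in> S \<Longrightarrow> hess f x = H (x, f x, jac f x)"
    and g: "smooth_on S g" "\<And>x. x \<in> S \<Longrightarrow> hess g x = H (x, g x, jac g x)"
    and init: "(x0, f x0, jac f x0) \<in> \<Omega>" "f x0 = g x0" "jac f x0 = jac g x0"
  shows "\<forall>\<^sub>F x in nhds x0. f x = g x"
proof -
  obtain F F' where F: "\<And>z v. blinfun_apply (F z) v = snd (prolongation H z v)"
    and dF: "\<And>z. z \<in> \<Omega> \<Longrightarrow> (F has_derivative blinfun_apply (F' z)) (at z)" and cF': "continuous_on \<Omega> F'"
    using first_order_form by metis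
  have der: "((\<lambda>x. (h x, jac h x)) has_derivative blinfun_apply (F (x, h x, jac h x))) (at x)"
    if "smooth_on S h" "\<And>x. x \<in> S \<Longrightarrow> hess h x = H (x, h x, jac h x)" "x \<in> S" for h x
  proof -
    have "((\<lambda>x. (h x, jac h x)) has_derivative (\<lambda>v. snd (prolongation H (x, h x, jac h x) v))) (at x)"
      using has_derivative_snd[OF has_derivative_1jet[OF S(1) that(3,1) that(2)[OF that(3)]]] by simp
    then show ?thesis by (simp only: F[symmetric])
  qed
  have "\<forall>\<^sub>F x in nhds x0. (f x, jac f x) = (g x, jac g x)"
    by (rule Frobenius_uniqueness[OF \<Omega> init(1) dF cF' S])
      (use init der[OF f] der[OF g] in auto)
  then show ?thesis by (rule eventually_mono) simp
qed

text \<open>Along a solution \<open>H\<close> at the 1-jet is the Hessian, so by the chain rule its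
  total derivatives are third partial derivatives of \<open>f\<close>.\<close>

lemma second_order_compatible:
  assumes S: "open S" "x0 \<in> S" and f: "smooth_on S f"
    and sol: "\<And>x. x \<in> S \<Longrightarrow> hess f x = H (x, f x, jac f x)"
    and z: "(x0, f x0, jac f x0) \<in> \<Omega>"
  shows "compatible H (x0, f x0, jac f x0)"
proof -
  let ?z = "\<lambda>x. (x, f x, jac f x)"
  have "((\<lambda>x. H (?z x)) has_derivative
      (\<lambda>v. frechet_derivative H (at (?z x0)) (prolongation H (?z x0) v))) (at x0)"
    using has_derivative_compose[OF has_derivative_1jet[OF S f sol[OF S(2)]]
        smooth_on_has_derivative[OF H z]] .
  then have "((\<lambda>x. H (?z x) $ i $ j $ k) has_derivative
      (\<lambda>v. frechet_derivative H (at (?z x0)) (prolongation H (?z x0) v) $ i $ j $ k)) (at x0)" for i j k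
    by (intro has_derivative_vec_nth)
  note * = pd_eq[OF this]
  have "frechet_derivative H (at (?z x0)) (prolongation H (?z x0) (axis r 1)) $ i $ j $ k =
      pd r (\<lambda>x. hess f x $ i $ j $ k) x0" for i r j k
    unfolding *[symmetric] by (rule pd_cong[OF S]) (simp add: sol)
  then show ?thesis
    by (simp only: compatible_def) (intro allI pd_hess_symmetric[OF S f])
qed

end

section \<open>Integrability conditions as curvature\<close>

text \<open>Index-free view of an array, with \<open>v\<close> in the first lower index and
  \<open>w\<close> in the second. In this form the curvature identities become algebra with bilinear
  maps instead of manipulations of sums.\<close>

definition bil :: "real^'n^'n^'n \<Rightarrow> real^'n \<Rightarrow> real^'n \<Rightarrow> real^'n" where
  "bil T v w = contract T w *v v"

lemma bil_component: "bil T v w $ i = (\<Sum>j\<in>UNIV. \<Sum>k\<in>UNIV. T $ i $ j $ k * v $ j * w $ k)"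
  by (simp add: bil_def contract_def matrix_vector_mult_def sum_distrib_right sum_distrib_left mult_ac)

lemma bil_axis_left: "bil T (axis j 1) w $ i = (\<Sum>k\<in>UNIV. T $ i $ j $ k * w $ k)"
  by (simp add: bil_def matrix_vector_mult_basis column_def contract_def)

lemma sum_times_axis: "(\<Sum>k\<in>UNIV. f k * axis j (1::real) $ k) = f j"
  by (simp add: axis_def if_distrib cong: if_cong)

lemma bil_axis: "bil T (axis j 1) (axis k 1) $ i = T $ i $ j $ k"
  by (simp add: bil_def matrix_vector_mult_basis column_def contract_axis)

lemma bil_sym: "(\<And>i j k. T $ i $ j $ k = T $ i $ k $ j) \<Longrightarrow> bil T v w = bil T w v"
  unfolding vec_eq_iff bil_component
  by (intro allI, subst sum.swap) (intro sum.cong refl, simp add: mult_ac)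

lemma bounded_bilinear_matrix_vector: "bounded_bilinear (\<lambda>(M::real^'n^'m) v. M *v v)"
  unfolding bilinear_conv_bounded_bilinear[symmetric]
  by (simp add: bilinear_def linear_iff matrix_vector_mult_add_rdistrib scaleR_matrix_vector_assoc
      matrix_vector_right_distrib matrix_vector_mult_scaleR)

lemma bounded_bilinear_contract: "bounded_bilinear (contract :: real^'n^'n^'n \<Rightarrow> _)"
  unfolding bilinear_conv_bounded_bilinear[symmetric]
  by (simp add: bilinear_def linear_contract linear_contract_left)

lemma has_derivative_matrix_vector:
  fixes M :: "'a::real_normed_vector \<Rightarrow> real^'n^'m"
  assumes "(M has_derivative M') (at z)" "(f has_derivative f') (at z)"
  shows "((\<lambda>z. M z *v f z) has_derivative (\<lambda>h. M z *v f' h + M' h *v f z)) (at z)"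
  by (rule bounded_bilinear.FDERIV[OF bounded_bilinear_matrix_vector assms])

lemma has_derivative_bil:
  fixes T :: "'a::real_normed_vector \<Rightarrow> real^'n^'n^'n"
  assumes "(T has_derivative T') (at z)" "(f has_derivative f') (at z)" "(g has_derivative g') (at z)"
  shows "((\<lambda>z. bil (T z) (f z) (g z)) has_derivative
    (\<lambda>h. bil (T' h) (f z) (g z) + bil (T z) (f' h) (g z) + bil (T z) (f z) (g' h))) (at z)"
proof -
  have "((\<lambda>z. contract (T z) (g z)) has_derivative (\<lambda>h. contract (T z) (g' h) + contract (T' h) (g z))) (at z)"
    by (rule bounded_bilinear.FDERIV[OF bounded_bilinear_contract assms(1,3)])
  from has_derivative_matrix_vector[OF this assms(2)] show ?thesis
    unfolding bil_def by (rule has_derivative_eq_rhs) (simp add: fun_eq_iff matrix_vector_mult_add_rdistrib)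
qed

lemma bil_add:
  "bil (S + T) v w = bil S v w + bil T v w"
  "bil T (v + v') w = bil T v w + bil T v' w"
  "bil T v (w + w') = bil T v w + bil T v w'"
  "bil (S - T) v w = bil S v w - bil T v w"
  "bil T (v - v') w = bil T v w - bil T v' w"
  "bil T v (w - w') = bil T v w - bil T v w'"
  by (simp_all add: vec_eq_iff bil_component algebra_simps sum.distrib sum_subtractf)

lemma bil_scaleR:
  "bil (c *\<^sub>R T) v w = c *\<^sub>R bil T v w" "bil T (c *\<^sub>R v) w = c *\<^sub>R bil T v w"
  "bil T v (c *\<^sub>R w) = c *\<^sub>R bil T v w"
  by (simp_all add: vec_eq_iff bil_component sum_distrib_left mult_ac)

lemma linear_bil: "linear (\<lambda>T. bil T v w)" "linear (\<lambda>v. bil T v w)" "linear (\<lambda>w. bil T v w)"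
  by (simp_all add: linear_iff bil_add bil_scaleR)

lemma bil_fst:
  assumes "(T has_derivative T') (at z)"
  shows "((\<lambda>z. bil (T z) v w) has_derivative (\<lambda>h. bil (T' h) v w)) (at z)"
  using assms by (rule bounded_linear.has_derivative[OF linear_bil(1)[unfolded linear_conv_bounded_linear]])

lemma sum_axis: "(q :: 'b::euclidean_space^'n) = (\<Sum>a\<in>UNIV. axis a (q $ a))"
  by (simp add: vec_eq_iff axis_def if_distrib cong: if_cong)

text \<open>\<open>curv T D\<close> is the integrability object at \<open>x\<close> as a trilinear map, for \<open>T = \<Gamma>(x)\<close> and \<open>D = d\<Gamma>(x)\<close>.\<close>

definition curv :: "real^'n^'n^'n \<Rightarrow> (real^'n \<Rightarrow> real^'n^'n^'n) \<Rightarrow> real^'n \<Rightarrow> real^'n \<Rightarrow> real^'n \<Rightarrow> real^'n" where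
  "curv T D u v w = (bil (D u) v w + bil T v (bil T u w)) - (bil (D v) u w + bil T u (bil T v w))"

abbreviation curvature_at :: "(real^'n::finite \<Rightarrow> real^'n^'n^'n) \<Rightarrow> real^'n \<Rightarrow> real^'n \<Rightarrow> real^'n \<Rightarrow> real^'n \<Rightarrow> real^'n" where
  "curvature_at \<gamma> x \<equiv> curv (\<gamma> x) (frechet_derivative \<gamma> (at x))"

lemma pd_component:
  assumes "\<gamma> differentiable at x"
  shows "pd r (\<lambda>z. \<gamma> z $ i $ j $ k) x = frechet_derivative \<gamma> (at x) (axis r 1) $ i $ j $ k"
  using assms unfolding frechet_derivative_works
  by (intro pd_eq has_derivative_vec_nth)

lemma integrability_object_curv:
  assumes "\<Gamma> c differentiable at x"
  shows "integrability_object \<Gamma> c x $ i $ r $ j $ k = curvature_at (\<Gamma> c) x (axis r 1) (axis j 1) (axis k 1) $ i"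
  unfolding integrability_object_def curv_def Let_def
  by (simp add: pd_component[OF assms] bil_axis_left sum_times_axis)

lemma curv_linear:
  assumes "linear D"
  shows "linear (\<lambda>u. curv T D u v w)" "linear (\<lambda>v. curv T D u v w)" "linear (\<lambda>w. curv T D u v w)"
  by (simp_all add: linear_iff curv_def bil_add bil_scaleR linear_add[OF assms] linear_scale[OF assms] algebra_simps)

lemma linear_eq_0_axis: "linear f \<Longrightarrow> (\<And>k. f (axis k 1) = 0) \<Longrightarrow> f (u::real^'n) = 0"
  by (subst linear_axis_sum) simp_all

lemma integrability_object_eq_0_iff:
  assumes "\<Gamma> c differentiable at x"
  shows "integrability_object \<Gamma> c x = 0 \<longleftrightarrow> (\<forall>u v w. curvature_at (\<Gamma> c) x u v w = 0)" (is "?l \<longleftrightarrow> ?r")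
proof
  assume ?l
  then have 0: "curvature_at (\<Gamma> c) x (axis r 1) (axis j 1) (axis k 1) = 0" for r j k
    unfolding vec_eq_iff[of "curvature_at (\<Gamma> c) x (axis r 1) (axis j 1) (axis k 1)"]
    using integrability_object_curv[of \<Gamma> c x, OF assms] by (metis zero_index)
  note lin = curv_linear[OF linear_frechet_derivative[OF assms]]
  \<comment> \<open>Components are values on axis vectors; linearity frees one argument at a time,
    starting with the last.\<close>
  have 1: "curvature_at (\<Gamma> c) x (axis r 1) (axis j 1) w = 0" for r j w
    by (rule linear_eq_0_axis[OF lin(3)]) (rule 0)
  have 2: "curvature_at (\<Gamma> c) x (axis r 1) v w = 0" for r v w
    by (rule linear_eq_0_axis[OF lin(2)]) (rule 1)
  have "curvature_at (\<Gamma> c) x u v w = 0" for u v w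
    by (rule linear_eq_0_axis[OF lin(1)]) (rule 2)
  then show ?r by blast
next
  assume ?r
  then show ?l by (simp add: vec_eq_iff integrability_object_curv[of \<Gamma> c x, OF assms])
qed

section \<open>The nonlinear and the linear second order system\<close>

lemma compatible_bil:
  "compatible H z \<longleftrightarrow> (\<forall>r j k.
    bil (frechet_derivative H (at z) (prolongation H z (axis r 1))) (axis j 1) (axis k 1) =
    bil (frechet_derivative H (at z) (prolongation H z (axis j 1))) (axis r 1) (axis k 1))"
  unfolding compatible_def by (simp add: vec_eq_iff[of "bil _ _ _"] bil_axis) blast

text \<open>The second derivatives that \<open>affine_PHG\<close> prescribes over a 1-arrow,
  separated from the membership in \<open>U2\<close> so that the theory of second order systems
  applies. \<open>linear_system\<close> does the same for \<open>linearization\<close>.\<close>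

definition PHG_system :: "('m, 'n::finite) gamma \<Rightarrow> ('m, 'n) chart \<Rightarrow> ('m, 'n) chart \<Rightarrow> 'n jet_fun" where
  "PHG_system \<Gamma> c d = (\<lambda>(x, y, p). \<chi> i j k.
     (\<Sum>a\<in>UNIV. \<Sum>b\<in>UNIV. \<Gamma> d y $ i $ a $ b * p $ a $ j * p $ b $ k)
     - (\<Sum>a\<in>UNIV. \<Gamma> c x $ a $ j $ k * p $ i $ a))"

definition linear_system :: "('m, 'n::finite) gamma \<Rightarrow> ('m, 'n) chart \<Rightarrow> 'n jet_fun" where
  "linear_system \<Gamma> c = (\<lambda>(x, \<xi>, \<xi>1). P_lin \<Gamma> c x \<xi> \<xi>1)"

lemma bilinear_eq_on_axis:
  fixes f :: "real^'n \<Rightarrow> real^'m \<Rightarrow> 'a::real_vector"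
  assumes "bilinear f" "bilinear g" "\<And>j k. f (axis j 1) (axis k 1) = g (axis j 1) (axis k 1)"
  shows "f v w = g v w"
proof -
  have "f (axis j 1) w = g (axis j 1) w" for j
    using linear_axis_sum[of "f (axis j 1)" w] linear_axis_sum[of "g (axis j 1)" w] assms
    by (simp add: bilinear_def)
  then show ?thesis
    using linear_axis_sum[of "\<lambda>v. f v w" v] linear_axis_sum[of "\<lambda>v. g v w" v] assms
    by (simp add: bilinear_def)
qed

text \<open>Both sides are bilinear in \<open>v\<close> and \<open>w\<close>, so it suffices to
  compare them on axis vectors, where the left one is a component of the array.\<close>

lemma bil_PHG_system:
  "bil (PHG_system \<Gamma> c d z) v w =
    bil (\<Gamma> d (fst (snd z))) (snd (snd z) *v v) (snd (snd z) *v w) - snd (snd z) *v bil (\<Gamma> c (fst z)) v w"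
proof (rule bilinear_eq_on_axis[where f = "bil (PHG_system \<Gamma> c d z)"])
  obtain x y p where z: "z = (x, y, p)" by (cases z)
  show "bil (PHG_system \<Gamma> c d z) (axis j 1) (axis k 1) =
    bil (\<Gamma> d (fst (snd z))) (snd (snd z) *v axis j 1) (snd (snd z) *v axis k 1) - snd (snd z) *v bil (\<Gamma> c (fst z)) (axis j 1) (axis k 1)" for j k
  proof -
    have "(p *v bil T (axis j 1) (axis k 1)) $ i = (\<Sum>a\<in>UNIV. T $ a $ j $ k * p $ i $ a)" for T i
      by (simp add: matrix_vector_mult_def bil_axis mult.commute)
    then show ?thesis
      by (simp add: vec_eq_iff bil_axis z PHG_system_def) (simp add: bil_component matrix_vector_mult_basis column_def)
  qed
qed (simp_all add: bilinear_def linear_iff bil_add bil_scaleR matrix_vector_right_distrib matrix_vector_mult_scaleR algebra_simps)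

lemma bil_linear_system:
  assumes "\<Gamma> c differentiable at (fst z)"
  shows "bil (linear_system \<Gamma> c z) v w =
    bil (frechet_derivative (\<Gamma> c) (at (fst z)) (fst (snd z))) v w + bil (\<Gamma> c (fst z)) w (snd (snd z) *v v)
    + bil (\<Gamma> c (fst z)) v (snd (snd z) *v w) - snd (snd z) *v bil (\<Gamma> c (fst z)) v w"
proof (rule bilinear_eq_on_axis[where f = "bil (linear_system \<Gamma> c z)"])
  obtain x \<xi> p where z: "z = (x, \<xi>, p)" by (cases z)
  have d: "(\<Gamma> c has_derivative frechet_derivative (\<Gamma> c) (at x)) (at x)"
    using assms frechet_derivative_works by (auto simp: z)
  have 1: "bil T (axis j 1) w $ i = (\<Sum>a\<in>UNIV. T $ i $ j $ a * w $ a)" for T :: "real^'n^'n^'n" and w i j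
    by (simp add: bil_def matrix_vector_mult_basis column_def contract_def)
  have 2: "frechet_derivative (\<Gamma> c) (at x) \<xi> $ i $ j $ k = (\<Sum>a\<in>UNIV. pd a (\<lambda>z. \<Gamma> c z $ i $ j $ k) x * \<xi> $ a)" for i j k
    by (rule has_derivative_pd[OF has_derivative_vec_nth[OF has_derivative_vec_nth[OF has_derivative_vec_nth[OF d]]]])
  have 3: "(p *v bil T (axis j 1) (axis k 1)) $ i = (\<Sum>a\<in>UNIV. p $ i $ a * T $ a $ j $ k)" for T i j k
    by (simp add: matrix_vector_mult_def bil_axis)
  show "bil (linear_system \<Gamma> c z) (axis j 1) (axis k 1) =
    bil (frechet_derivative (\<Gamma> c) (at (fst z)) (fst (snd z))) (axis j 1) (axis k 1)
    + bil (\<Gamma> c (fst z)) (axis k 1) (snd (snd z) *v axis j 1)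
    + bil (\<Gamma> c (fst z)) (axis j 1) (snd (snd z) *v axis k 1) - snd (snd z) *v bil (\<Gamma> c (fst z)) (axis j 1) (axis k 1)" for j k
    by (simp add: vec_eq_iff bil_axis z linear_system_def P_lin_def 2 3)
      (simp add: 1 matrix_vector_mult_basis column_def)
qed (simp_all add: bilinear_def linear_iff bil_add bil_scaleR matrix_vector_right_distrib matrix_vector_mult_scaleR algebra_simps)

lemma smooth_on_PHG_system:
  assumes "open U" "open V" "smooth_on U (\<Gamma> c)" "smooth_on V (\<Gamma> d)"
  shows "smooth_on (U \<times> V \<times> UNIV) (PHG_system \<Gamma> c d)"
proof -
  have o: "open (U \<times> V \<times> (UNIV :: (real^'n^'n) set))" using assms by (intro open_Times open_UNIV)
  have 1: "smooth_on (U \<times> V \<times> (UNIV :: (real^'n^'n) set)) (\<lambda>z. \<Gamma> c (fst z))"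
    by (rule smooth_on_compose[OF o assms(1) _ _ assms(3)]) (auto intro!: smooth_intros o)
  have 2: "smooth_on (U \<times> V \<times> (UNIV :: (real^'n^'n) set)) (\<lambda>z. \<Gamma> d (fst (snd z)))"
    by (rule smooth_on_compose[OF o assms(2) _ _ assms(4)]) (auto intro!: smooth_intros o)
  show ?thesis
    unfolding PHG_system_def case_prod_unfold
    by (intro smooth_on_vec_lambda smooth_on_diff smooth_on_sum smooth_on_mult smooth_on_vec_nth
        smooth_on_snd smooth_on_ident 1 2 o)
qed

lemma smooth_on_linear_system:
  assumes "open U" "smooth_on U (\<Gamma> c)"
  shows "smooth_on (U \<times> UNIV \<times> UNIV) (linear_system \<Gamma> c)"
proof -
  have o: "open (U \<times> (UNIV :: (real^'n) set) \<times> (UNIV :: (real^'n^'n) set))" using assms by (intro open_Times open_UNIV)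
  have 1: "smooth_on (U \<times> (UNIV :: (real^'n) set) \<times> (UNIV :: (real^'n^'n) set)) (\<lambda>z. \<Gamma> c (fst z))"
    by (rule smooth_on_compose[OF o assms(1) _ _ assms(2)]) (auto intro!: smooth_intros o simp del: UNIV_Times_UNIV)
  have 2: "smooth_on (U \<times> (UNIV :: (real^'n) set) \<times> (UNIV :: (real^'n^'n) set)) (\<lambda>z. pd a (\<lambda>z. \<Gamma> c z $ i $ j $ k) (fst z))" for a i j k
    by (rule smooth_on_compose[OF o assms(1)]) (auto intro!: smooth_intros smooth_on_pd o assms simp del: UNIV_Times_UNIV)
  show ?thesis
    unfolding linear_system_def P_lin_def case_prod_unfold
    by (intro smooth_on_vec_lambda smooth_on_diff smooth_on_add smooth_on_sum smooth_on_mult smooth_on_vec_nth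
        smooth_on_fst smooth_on_snd smooth_on_ident 1 2 o)
qed

lemma bil_prolongation: "snd (snd (prolongation H z u)) *v v = bil (H z) v u"
  by (simp add: prolongation_def bil_def)

text \<open>Evaluation at fixed \<open>v, w\<close> is linear, so a derivative computed from the
  index-free form must coincide with the evaluated derivative of the array.\<close>

lemma has_derivative_bil_system:
  assumes "(H has_derivative D) (at z)" "\<And>v w. ((\<lambda>z. bil (H z) v w) has_derivative (\<lambda>h. E h v w)) (at z)"
  shows "bil (D h) v w = E h v w"
  using has_derivative_unique[OF bil_fst[OF assms(1)] assms(2)] by (rule fun_cong)

lemma PHG_system_derivative:
  assumes c: "\<Gamma> c differentiable at x" and d: "\<Gamma> d differentiable at y"
    and H: "PHG_system \<Gamma> c d differentiable at (x, y, p)"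
  shows "bil (frechet_derivative (PHG_system \<Gamma> c d) (at (x, y, p)) h) v w =
    bil (frechet_derivative (\<Gamma> d) (at y) (fst (snd h))) (p *v v) (p *v w)
    + bil (\<Gamma> d y) (snd (snd h) *v v) (p *v w) + bil (\<Gamma> d y) (p *v v) (snd (snd h) *v w)
    - (p *v bil (frechet_derivative (\<Gamma> c) (at x) (fst h)) v w + snd (snd h) *v bil (\<Gamma> c x) v w)"
proof -
  let ?z = "(x, y, p)"
  have D: "(PHG_system \<Gamma> c d has_derivative frechet_derivative (PHG_system \<Gamma> c d) (at ?z)) (at ?z)"
    using H unfolding frechet_derivative_works .
  have c': "((\<lambda>z. \<Gamma> c (fst z)) has_derivative (\<lambda>h. frechet_derivative (\<Gamma> c) (at x) (fst h))) (at ?z)"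
    by (rule has_derivative_compose[of fst fst "(x, y, p)"])
      (use c in \<open>auto simp: frechet_derivative_works intro!: bounded_linear_imp_has_derivative bounded_linear_fst\<close>)
  have d': "((\<lambda>z. \<Gamma> d (fst (snd z))) has_derivative (\<lambda>h. frechet_derivative (\<Gamma> d) (at y) (fst (snd h)))) (at ?z)"
    by (rule has_derivative_compose[of "\<lambda>z. fst (snd z)" "\<lambda>h. fst (snd h)" "(x, y, p)"])
      (use d in \<open>auto simp: frechet_derivative_works intro!: derivative_intros\<close>)
  have p': "((\<lambda>z. snd (snd z)) has_derivative (\<lambda>h. snd (snd h))) (at ?z)"
    by (auto intro!: derivative_intros)
  have pv: "((\<lambda>z. snd (snd z) *v v) has_derivative (\<lambda>h. snd (snd h) *v v)) (at ?z)" for v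
    using has_derivative_matrix_vector[OF p' has_derivative_const[of v]] by simp
  have "((\<lambda>z. bil (PHG_system \<Gamma> c d z) v w) has_derivative
    (\<lambda>h. bil (frechet_derivative (\<Gamma> d) (at y) (fst (snd h))) (p *v v) (p *v w)
    + bil (\<Gamma> d y) (snd (snd h) *v v) (p *v w) + bil (\<Gamma> d y) (p *v v) (snd (snd h) *v w)
    - (p *v bil (frechet_derivative (\<Gamma> c) (at x) (fst h)) v w + snd (snd h) *v bil (\<Gamma> c x) v w))) (at ?z)" for v w
    using has_derivative_diff[OF has_derivative_bil[OF d' pv[of v] pv[of w]]
        has_derivative_matrix_vector[OF p' bil_fst[OF c', of v w]]]
    by (simp add: bil_PHG_system)
  from has_derivative_bil_system[OF D this] show ?thesis .
qed

text \<open>Antisymmetrization in \<open>u, v\<close> leaves the two curvatures. The mixed terms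
  \<open>\<Gamma>(y)(pv, p \<Gamma>(x)(w, u))\<close> and
  \<open>\<Gamma>(y)(p \<Gamma>(x)(v, w), pu)\<close> change into each other when \<open>u\<close>
  and \<open>v\<close> are exchanged, by the symmetry of \<Gamma>, so their sum cancels. So does the
  term that contains \<open>H(v, u)\<close>, which is symmetric in \<open>u, v\<close>.\<close>

lemma PHG_system_defect:
  assumes c: "\<Gamma> c differentiable at x" and d: "\<Gamma> d differentiable at y"
    and H: "PHG_system \<Gamma> c d differentiable at (x, y, p)"
    and sc: "\<And>i j k. \<Gamma> c x $ i $ j $ k = \<Gamma> c x $ i $ k $ j"
    and sd: "\<And>i j k. \<Gamma> d y $ i $ j $ k = \<Gamma> d y $ i $ k $ j"
  shows "bil (frechet_derivative (PHG_system \<Gamma> c d) (at (x, y, p)) (prolongation (PHG_system \<Gamma> c d) (x, y, p) u)) v w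
    - bil (frechet_derivative (PHG_system \<Gamma> c d) (at (x, y, p)) (prolongation (PHG_system \<Gamma> c d) (x, y, p) v)) u w
    = curvature_at (\<Gamma> d) y (p *v u) (p *v v) (p *v w) - p *v curvature_at (\<Gamma> c) x u v w"
proof -
  have sc': "bil (\<Gamma> c x) a b = bil (\<Gamma> c x) b a" for a b by (rule bil_sym[OF sc])
  have sd': "bil (\<Gamma> d y) a b = bil (\<Gamma> d y) b a" for a b by (rule bil_sym[OF sd])
  have fs: "fst (prolongation (PHG_system \<Gamma> c d) (x, y, p) u) = u"
    "fst (snd (prolongation (PHG_system \<Gamma> c d) (x, y, p) u)) = p *v u" for u
    by (simp_all add: prolongation_def)
  show ?thesis
    unfolding PHG_system_derivative[OF c d H] fs bil_prolongation bil_PHG_system fst_conv snd_conv curv_def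
    by (simp add: bil_add matrix_vector_right_distrib matrix_vector_mult_diff_distrib sc' sd' algebra_simps)
qed

section \<open>Derivatives of the structure object and of its curvature\<close>

lemma frechet_derivative_symmetric_vec:
  fixes f :: "'a::real_normed_vector \<Rightarrow> 'b::euclidean_space"
  assumes S: "open S" "x \<in> S" and f: "smooth_on S f"
  shows "frechet_derivative (\<lambda>z. frechet_derivative f (at z) u) (at x) v =
    frechet_derivative (\<lambda>z. frechet_derivative f (at z) v) (at x) u"
proof (rule euclidean_eqI)
  fix b :: 'b assume "b \<in> Basis"
  have inner: "frechet_derivative g (at z) w \<bullet> b = frechet_derivative (\<lambda>z. g z \<bullet> b) (at z) w"
    if "smooth_on S g" "z \<in> S" for g :: "'a \<Rightarrow> 'b" and z w
    using frechet_derivative_at[OF bounded_linear.has_derivative[OF bounded_linear_inner_left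
          smooth_on_has_derivative[OF that]]] by (rule fun_cong)
  have fb: "smooth_on S (\<lambda>z. f z \<bullet> b)"
    by (rule smooth_on_bounded_linear[OF S(1) bounded_linear_inner_left f])
  have 2: "frechet_derivative (\<lambda>z. frechet_derivative f (at z) u) (at x) v \<bullet> b =
    frechet_derivative (\<lambda>z. frechet_derivative (\<lambda>z. f z \<bullet> b) (at z) u) (at x) v" for u v
  proof -
    have "((\<lambda>z. frechet_derivative f (at z) u \<bullet> b) has_derivative
        (\<lambda>v. frechet_derivative (\<lambda>z. frechet_derivative f (at z) u) (at x) v \<bullet> b)) (at x)"
      by (rule bounded_linear.has_derivative[OF bounded_linear_inner_left
            smooth_on_has_derivative[OF smooth_on_frechet_derivative[OF f] S(2)]])
    then have "((\<lambda>z. frechet_derivative (\<lambda>z. f z \<bullet> b) (at z) u) has_derivative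
        (\<lambda>v. frechet_derivative (\<lambda>z. frechet_derivative f (at z) u) (at x) v \<bullet> b)) (at x)"
      by (rule has_derivative_transform_within_open[OF _ S]) (rule inner[OF f])
    from frechet_derivative_at[OF this] show ?thesis by (rule fun_cong)
  qed
  show "frechet_derivative (\<lambda>z. frechet_derivative f (at z) u) (at x) v \<bullet> b =
    frechet_derivative (\<lambda>z. frechet_derivative f (at z) v) (at x) u \<bullet> b"
    unfolding 2 by (rule frechet_derivative_symmetric[OF S fb])
qed

definition dir_deriv :: "(real^'n \<Rightarrow> real^'n^'n^'n) \<Rightarrow> real^'n \<Rightarrow> real^'n \<Rightarrow> real^'n^'n^'n" where
  "dir_deriv \<gamma> x u = frechet_derivative \<gamma> (at x) u"

definition dir_deriv2 :: "(real^'n \<Rightarrow> real^'n^'n^'n) \<Rightarrow> real^'n \<Rightarrow> real^'n \<Rightarrow> real^'n \<Rightarrow> real^'n^'n^'n" where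
  "dir_deriv2 \<gamma> x u v = frechet_derivative (\<lambda>z. dir_deriv \<gamma> z u) (at x) v"

definition curv_deriv :: "(real^'n \<Rightarrow> real^'n^'n^'n) \<Rightarrow> real^'n \<Rightarrow> real^'n \<Rightarrow> real^'n \<Rightarrow> real^'n \<Rightarrow> real^'n \<Rightarrow> real^'n" where
  "curv_deriv \<gamma> x \<xi> u v w =
    (bil (dir_deriv2 \<gamma> x u \<xi>) v w + (bil (dir_deriv \<gamma> x \<xi>) v (bil (\<gamma> x) u w) + bil (\<gamma> x) v (bil (dir_deriv \<gamma> x \<xi>) u w)))
    - (bil (dir_deriv2 \<gamma> x v \<xi>) u w + (bil (dir_deriv \<gamma> x \<xi>) u (bil (\<gamma> x) v w) + bil (\<gamma> x) u (bil (dir_deriv \<gamma> x \<xi>) v w)))"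

context
  fixes U :: "(real^'n::finite) set" and \<gamma> :: "real^'n \<Rightarrow> real^'n^'n^'n"
  assumes U: "open U" and \<gamma>: "smooth_on U \<gamma>"
    and sym: "\<forall>z\<in>U. \<forall>i j k. \<gamma> z $ i $ j $ k = \<gamma> z $ i $ k $ j"
begin

lemma smooth_on_dir_deriv: "smooth_on U (\<lambda>z. dir_deriv \<gamma> z u)"
  unfolding dir_deriv_def by (rule smooth_on_frechet_derivative[OF \<gamma>])

lemma has_derivative_dir_deriv: "x \<in> U \<Longrightarrow> ((\<lambda>z. dir_deriv \<gamma> z u) has_derivative dir_deriv2 \<gamma> x u) (at x)"
  unfolding dir_deriv2_def[abs_def] by (rule smooth_on_has_derivative[OF smooth_on_dir_deriv])

lemma has_derivative_\<gamma>: "x \<in> U \<Longrightarrow> (\<gamma> has_derivative dir_deriv \<gamma> x) (at x)"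
  unfolding dir_deriv_def[abs_def] by (rule smooth_on_has_derivative[OF \<gamma>])

lemma dir_deriv2_commute: "x \<in> U \<Longrightarrow> dir_deriv2 \<gamma> x u v = dir_deriv2 \<gamma> x v u"
  unfolding dir_deriv2_def dir_deriv_def by (rule frechet_derivative_symmetric_vec[OF U _ \<gamma>])

lemma bil_commute:
  assumes "x \<in> U"
  shows "bil (\<gamma> x) v w = bil (\<gamma> x) w v" "bil (dir_deriv \<gamma> x u) v w = bil (dir_deriv \<gamma> x u) w v"
    "bil (dir_deriv2 \<gamma> x a b) v w = bil (dir_deriv2 \<gamma> x a b) w v"
proof -
  show "bil (\<gamma> x) v w = bil (\<gamma> x) w v" by (rule bil_sym[OF sym[rule_format, OF assms]])
  have dir_deriv: "dir_deriv \<gamma> z u $ i $ j $ k = dir_deriv \<gamma> z u $ i $ k $ j" if "z \<in> U" for z u i j k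
    unfolding dir_deriv_def by (rule symmetric_derivative[OF U \<gamma> sym[rule_format] that])
  show "bil (dir_deriv \<gamma> x u) v w = bil (dir_deriv \<gamma> x u) w v" by (rule bil_sym[OF dir_deriv[OF assms]])
  show "bil (dir_deriv2 \<gamma> x a b) v w = bil (dir_deriv2 \<gamma> x a b) w v"
    unfolding dir_deriv2_def by (rule bil_sym[OF symmetric_derivative[OF U smooth_on_dir_deriv dir_deriv assms]])
qed

lemma has_derivative_curvature:
  assumes "x \<in> U"
  shows "((\<lambda>x. curvature_at \<gamma> x u v w) has_derivative (\<lambda>\<xi>. curv_deriv \<gamma> x \<xi> u v w)) (at x)"
proof -
  note g = bil_fst[OF has_derivative_\<gamma>[OF assms]] and d = bil_fst[OF has_derivative_dir_deriv[OF assms]]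
  have q: "((\<lambda>x. bil (\<gamma> x) v (bil (\<gamma> x) u w)) has_derivative
      (\<lambda>\<xi>. bil (dir_deriv \<gamma> x \<xi>) v (bil (\<gamma> x) u w) + bil (\<gamma> x) v (bil (dir_deriv \<gamma> x \<xi>) u w))) (at x)" for u v w
    using has_derivative_bil[OF has_derivative_\<gamma>[OF assms] has_derivative_const[of v] g[of u w]]
    by (simp add: linear_0[OF linear_bil(2)])
  show ?thesis
    unfolding curv_def curv_deriv_def dir_deriv_def[symmetric]
    by (intro has_derivative_diff has_derivative_add d q)
qed

text \<open>The derivative of \<open>\<gamma>\<close> in direction \<open>\<xi>\<close> is needed as
  a function of the point and of \<open>\<xi>\<close> jointly. Being linear in \<open>\<xi>\<close>,
  it is a finite sum of coordinates of \<open>\<xi>\<close> times maps of the point alone, to which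
  the product rule applies.\<close>

lemma has_derivative_dir_deriv_pair:
  assumes "fst z \<in> U"
  shows "((\<lambda>z. dir_deriv \<gamma> (fst z) (fst (snd z))) has_derivative
    (\<lambda>h. dir_deriv \<gamma> (fst z) (fst (snd h)) + dir_deriv2 \<gamma> (fst z) (fst (snd z)) (fst h))) (at (z :: 'n vjet1))"
proof -
  have lin: "linear (dir_deriv \<gamma> x)" if "x \<in> U" for x
    using has_derivative_linear[OF has_derivative_\<gamma>[OF that]] .
  note sum = linear_axis_sum[OF lin]
  have dir_deriv2_sum: "dir_deriv2 \<gamma> x \<xi> u = (\<Sum>a\<in>UNIV. \<xi> $ a *\<^sub>R dir_deriv2 \<gamma> x (axis a 1) u)" if x: "x \<in> U" for x \<xi> u
  proof -
    have "((\<lambda>x. \<Sum>a\<in>UNIV. \<xi> $ a *\<^sub>R dir_deriv \<gamma> x (axis a 1)) has_derivative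
        (\<lambda>u. \<Sum>a\<in>UNIV. \<xi> $ a *\<^sub>R dir_deriv2 \<gamma> x (axis a 1) u)) (at x)"
      by (intro has_derivative_sum has_derivative_scaleR_right has_derivative_dir_deriv x)
    then have "((\<lambda>x. dir_deriv \<gamma> x \<xi>) has_derivative (\<lambda>u. \<Sum>a\<in>UNIV. \<xi> $ a *\<^sub>R dir_deriv2 \<gamma> x (axis a 1) u)) (at x)"
      by (rule has_derivative_transform_within_open[OF _ U x]) (rule sum[symmetric])
    from has_derivative_unique[OF has_derivative_dir_deriv[OF x] this] show ?thesis by (rule fun_cong)
  qed
  have dir_deriv': "((\<lambda>z. dir_deriv \<gamma> (fst z) e) has_derivative (\<lambda>h. dir_deriv2 \<gamma> (fst z) e (fst h))) (at z)" for e
    by (rule has_derivative_compose[where f = fst and f' = fst and g = "\<lambda>x. dir_deriv \<gamma> x e" and g' = "dir_deriv2 \<gamma> (fst z) e"])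
      (auto intro!: derivative_intros has_derivative_dir_deriv assms)
  have \<xi>': "((\<lambda>z. fst (snd z) $ a) has_derivative (\<lambda>h. fst (snd h) $ a)) (at z)" for a
    by (intro has_derivative_vec_nth derivative_intros)
  have "((\<lambda>z. \<Sum>a\<in>UNIV. fst (snd z) $ a *\<^sub>R dir_deriv \<gamma> (fst z) (axis a 1)) has_derivative
      (\<lambda>h. \<Sum>a\<in>UNIV. fst (snd z) $ a *\<^sub>R dir_deriv2 \<gamma> (fst z) (axis a 1) (fst h) + fst (snd h) $ a *\<^sub>R dir_deriv \<gamma> (fst z) (axis a 1))) (at z)"
    by (intro has_derivative_sum has_derivative_scaleR \<xi>' dir_deriv')
  moreover have "(\<lambda>h. \<Sum>a\<in>UNIV. fst (snd z) $ a *\<^sub>R dir_deriv2 \<gamma> (fst z) (axis a 1) (fst h) + fst (snd h) $ a *\<^sub>R dir_deriv \<gamma> (fst z) (axis a 1)) =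
      (\<lambda>h. dir_deriv \<gamma> (fst z) (fst (snd h)) + dir_deriv2 \<gamma> (fst z) (fst (snd z)) (fst h))"
    by (rule ext) (simp only: sum.distrib dir_deriv2_sum[OF assms, symmetric] sum[OF assms, symmetric] add.commute)
  ultimately have "((\<lambda>z. \<Sum>a\<in>UNIV. fst (snd z) $ a *\<^sub>R dir_deriv \<gamma> (fst z) (axis a 1)) has_derivative
      (\<lambda>h. dir_deriv \<gamma> (fst z) (fst (snd h)) + dir_deriv2 \<gamma> (fst z) (fst (snd z)) (fst h))) (at z)"
    by (rule has_derivative_eq_rhs)
  then show ?thesis
  proof (rule has_derivative_transform_within_open)
    show "open (U \<times> (UNIV :: ((real^'n) \<times> (real^'n^'n)) set))" using U by (intro open_Times open_UNIV)
    show "z \<in> U \<times> UNIV" using assms by (cases z) auto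
    show "(\<Sum>a\<in>UNIV. fst (snd z) $ a *\<^sub>R dir_deriv \<gamma> (fst z) (axis a 1)) = dir_deriv \<gamma> (fst z) (fst (snd z))"
      if "z \<in> U \<times> UNIV" for z :: "'n vjet1"
      using that by (intro sum[symmetric]) auto
  qed
qed

end

section \<open>Compatibility and curvature of the linear system\<close>

context
  fixes \<Gamma> :: "('m, 'n::finite) gamma" and c :: "('m, 'n) chart" and U :: "(real^'n) set"
  assumes U: "open U" and \<Gamma>: "smooth_on U (\<Gamma> c)"
    and sym: "\<forall>x\<in>U. \<forall>i j k. \<Gamma> c x $ i $ j $ k = \<Gamma> c x $ i $ k $ j"
begin

lemma linear_system_derivative:
  assumes x: "x \<in> U"
  shows "bil (frechet_derivative (linear_system \<Gamma> c) (at (x, \<xi>, p)) h) v w =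
    bil (dir_deriv (\<Gamma> c) x (fst (snd h))) v w + bil (dir_deriv2 (\<Gamma> c) x \<xi> (fst h)) v w
    + (bil (dir_deriv (\<Gamma> c) x (fst h)) w (p *v v) + bil (\<Gamma> c x) w (snd (snd h) *v v))
    + (bil (dir_deriv (\<Gamma> c) x (fst h)) v (p *v w) + bil (\<Gamma> c x) v (snd (snd h) *v w))
    - (p *v bil (dir_deriv (\<Gamma> c) x (fst h)) v w + snd (snd h) *v bil (\<Gamma> c x) v w)"
proof -
  let ?z = "(x, \<xi>, p)" and ?S = "U \<times> (UNIV :: ((real^'n) \<times> (real^'n^'n)) set)"
  let ?E = "\<lambda>v w h. bil (dir_deriv (\<Gamma> c) x (fst (snd h)) + dir_deriv2 (\<Gamma> c) x \<xi> (fst h)) v w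
    + (bil (dir_deriv (\<Gamma> c) x (fst h)) w (p *v v) + bil (\<Gamma> c x) w (snd (snd h) *v v))
    + (bil (dir_deriv (\<Gamma> c) x (fst h)) v (p *v w) + bil (\<Gamma> c x) v (snd (snd h) *v w))
    - (p *v bil (dir_deriv (\<Gamma> c) x (fst h)) v w + snd (snd h) *v bil (\<Gamma> c x) v w)"
  let ?K = "\<lambda>v w z. bil (dir_deriv (\<Gamma> c) (fst z) (fst (snd z))) v w + bil (\<Gamma> c (fst z)) w (snd (snd z) *v v)
      + bil (\<Gamma> c (fst z)) v (snd (snd z) *v w) - snd (snd z) *v bil (\<Gamma> c (fst z)) v w"
  have S: "open ?S" "?z \<in> ?S" using U x by (auto intro!: open_Times open_UNIV)
  have D: "(linear_system \<Gamma> c has_derivative frechet_derivative (linear_system \<Gamma> c) (at ?z)) (at ?z)"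
    using smooth_on_has_derivative[OF smooth_on_linear_system[of U \<Gamma> c, OF U \<Gamma>]] x by simp
  note dir_deriv' = has_derivative_dir_deriv_pair[OF U \<Gamma> sym, of ?z, unfolded fst_conv snd_conv, OF x]
  have g': "((\<lambda>z. \<Gamma> c (fst z)) has_derivative (\<lambda>h. dir_deriv (\<Gamma> c) x (fst h))) (at ?z)"
    by (rule has_derivative_compose[where f = fst and f' = fst and g = "\<Gamma> c" and g' = "dir_deriv (\<Gamma> c) x"])
      (auto intro!: derivative_intros has_derivative_\<gamma>[OF U \<Gamma> sym] x)
  have p': "((\<lambda>z. snd (snd z)) has_derivative (\<lambda>h. snd (snd h))) (at ?z)"
    by (auto intro!: derivative_intros)
  have pv: "((\<lambda>z. snd (snd z) *v v) has_derivative (\<lambda>h. snd (snd h) *v v)) (at ?z)" for v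
    using has_derivative_matrix_vector[OF p' has_derivative_const[of v]] by simp
  have b: "((\<lambda>z. bil (\<Gamma> c (fst z)) w (snd (snd z) *v v)) has_derivative
      (\<lambda>h. bil (dir_deriv (\<Gamma> c) x (fst h)) w (p *v v) + bil (\<Gamma> c x) w (snd (snd h) *v v))) (at ?z)" for v w
    using has_derivative_bil[OF g' has_derivative_const[of w] pv[of v]]
    by (simp add: linear_0[OF linear_bil(2)])
  have m: "((\<lambda>z. snd (snd z) *v bil (\<Gamma> c (fst z)) v w) has_derivative
      (\<lambda>h. p *v bil (dir_deriv (\<Gamma> c) x (fst h)) v w + snd (snd h) *v bil (\<Gamma> c x) v w)) (at ?z)" for v w
    using has_derivative_matrix_vector[OF p' bil_fst[OF g']] by simp
  have "(?K v w has_derivative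
    ?E v w) (at ?z)" for v w
    by (intro has_derivative_diff has_derivative_add bil_fst[OF dir_deriv'] b m)
  \<comment> \<open>The index-free form of \<open>linear_system\<close> is available where
    \<open>\<Gamma> c\<close> is differentiable. Its derivative is therefore computed for
    \<open>?K\<close> and transferred on the open set \<open>?S\<close>.\<close>
  then have "((\<lambda>z. bil (linear_system \<Gamma> c z) v w) has_derivative
    ?E v w) (at ?z)" for v w
  proof (rule has_derivative_transform_within_open[OF _ S])
    fix z :: "'n vjet1" assume "z \<in> ?S"
    then have "\<Gamma> c differentiable at (fst z)"
      by (intro smooth_on_imp_differentiable[OF \<Gamma>]) auto
    from bil_linear_system[of \<Gamma> c, OF this]
    show "?K v w z = bil (linear_system \<Gamma> c z) v w"
      by (simp add: dir_deriv_def)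
  qed
  from has_derivative_bil_system[OF D this] show ?thesis by (simp add: bil_add)
qed

text \<open>The right-hand side is the formal Lie derivative of the integrability object; \<open>curv_deriv\<close> contributes
  its derivative in direction \<open>\<xi>\<close>.\<close>

lemma linear_system_defect:
  assumes x: "x \<in> U"
  defines "K \<equiv> linear_system \<Gamma> c" and "J \<equiv> curvature_at (\<Gamma> c) x"
  shows "bil (frechet_derivative K (at (x, \<xi>, p)) (prolongation K (x, \<xi>, p) u)) v w
    - bil (frechet_derivative K (at (x, \<xi>, p)) (prolongation K (x, \<xi>, p) v)) u w
    = curv_deriv (\<Gamma> c) x \<xi> u v w - p *v J u v w + J (p *v u) v w + J u (p *v v) w + J u v (p *v w)"
proof -
  have d: "\<Gamma> c differentiable at (fst (x, \<xi>, p))"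
    using smooth_on_imp_differentiable[OF \<Gamma> x] by simp
  have fs: "fst (prolongation (linear_system \<Gamma> c) (x, \<xi>, p) u) = u"
    "fst (snd (prolongation (linear_system \<Gamma> c) (x, \<xi>, p) u)) = p *v u" for u
    by (simp_all add: prolongation_def)
  note commute = bil_commute[of U "\<Gamma> c", OF U \<Gamma> sym x]
  \<comment> \<open>The system produces the second derivative along \<open>\<xi>\<close> and then
    \<open>u\<close>, the curvature that along \<open>u\<close> and then \<open>\<xi>\<close>.
    Symmetry of second derivatives identifies them; the remaining terms match by the symmetry of
    \<Gamma> and of its derivatives in the lower indices.\<close>
  show ?thesis
    unfolding K_def J_def linear_system_derivative[OF x] fs bil_prolongation
      bil_linear_system[of \<Gamma> c, OF d] fst_conv snd_conv curv_def curv_deriv_def dir_deriv_def[symmetric]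
      dir_deriv2_commute[OF U \<Gamma> sym x, of \<xi>]
    by (simp add: bil_add matrix_vector_right_distrib matrix_vector_mult_diff_distrib commute algebra_simps)
qed

lemma compatible_linear_system:
  assumes flat: "\<And>x. x \<in> U \<Longrightarrow> integrability_object \<Gamma> c x = 0" and x: "x \<in> U"
  shows "compatible (linear_system \<Gamma> c) (x, \<xi>, p)"
proof -
  have J: "curvature_at (\<Gamma> c) z u v w = 0" if "z \<in> U" for z u v w
    using flat[OF that] integrability_object_eq_0_iff[of \<Gamma> c, OF smooth_on_imp_differentiable[OF \<Gamma> that]] by blast
  \<comment> \<open>The curvature vanishes on the open set \<open>U\<close> and not merely at
    \<open>x\<close>, so its derivative in direction \<open>\<xi>\<close> vanishes too.\<close>
  have "((\<lambda>x. 0) has_derivative (\<lambda>\<xi>. curv_deriv (\<Gamma> c) x \<xi> u v w)) (at x)" for u v w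
    by (rule has_derivative_transform_within_open[OF has_derivative_curvature[OF U \<Gamma> sym x] U x]) (rule J)
  from has_derivative_unique[OF this has_derivative_const]
  have "curv_deriv (\<Gamma> c) x \<xi> u v w = 0" for u v w by (rule fun_cong)
  then have eq: "bil (frechet_derivative (linear_system \<Gamma> c) (at (x, \<xi>, p)) (prolongation (linear_system \<Gamma> c) (x, \<xi>, p) u)) v w
    - bil (frechet_derivative (linear_system \<Gamma> c) (at (x, \<xi>, p)) (prolongation (linear_system \<Gamma> c) (x, \<xi>, p) v)) u w = 0"
    for u v w
    by (simp only: linear_system_defect[OF x] J[OF x]) simp
  show ?thesis
    unfolding compatible_bil by (intro allI, rule iffD2[OF eq_iff_diff_eq_0], rule eq)
qed

lemma integrability_object_eq_0I:
  assumes x: "x \<in> U" and comp: "compatible (linear_system \<Gamma> c) (x, 0, mat 1)"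
  shows "integrability_object \<Gamma> c x = 0"
proof -
  have "curv_deriv (\<Gamma> c) x 0 u v w = 0" for u v w
    using linear_0[OF has_derivative_linear[OF has_derivative_curvature[OF U \<Gamma> sym x]]] .
  \<comment> \<open>With \<open>p\<close> the identity and \<open>\<xi> = 0\<close>, the defect is
    -J + J + J + J.\<close>
  then have "2 *\<^sub>R curvature_at (\<Gamma> c) x (axis r 1) (axis j 1) (axis k 1) = 0" for r j k
    using comp linear_system_defect[OF x, of 0 "mat 1" "axis r 1" "axis j 1" "axis k 1"]
    unfolding compatible_bil by (simp add: scaleR_2)
  then show ?thesis
    by (simp add: vec_eq_iff integrability_object_curv[of \<Gamma> c, OF smooth_on_imp_differentiable[OF \<Gamma> x]])
qed

text \<open>\<open>total_derivative\<close> differentiates in the three groups of variables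
  separately, with the three components of the prolonged direction as coefficients. The joint
  derivative is linear, so these contributions add up to its value on that direction.\<close>

lemma total_derivative_eq:
  assumes x: "x \<in> U"
  shows "total_derivative \<Gamma> c r (\<lambda>z \<eta> \<eta>1. P_lin \<Gamma> c z \<eta> \<eta>1 $ i $ j $ k) x \<xi> p =
    frechet_derivative (linear_system \<Gamma> c) (at (x, \<xi>, p))
      (prolongation (linear_system \<Gamma> c) (x, \<xi>, p) (axis r 1)) $ i $ j $ k"
proof -
  let ?z = "(x, \<xi>, p)" and ?K = "linear_system \<Gamma> c"
  let ?D = "\<lambda>h. frechet_derivative ?K (at ?z) h $ i $ j $ k"
  have D: "((\<lambda>z. ?K z $ i $ j $ k) has_derivative ?D) (at ?z)"
    using smooth_on_has_derivative[OF smooth_on_linear_system[of U \<Gamma> c, OF U \<Gamma>], of ?z] x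
    by (intro has_derivative_vec_nth) auto
  have lin: "linear ?D" using has_derivative_linear[OF D] .
  have K: "?K (a, b, q) = P_lin \<Gamma> c a b q" for a b q by (simp add: linear_system_def)
  have e1: "((\<lambda>z. (z, \<xi>, p)) has_derivative (\<lambda>u. (u, 0, 0))) (at x)"
    and e2: "((\<lambda>z. (x, z, p)) has_derivative (\<lambda>u. (0, u, 0))) (at \<xi>)"
    and e3: "((\<lambda>z. (x, \<xi>, z)) has_derivative (\<lambda>u. (0, 0, u))) (at p)"
    by (auto intro!: derivative_eq_intros simp: fun_eq_iff zero_prod_def)
  have 1: "((\<lambda>z. P_lin \<Gamma> c z \<xi> p $ i $ j $ k) has_derivative (\<lambda>u. ?D (u, 0, 0))) (at x)"
    using has_derivative_compose[OF e1, of "\<lambda>z. ?K z $ i $ j $ k" ?D] D by (simp add: K)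
  have 2: "((\<lambda>\<eta>. P_lin \<Gamma> c x \<eta> p $ i $ j $ k) has_derivative (\<lambda>u. ?D (0, u, 0))) (at \<xi>)"
    using has_derivative_compose[OF e2, of "\<lambda>z. ?K z $ i $ j $ k" ?D] D by (simp add: K)
  have 3: "((\<lambda>\<eta>1. P_lin \<Gamma> c x \<xi> \<eta>1 $ i $ j $ k) has_derivative (\<lambda>u. ?D (0, 0, u))) (at p)"
    using has_derivative_compose[OF e3, of "\<lambda>z. ?K z $ i $ j $ k" ?D] D by (simp add: K)
  have l2: "linear (\<lambda>u. ?D (0, u, 0))" and l3: "linear (\<lambda>u. ?D (0, 0, u))"
    using has_derivative_linear[OF 2] has_derivative_linear[OF 3] .
  have mat: "q = (\<Sum>a\<in>UNIV. \<Sum>b\<in>UNIV. q $ a $ b *\<^sub>R axis a (axis b 1))" for q :: "real^'n^'n"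
  proof -
    have "(\<Sum>b\<in>UNIV. q $ a $ b *\<^sub>R axis a (axis b 1)) = axis a (q $ a)" for a
      by (rule linear_axis_sum[symmetric]) (rule bounded_linear.linear[OF bounded_linear_axis])
    then show ?thesis by (simp only: sum_axis[symmetric])
  qed
  have M: "?D (0, 0, q) = (\<Sum>a\<in>UNIV. \<Sum>b\<in>UNIV. q $ a $ b * ?D (0, 0, axis a (axis b 1)))" for q
  proof -
    have "?D (0, 0, \<Sum>a\<in>UNIV. \<Sum>b\<in>UNIV. q $ a $ b *\<^sub>R axis a (axis b 1)) =
      (\<Sum>a\<in>UNIV. \<Sum>b\<in>UNIV. q $ a $ b * ?D (0, 0, axis a (axis b 1)))"
      unfolding linear_sum[OF l3] linear_scale[OF l3] by simp
    then show ?thesis unfolding mat[symmetric] .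
  qed
  have A: "(\<Sum>a\<in>UNIV. p $ a $ r * ?D (0, axis a 1, 0)) = ?D (0, p *v axis r 1, 0)"
    by (subst linear_axis_sum[OF l2, of "p *v axis r 1"]) (simp add: matrix_vector_mult_basis column_def)
  have B: "(\<Sum>a\<in>UNIV. \<Sum>b\<in>UNIV. P_lin \<Gamma> c x \<xi> p $ a $ b $ r * ?D (0, 0, axis a (axis b 1))) =
      ?D (0, 0, contract (?K ?z) (axis r 1))"
    by (subst M) (simp add: contract_axis linear_system_def)
  have C: "?D (prolongation ?K ?z (axis r 1)) =
      ?D (axis r 1, 0, 0) + ?D (0, p *v axis r 1, 0) + ?D (0, 0, contract (?K ?z) (axis r 1))"
    by (simp add: linear_add[OF lin, symmetric] prolongation_def)
  show ?thesis
    unfolding total_derivative_def pd_eq[OF 1] pd_eq[OF 2] frechet_derivative_at[OF 3, symmetric]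
    by (simp only: A B C)
qed

lemma linear_curvature_eq_0_iff:
  assumes "x \<in> U"
  shows "linear_curvature \<Gamma> c (x, \<xi>, p) = 0 \<longleftrightarrow> compatible (linear_system \<Gamma> c) (x, \<xi>, p)"
  unfolding linear_curvature_def compatible_def case_prod_conv total_derivative_eq[OF assms]
  by (simp add: vec_eq_iff)

end

section \<open>Diffeomorphisms and vector fields in charts\<close>

text \<open>The inverse function theorem gives a differentiable local inverse \<open>g\<close> whose
  derivative at \<open>y\<close> is the inverse of the Jacobian at \<open>g y\<close>. This is a
  smooth function of \<open>g y\<close> by Cramer's rule, so bootstrapping makes \<open>g\<close>
  smooth.\<close>

lemma smooth_local_inverse:
  fixes F :: "real^'n \<Rightarrow> real^'n"
  assumes S: "open S" "x \<in> S" and F: "smooth_on S F" and inv: "invertible (jac F x)"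
  obtains U G where "open U" "x \<in> U" "U \<subseteq> S" "open (F ` U)" "smooth_on (F ` U) G"
    "\<And>z. z \<in> U \<Longrightarrow> G (F z) = z"
proof -
  obtain f' where f': "\<And>z. z \<in> S \<Longrightarrow> (F has_derivative blinfun_apply (f' z)) (at z)"
    and cf': "continuous_on S f'"
    using smooth_on_blinfun_derivative[OF F] by blast
  have f'_jac: "blinfun_apply (f' z) = (\<lambda>v. jac F z *v v)" if "z \<in> S" for z
    using has_derivative_unique[OF f'[OF that] jac_has_derivative[OF smooth_on_imp_differentiable[OF F that]]] .
  obtain B where B: "B ** jac F x = mat 1" using inv by (auto simp: invertible_def)
  have "Blinfun (\<lambda>v. B *v v) o\<^sub>L f' x = id_blinfun"
    using B
    by (intro blinfun_eqI) (simp add: bounded_linear_Blinfun_apply matrix_vector_mul_bounded_linear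
        f'_jac[OF S(2)] matrix_vector_mul_assoc)
  note ift = inverse_function_theorem[OF S(1) f' cf' S(2) this]
  obtain U V g g' where U: "open U" "U \<subseteq> S" "x \<in> U" "open V" "homeomorphism U V F g"
    and g: "\<And>y. y \<in> V \<Longrightarrow> (g has_derivative g' y) (at y)"
    and g': "\<And>y. y \<in> V \<Longrightarrow> g' y = Hilbert_Choice.inv (blinfun_apply (f' (g y)))"
    and bij: "\<And>y. y \<in> V \<Longrightarrow> bij (blinfun_apply (f' (g y)))"
  proof (rule ift)
    fix U' V g g'
    assume "open U'" "U' \<subseteq> S" "x \<in> U'" "open V" "F x \<in> V" "homeomorphism U' V F g"
      "\<And>y. y \<in> V \<Longrightarrow> (g has_derivative g' y) (at y)"
      "\<And>y. y \<in> V \<Longrightarrow> g' y = Hilbert_Choice.inv (blinfun_apply (f' (g y)))"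
      "\<And>y. y \<in> V \<Longrightarrow> bij (blinfun_apply (f' (g y)))"
    then show thesis by (intro that)
  qed
  have V: "F ` U = V" and gF: "\<And>z. z \<in> U \<Longrightarrow> g (F z) = z" and gV: "g ` V = U"
    using U(5) by (auto simp: homeomorphism_def)
  have bijU: "bij (\<lambda>v. jac F z *v v)" if "z \<in> U" for z
    using bij[of "F z"] gF[OF that] that V U(2) by (auto simp: f'_jac)
  define D where "D z = Hilbert_Choice.inv (\<lambda>v. jac F z *v v)" for z
  have "smooth_on V g"
  proof (rule smooth_on_chain[OF U(4) U(1)])
    show "g ` V \<subseteq> U" using gV by simp
    show "(g has_derivative D (g y)) (at y)" if "y \<in> V" for y
    proof -
      have "g y \<in> S" using that gV U(2) by auto
      then show ?thesis using g[OF that] g'[OF that] by (simp add: D_def f'_jac)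
    qed
    show "smooth_on U (\<lambda>z. D z v)" for v
    proof (rule smooth_on_cramer[OF U(1) _ smooth_on_const])
      show "smooth_on U (jac F)"
        using smooth_on_subset[OF smooth_on_jac[OF S(1) F] U(2)] .
      fix z assume "z \<in> U"
      note b = bijU[OF this]
      show "jac F z *v D z v = v"
        unfolding D_def using surj_f_inv_f[OF bij_is_surj[OF b]] .
      show "det (jac F z) \<noteq> 0"
        using b unfolding invertible_det_nz[symmetric] invertible_eq_bij .
    qed
  qed
  then have "smooth_on (F ` U) g" by (simp only: V)
  moreover have "open (F ` U)" using U(4) by (simp only: V)
  ultimately show ?thesis using gF by (intro that[of U g] U(1-3))
qed

text \<open>The Taylor polynomial with 2-jet \<open>(y, B, C)\<close> at \<open>x\<close> when
  \<open>C\<close> is symmetric in its lower indices. It is the witness for prescribed jets, both of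
  diffeomorphisms and of vector fields.\<close>

definition quadratic_map :: "real^'n \<Rightarrow> real^'n \<Rightarrow> real^'n^'n \<Rightarrow> real^'n^'n^'n \<Rightarrow> real^'n \<Rightarrow> real^'n" where
  "quadratic_map x y B C z = y + B *v (z - x) + (1/2) *\<^sub>R bil C (z - x) (z - x)"

lemma smooth_on_quadratic_map: "smooth_on UNIV (quadratic_map x y B C)"
  unfolding quadratic_map_def[abs_def] bil_def
  by (intro smooth_on_add smooth_on_scaleR smooth_on_matrix_vector_mult smooth_on_diff smooth_on_const smooth_on_ident
      smooth_on_bounded_bilinear[OF _ bounded_bilinear_contract] open_UNIV)

lemma quadratic_map_jet:
  assumes sym: "\<And>i j k. C $ i $ j $ k = C $ i $ k $ j"
  shows "quadratic_map x y B C x = y" "jac (quadratic_map x y B C) x = B" "hess (quadratic_map x y B C) x = C"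
proof -
  have D: "(quadratic_map x y B C has_derivative (\<lambda>h. B *v h + bil C h (z - x))) (at z)" for z
  proof -
    have s: "((\<lambda>z. z - x) has_derivative (\<lambda>h. h)) (at z)" by (auto intro!: derivative_eq_intros)
    have 1: "((\<lambda>z. B *v (z - x)) has_derivative (\<lambda>h. B *v h)) (at z)"
      using has_derivative_matrix_vector[OF has_derivative_const s] by simp
    have 2: "((\<lambda>z. bil C (z - x) (z - x)) has_derivative (\<lambda>h. bil C h (z - x) + bil C (z - x) h)) (at z)"
      using has_derivative_bil[OF has_derivative_const s s] by (simp add: linear_0[OF linear_bil(1)])
    have "(quadratic_map x y B C has_derivative
        (\<lambda>h. 0 + B *v h + (1/2) *\<^sub>R (bil C h (z - x) + bil C (z - x) h))) (at z)"
      unfolding quadratic_map_def[abs_def]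
      by (intro has_derivative_add has_derivative_const 1 has_derivative_scaleR_right 2)
    moreover have "(\<lambda>h. 0 + B *v h + (1/2) *\<^sub>R (bil C h (z - x) + bil C (z - x) h)) = (\<lambda>h. B *v h + bil C h (z - x))"
      by (simp add: fun_eq_iff bil_sym[OF sym, of "z - x"] scaleR_2[symmetric])
    ultimately show ?thesis by simp
  qed
  have j: "jac (quadratic_map x y B C) z $ i $ j = B $ i $ j + (bil C (axis j 1) (z - x)) $ i" for z i j
    by (simp add: jac_eq[OF D] matrix_vector_mult_basis column_def)
  show "quadratic_map x y B C x = y"
    by (simp add: quadratic_map_def linear_0[OF linear_bil(2)])
  show "jac (quadratic_map x y B C) x = B"
    by (simp add: vec_eq_iff j linear_0[OF linear_bil(3)])
  have "((\<lambda>z. B $ i $ j + bil C (axis j 1) (z - x) $ i) has_derivative (\<lambda>h. bil C (axis j 1) h $ i)) (at x)" for i j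
  proof -
    have s: "((\<lambda>z. z - x) has_derivative (\<lambda>h. h)) (at x)" by (auto intro!: derivative_eq_intros)
    have "((\<lambda>z. bil C (axis j 1) (z - x)) has_derivative (\<lambda>h. bil C (axis j 1) h)) (at x)"
      using has_derivative_bil[OF has_derivative_const has_derivative_const s]
      by (simp add: linear_0[OF linear_bil(1)] linear_0[OF linear_bil(2)])
    from has_derivative_add[OF has_derivative_const has_derivative_vec_nth[OF this]] show ?thesis by simp
  qed
  note pd = pd_eq[OF this]
  have "hess (quadratic_map x y B C) x $ i $ j $ k = C $ i $ j $ k" for i j k
    unfolding hess_eq_pd_jac j pd bil_axis ..
  then show "hess (quadratic_map x y B C) x = C" by (simp add: vec_eq_iff)
qed

section \<open>Maps and fields in the charts of a manifold\<close>

context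
  fixes A :: "('m::{t2_space, second_countable_topology}, 'n::finite) chart set"
  assumes A: "smooth_manifold A"
begin

lemma
  assumes "c \<in> A"
  shows open_dom: "open (dom_of c)" and open_coords: "open (coord c ` dom_of c)"
    and point_coord: "\<And>p. p \<in> dom_of c \<Longrightarrow> point c (coord c p) = p"
    and coord_point: "\<And>z. z \<in> coord c ` dom_of c \<Longrightarrow> coord c (point c z) = z"
    and point_in_dom: "\<And>z. z \<in> coord c ` dom_of c \<Longrightarrow> point c z \<in> dom_of c"
    and continuous_coord: "continuous_on (dom_of c) (coord c)"
    and continuous_point: "continuous_on (coord c ` dom_of c) (point c)"
proof -
  have c: "is_chart c" using A assms by (simp add: smooth_manifold_def)
  then show "open (dom_of c)" "open (coord c ` dom_of c)" by (simp_all add: is_chart_def)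
  have h: "homeomorphism (dom_of c) (coord c ` dom_of c) (coord c) (point c)" using c by (simp add: is_chart_def)
  then show "continuous_on (dom_of c) (coord c)" "continuous_on (coord c ` dom_of c) (point c)"
    "\<And>p. p \<in> dom_of c \<Longrightarrow> point c (coord c p) = p"
    unfolding homeomorphism_def by blast+
  show "coord c (point c z) = z" "point c z \<in> dom_of c" if "z \<in> coord c ` dom_of c" for z
    using that by (auto intro: f_inv_into_f inv_into_into)
qed

lemma coord_image: "c \<in> A \<Longrightarrow> coord c ` (W \<inter> dom_of c) = {z \<in> coord c ` dom_of c. point c z \<in> W}"
  by (auto simp: point_coord)

lemma point_image:
  assumes c: "c \<in> A" and U: "U \<subseteq> coord c ` dom_of c"
  shows "point c ` U = {p \<in> dom_of c. coord c p \<in> U}"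
proof (intro set_eqI iffI)
  fix p assume "p \<in> point c ` U"
  then obtain u where u: "u \<in> U" "p = point c u" by blast
  then have "u \<in> coord c ` dom_of c" using U by blast
  then show "p \<in> {p \<in> dom_of c. coord c p \<in> U}"
    using u coord_point[OF c] point_in_dom[OF c] by simp
next
  fix p assume "p \<in> {p \<in> dom_of c. coord c p \<in> U}"
  then show "p \<in> point c ` U" using point_coord[OF c, of p] by (metis (mono_tags, lifting) imageI mem_Collect_eq)
qed

lemma open_coord_image:
  assumes "c \<in> A" "open W"
  shows "open (coord c ` (W \<inter> dom_of c))"
proof -
  have "open (coord c ` dom_of c \<inter> point c -` W)"
    by (rule continuous_open_preimage[OF continuous_point open_coords]) (use assms in auto)
  moreover have "coord c ` dom_of c \<inter> point c -` W = coord c ` (W \<inter> dom_of c)"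
    unfolding coord_image[OF assms(1)] by auto
  ultimately show ?thesis by simp
qed

lemma open_point_image:
  assumes "c \<in> A" "open U" "U \<subseteq> coord c ` dom_of c"
  shows "open (point c ` U)"
proof -
  have "open (dom_of c \<inter> coord c -` U)"
    by (rule continuous_open_preimage[OF continuous_coord open_dom]) (use assms in auto)
  moreover have "dom_of c \<inter> coord c -` U = point c ` U"
    unfolding point_image[OF assms(1,3)] by auto
  ultimately show ?thesis by simp
qed

lemma smooth_on_transition:
  "c \<in> A \<Longrightarrow> d \<in> A \<Longrightarrow> smooth_on (coord c ` (dom_of c \<inter> dom_of d)) (transition c d)"
  using A by (simp add: smooth_manifold_def)

lemma open_overlap: "c \<in> A \<Longrightarrow> d \<in> A \<Longrightarrow> open (coord c ` (dom_of c \<inter> dom_of d))"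
  using open_coord_image[of c "dom_of d"] open_dom[of d] by (simp add: Int_commute)

text \<open>Composing \<open>F\<close> with transition maps on both sides gives the local expression
  in every other pair of charts, so one pair is enough.\<close>

lemma smooth_map_in_charts:
  assumes c: "c \<in> A" and d: "d \<in> A" and U: "open U" "U \<subseteq> coord c ` dom_of c"
    and F: "smooth_on U F" "F ` U \<subseteq> coord d ` dom_of d"
    and h: "\<And>p. p \<in> point c ` U \<Longrightarrow> h p = point d (F (coord c p))"
  shows "smooth_map_on A (point c ` U) h"
  unfolding smooth_map_on_def
proof (intro conjI ballI)
  let ?W = "point c ` U"
  have W: "open ?W" using open_point_image[OF c U] .
  have Wc: "?W = {p \<in> dom_of c. coord c p \<in> U}" using point_image[OF c U(2)] .
  have "continuous_on ?W (\<lambda>p. F (coord c p))"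
    by (rule continuous_on_compose2[OF smooth_on_imp_continuous_on[OF F(1)]
          continuous_on_subset[OF continuous_coord[OF c]]]) (auto simp: Wc)
  then have "continuous_on ?W (\<lambda>p. point d (F (coord c p)))"
    by (rule continuous_on_compose2[OF continuous_point[OF d]]) (use F Wc in auto)
  then show cont: "continuous_on ?W h"
    using h by (simp cong: continuous_on_cong)
  fix c' d' assume c': "c' \<in> A" and d': "d' \<in> A"
  let ?P = "{p \<in> ?W \<inter> dom_of c'. h p \<in> dom_of d'}"
  have "open (?W \<inter> h -` dom_of d')"
    by (rule continuous_open_preimage[OF cont W open_dom[OF d']])
  then have "open (coord c' ` ((?W \<inter> h -` dom_of d') \<inter> dom_of c'))"
    by (rule open_coord_image[OF c'])
  moreover have "(?W \<inter> h -` dom_of d') \<inter> dom_of c' = ?P" by auto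
  ultimately have oP: "open (coord c' ` ?P)" by simp
  have 1: "smooth_on (coord c' ` ?P) (transition c' c)"
    by (rule smooth_on_subset[OF smooth_on_transition[OF c' c]]) (auto simp: Wc)
  have m1: "transition c' c ` coord c' ` ?P \<subseteq> U"
    by (auto simp: transition_def point_coord[OF c'] Wc)
  have 2: "smooth_on (coord c' ` ?P) (\<lambda>z. F (transition c' c z))"
    by (rule smooth_on_compose[OF oP U(1) m1 1 F(1)])
  have "smooth_on (coord c' ` ?P) (\<lambda>z. transition d d' (F (transition c' c z)))"
  proof (rule smooth_on_compose[OF oP open_overlap[OF d d'] _ 2 smooth_on_transition[OF d d']])
    show "(\<lambda>z. F (transition c' c z)) ` coord c' ` ?P \<subseteq> coord d ` (dom_of d \<inter> dom_of d')"
    proof clarsimp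
      fix u assume u: "point c u \<in> dom_of c'" "u \<in> U" "h (point c u) \<in> dom_of d'"
      have cu: "coord c (point c u) = u" using coord_point[OF c] U(2) u(2) by auto
      then have hu: "h (point c u) = point d (F u)" using h[of "point c u"] u(2) by auto
      have Fu: "F u \<in> coord d ` dom_of d" using F(2) u(2) by auto
      have "F (transition c' c (coord c' (point c u))) = coord d (point d (F u))"
        by (simp add: transition_def point_coord[OF c' u(1)] cu coord_point[OF d Fu])
      then show "F (transition c' c (coord c' (point c u))) \<in> coord d ` (dom_of d \<inter> dom_of d')"
        using point_in_dom[OF d Fu] u(3) hu by auto
    qed
  qed
  then show "smooth_on (coord c' ` ?P) (in_charts c' d' h)"
  proof (rule smooth_on_cong[OF oP, rotated])
    fix z assume "z \<in> coord c' ` ?P"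
    then obtain p where p: "z = coord c' p" "p \<in> ?W" "p \<in> dom_of c'" by auto
    then show "transition d d' (F (transition c' c z)) = in_charts c' d' h z"
      by (simp add: transition_def in_charts_def point_coord[OF c'] h)
  qed
qed

text \<open>The inverse on the image is again given by a coordinate map, namely \<open>G\<close>
  with the charts exchanged, so \<open>smooth_map_in_charts\<close> covers both directions.\<close>

lemma diffeo_from_coordinates:
  assumes c: "c \<in> A" and d: "d \<in> A" and U: "open U" "U \<subseteq> coord c ` dom_of c"
    and F: "smooth_on U F" "open (F ` U)" "F ` U \<subseteq> coord d ` dom_of d"
    and G: "smooth_on (F ` U) G" "\<And>z. z \<in> U \<Longrightarrow> G (F z) = z"
  shows "diffeo_on A (point c ` U) (\<lambda>p. point d (F (coord c p)))"
proof -
  let ?f = "\<lambda>p. point d (F (coord c p))" and ?W = "point c ` U"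
  have cu: "coord c (point c u) = u" if "u \<in> U" for u using coord_point[OF c] U(2) that by auto
  have du: "coord d (point d (F u)) = F u" if "u \<in> U" for u using coord_point[OF d] F(3) that by auto
  have fW: "?f ` ?W = point d ` (F ` U)" by (auto simp: cu image_iff)
  have inj: "inj_on ?f ?W"
  proof (rule inj_onI, clarsimp simp: cu)
    fix u v assume uv: "u \<in> U" "v \<in> U" "point d (F u) = point d (F v)"
    then have "F u = F v" using du by metis
    then show "point c u = point c v" using G(2) uv by metis
  qed
  have inv: "smooth_map_on A (point d ` (F ` U)) (inv_into ?W ?f)"
  proof (rule smooth_map_in_charts[OF d c F(2,3) G(1)])
    show "G ` F ` U \<subseteq> coord c ` dom_of c" using G(2) U(2) by auto
    fix p assume "p \<in> point d ` F ` U"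
    then obtain u where u: "u \<in> U" "p = point d (F u)" by auto
    have "inv_into ?W ?f (?f (point c u)) = point c u"
      by (rule inv_into_f_f[OF inj]) (use u in auto)
    then show "inv_into ?W ?f p = point c (G (coord d p))"
      using u by (simp add: cu du G(2))
  qed
  have smooth: "smooth_map_on A ?W ?f" by (rule smooth_map_in_charts[OF c d U F(1,3)]) simp
  have "?W \<subseteq> dom_of c" "point d ` F ` U \<subseteq> dom_of d"
    using U(2) F(3) by (auto intro!: point_in_dom[OF c] point_in_dom[OF d])
  moreover have "dom_of c \<subseteq> carrier_of A" "dom_of d \<subseteq> carrier_of A"
    using c d by (auto simp: carrier_of_def)
  ultimately have sub: "?W \<subseteq> carrier_of A" "point d ` F ` U \<subseteq> carrier_of A"
    by (simp_all only: order_trans)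
  show ?thesis
    unfolding diffeo_on_def fW
    by (intro conjI open_point_image[OF c U] open_point_image[OF d F(2,3)] inj smooth inv sub)
qed

text \<open>Read in the exchanged charts, the smooth inverse is a left inverse of the local
  expression near the point; the chain rule then provides a left inverse of the Jacobian.\<close>

lemma local_diffeo_coordinates:
  assumes c: "c \<in> A" and d: "d \<in> A" and p: "p \<in> dom_of c" "f p \<in> dom_of d" and f: "local_diffeo_at A p f"
  obtains S where "open S" "coord c p \<in> S" "S \<subseteq> coord c ` dom_of c" "smooth_on S (in_charts c d f)"
    "\<And>z. z \<in> S \<Longrightarrow> f (point c z) \<in> dom_of d"
    "invertible (jac (in_charts c d f) (coord c p))"
proof -
  obtain W where W: "p \<in> W" "diffeo_on A W f" using f by (auto simp: local_diffeo_at_def)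
  have oW: "open W" and cf: "continuous_on W f" and ofW: "open (f ` W)" and inj: "inj_on f W"
    and sf: "smooth_map_on A W f" and sg: "smooth_map_on A (f ` W) (inv_into W f)"
    using W(2) by (auto simp: diffeo_on_def smooth_map_on_def)
  let ?g = "inv_into W f"
  define S where "S = coord c ` {q \<in> W \<inter> dom_of c. f q \<in> dom_of d}"
  define S' where "S' = coord d ` {q \<in> f ` W \<inter> dom_of d. ?g q \<in> dom_of c}"
  have F: "smooth_on S (in_charts c d f)" using sf c d by (simp add: smooth_map_on_def S_def)
  have G: "smooth_on S' (in_charts d c ?g)" using sg c d by (simp add: smooth_map_on_def S'_def)
  have "open (W \<inter> f -` dom_of d)"
    by (rule continuous_open_preimage[OF cf oW open_dom[OF d]])
  then have "open (coord c ` ((W \<inter> f -` dom_of d) \<inter> dom_of c))"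
    by (rule open_coord_image[OF c])
  moreover have "(W \<inter> f -` dom_of d) \<inter> dom_of c = {q \<in> W \<inter> dom_of c. f q \<in> dom_of d}" by auto
  ultimately have oS: "open S" by (simp add: S_def)
  have x: "coord c p \<in> S" using p W by (auto simp: S_def)
  have Fz: "in_charts c d f (coord c q) = coord d (f q)" if "q \<in> dom_of c" for q
    using that by (simp add: in_charts_def point_coord[OF c])
  have GF: "in_charts d c ?g (in_charts c d f z) = z" if z: "z \<in> S" for z
  proof -
    obtain q where q: "z = coord c q" "q \<in> W" "q \<in> dom_of c" "f q \<in> dom_of d"
      using z by (auto simp: S_def)
    then show ?thesis
      by (simp add: Fz in_charts_def[of d] point_coord[OF d] inv_into_f_f[OF inj])
  qed
  have y: "in_charts c d f (coord c p) \<in> S'"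
    using p W by (auto simp: Fz S'_def inv_into_f_f[OF inj])
  let ?x = "coord c p" and ?F = "in_charts c d f" and ?G = "in_charts d c ?g"
  have dF: "(?F has_derivative (\<lambda>v. jac ?F ?x *v v)) (at ?x)"
    by (rule jac_has_derivative[OF smooth_on_imp_differentiable[OF F x]])
  have dG: "(?G has_derivative (\<lambda>v. jac ?G (?F ?x) *v v)) (at (?F ?x))"
    by (rule jac_has_derivative[OF smooth_on_imp_differentiable[OF G y]])
  have "((\<lambda>z. z) has_derivative (\<lambda>v. jac ?G (?F ?x) *v (jac ?F ?x *v v))) (at ?x)"
    by (rule has_derivative_transform_within_open[OF has_derivative_compose[OF dF dG] oS x]) (rule GF)
  from has_derivative_unique[OF this has_derivative_ident]
  have "jac ?G (?F ?x) *v (jac ?F ?x *v v) = v" for v by (rule fun_cong)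
  then have "jac ?G (?F ?x) ** jac ?F ?x = mat 1"
    by (simp add: matrix_eq matrix_vector_mul_assoc[symmetric])
  then have inv: "invertible (jac ?F ?x)" unfolding invertible_left_inverse by blast
  have sub: "S \<subseteq> coord c ` dom_of c" by (auto simp: S_def)
  have dom: "f (point c z) \<in> dom_of d" if "z \<in> S" for z
    using that by (auto simp: S_def point_coord[OF c])
  show ?thesis by (rule that[OF oS x sub F dom inv])
qed

text \<open>A \<open>vfield\<close> assigns components in every chart, so those given in
  \<open>c\<close> are extended by the transformation rule of vectors. Values at points outside the
  domain of \<open>c\<close> carry no meaning.\<close>

definition coordinate_field :: "('m, 'n) chart \<Rightarrow> (real^'n \<Rightarrow> real^'n) \<Rightarrow> ('m, 'n) vfield" where
  "coordinate_field c X d y = jac (transition c d) (transition d c y) *v X (transition d c y)"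

lemma coordinate_field_same:
  assumes c: "c \<in> A" and x: "x \<in> coord c ` dom_of c"
  shows "coordinate_field c X c x = X x"
proof -
  have id: "transition c c z = z" if "z \<in> coord c ` dom_of c" for z
    using that coord_point[OF c] by (simp add: transition_def)
  have "jac (transition c c) x = jac (\<lambda>z. z) x"
    by (rule jac_cong[OF open_coords[OF c] x]) (rule id)
  also have "\<dots> = mat 1"
  proof -
    have "jac (\<lambda>z. z) x $ i $ j = mat 1 $ i $ j" for i j
      by (simp add: jac_eq[OF has_derivative_ident] mat_def axis_def)
    then show ?thesis unfolding vec_eq_iff by blast
  qed
  finally show ?thesis by (simp add: coordinate_field_def id[OF x])
qed

lemma vector_field_coordinate_field:
  assumes c: "c \<in> A" and U: "open U" "U \<subseteq> coord c ` dom_of c" and X: "smooth_on U X"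
  shows "vector_field_on A (point c ` U) (coordinate_field c X)"
  unfolding vector_field_on_def
proof (intro conjI ballI)
  let ?W = "point c ` U"
  have Wc: "?W = {p \<in> dom_of c. coord c p \<in> U}" using point_image[OF c U(2)] .
  show W: "open ?W" using open_point_image[OF c U] .
  show "?W \<subseteq> carrier_of A" using c by (auto simp: Wc carrier_of_def)
  fix d assume d: "d \<in> A"
  have o: "open (coord d ` (?W \<inter> dom_of d))" by (rule open_coord_image[OF d W])
  have t: "smooth_on (coord d ` (?W \<inter> dom_of d)) (transition d c)"
    by (rule smooth_on_subset[OF smooth_on_transition[OF d c]]) (auto simp: Wc)
  show "smooth_on (coord d ` (?W \<inter> dom_of d)) (coordinate_field c X d)"
    unfolding coordinate_field_def[abs_def]
  proof (rule smooth_on_matrix_vector_mult[OF o])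
    show "smooth_on (coord d ` (?W \<inter> dom_of d)) (\<lambda>y. jac (transition c d) (transition d c y))"
    proof (rule smooth_on_compose[OF o open_overlap[OF c d] _ t smooth_on_jac[OF open_overlap[OF c d] smooth_on_transition[OF c d]]])
      show "transition d c ` coord d ` (?W \<inter> dom_of d) \<subseteq> coord c ` (dom_of c \<inter> dom_of d)"
        by (auto simp: Wc transition_def point_coord[OF d])
    qed
    show "smooth_on (coord d ` (?W \<inter> dom_of d)) (\<lambda>y. X (transition d c y))"
      by (rule smooth_on_compose[OF o U(1) _ t X]) (auto simp: Wc transition_def point_coord[OF d])
  qed
next
  let ?W = "point c ` U"
  have Wc: "?W = {p \<in> dom_of c. coord c p \<in> U}" using point_image[OF c U(2)] .
  fix d e x assume d: "d \<in> A" and e: "e \<in> A" and "x \<in> coord d ` (?W \<inter> dom_of d \<inter> dom_of e)"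
  then obtain p where p: "x = coord d p" "p \<in> dom_of c" "p \<in> dom_of d" "p \<in> dom_of e" by (auto simp: Wc)
  let ?y = "coord c p"
  let ?S = "coord c ` ((dom_of d \<inter> dom_of e) \<inter> dom_of c)"
  have S: "open ?S" "?y \<in> ?S"
    using open_coord_image[OF c open_Int[OF open_dom[OF d] open_dom[OF e]]] p by auto
  have tr: "transition d c x = ?y" "transition d e x = coord e p" "transition e c (coord e p) = ?y" "transition c d ?y = x"
    using p by (simp_all add: transition_def point_coord c d e)
  have 1: "(transition c d has_derivative (\<lambda>v. jac (transition c d) ?y *v v)) (at ?y)"
    by (rule jac_has_derivative[OF smooth_on_imp_differentiable[OF smooth_on_transition[OF c d]]]) (use p in auto)
  have "(transition d e has_derivative (\<lambda>v. jac (transition d e) x *v v)) (at x)"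
    by (rule jac_has_derivative[OF smooth_on_imp_differentiable[OF smooth_on_transition[OF d e]]]) (use p in auto)
  then have 2: "(transition d e has_derivative (\<lambda>v. jac (transition d e) x *v v)) (at (transition c d ?y))"
    by (simp only: tr)
  have 3: "(transition c e has_derivative (\<lambda>v. jac (transition c e) ?y *v v)) (at ?y)"
    by (rule jac_has_derivative[OF smooth_on_imp_differentiable[OF smooth_on_transition[OF c e]]]) (use p in auto)
  \<comment> \<open>The chain rule for
    \<open>transition c e = transition d e \<circ> transition c d\<close> near the point gives the
    cocycle identity of the Jacobians, and this is the transformation rule between the charts
    \<open>d\<close> and \<open>e\<close>.\<close>
  have "(transition c e has_derivative (\<lambda>v. jac (transition d e) x *v (jac (transition c d) ?y *v v))) (at ?y)"
  proof (rule has_derivative_transform_within_open[OF has_derivative_compose[OF 1 2] S])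
    show "transition d e (transition c d z) = transition c e z" if "z \<in> ?S" for z
      using that by (auto simp: transition_def point_coord c d)
  qed
  from has_derivative_unique[OF 3 this]
  have chain: "jac (transition c e) ?y *v v = jac (transition d e) x *v (jac (transition c d) ?y *v v)" for v
    by (rule fun_cong)
  show "coordinate_field c X e (transition d e x) = jac (transition d e) x *v coordinate_field c X d x"
    unfolding coordinate_field_def tr by (rule chain)
qed

end

section \<open>Equivalence of the conditions\<close>

lemma mat_component: "mat b $ i $ j = (if i = j then b else 0)"
  by (simp add: mat_def)

lemma mat_mult_mat: "mat a ** mat b = (mat (a * b) :: real^'n^'n)"
proof -
  have "(mat a ** mat b :: real^'n^'n) $ i $ j = mat (a * b) $ i $ j" for i j
    unfolding matrix_matrix_mult_def by (simp add: mat_component if_distrib[of "\<lambda>t. t * _"] cong: if_cong)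
  then show ?thesis unfolding vec_eq_iff by blast
qed

lemma mat_mult_vec: "(mat b :: real^'n^'n) *v v = b *\<^sub>R v"
  unfolding vec_eq_iff matrix_vector_mult_def
  by (simp add: mat_component if_distrib[of "\<lambda>t. t * _"] cong: if_cong)

lemma matrix_inv_mat_2: "matrix_inv (mat 2 :: real^'n^'n) = mat (1/2)"
  unfolding matrix_inv_def
proof (rule some_equality)
  show "mat 2 ** mat (1/2) = (mat 1 :: real^'n^'n) \<and> mat (1/2) ** mat 2 = (mat 1 :: real^'n^'n)"
    by (simp add: mat_mult_mat)
  fix B :: "real^'n^'n" assume "mat 2 ** B = mat 1 \<and> B ** mat 2 = mat 1"
  then have "mat (1/2) ** (mat 2 ** B) = mat (1/2)" by simp
  then show "B = mat (1/2)" by (simp add: matrix_mul_assoc mat_mult_mat)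
qed

lemma invertible_mat_2: "invertible (mat 2 :: real^'n^'n)"
  unfolding invertible_def by (intro exI[of _ "mat (1/2)"]) (simp add: mat_mult_mat)

lemma sum_mat:
  "(\<Sum>c\<in>UNIV. mat b $ c $ r * X c) = b * (X r :: real)" "(\<Sum>e\<in>UNIV. mat b $ i $ e * X e) = b * (X i :: real)"
  by (simp_all add: mat_component if_distrib[of "\<lambda>t. t * _"] cong: if_cong)

text \<open>Each of the three lower indices contributes a factor 1/2 from the inverse matrix, the
  upper index a factor 2.\<close>

lemma transport_mat_2: "transport (mat 2 :: real^'n^'n) T $ i $ r $ j $ k = T $ i $ r $ j $ k / 4"
proof -
  have "transport (mat 2 :: real^'n^'n) T $ i $ r $ j $ k =
    (\<Sum>c\<in>UNIV. mat (1/2) $ c $ r * (\<Sum>a\<in>UNIV. mat (1/2) $ a $ j * (\<Sum>d\<in>UNIV. mat (1/2) $ d $ k *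
      (\<Sum>e\<in>UNIV. mat 2 $ i $ e * T $ e $ c $ a $ d))))"
    by (simp add: transport_def matrix_inv_mat_2 Let_def sum_distrib_left mult_ac)
  then show ?thesis unfolding sum_mat by simp
qed

lemma transport_mat_2_fixed: "transport (mat 2 :: real^'n^'n) T = T \<Longrightarrow> T = 0"
  using transport_mat_2[of T] by (simp add: vec_eq_iff)

lemma transport_0: "transport B 0 = 0"
  by (simp add: transport_def vec_eq_iff Let_def)

section \<open>Realization of arrows by local diffeomorphisms\<close>

context
  fixes A :: "('m::{t2_space, second_countable_topology}, 'n::finite) chart set"
    and \<Gamma> :: "('m, 'n) gamma"
  assumes A: "smooth_manifold A" and \<Gamma>: "structure_object A \<Gamma>"
begin

lemma smooth_on_\<Gamma>: "c \<in> A \<Longrightarrow> smooth_on (coord c ` dom_of c) (\<Gamma> c)"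
  using \<Gamma> by (simp add: structure_object_def)

lemma \<Gamma>_symmetric: "c \<in> A \<Longrightarrow> \<forall>x\<in>coord c ` dom_of c. \<forall>i j k. \<Gamma> c x $ i $ j $ k = \<Gamma> c x $ i $ k $ j"
  using \<Gamma> by (simp add: structure_object_def)

text \<open>The local expression of \<open>f\<close> agrees with \<open>F\<close> on the open set
  \<open>U\<close>, so all its jets there can be read off \<open>F\<close>. The equation
  \<open>f_def\<close> lets \<open>f\<close> be either a literal term, by \<open>refl\<close>, or a
  locally defined name.\<close>

lemma diffeo_jets:
  assumes c: "c \<in> A" and d: "d \<in> A" and U: "open U" "U \<subseteq> coord c ` dom_of c"
    and F: "smooth_on U F" "open (F ` U)" "F ` U \<subseteq> coord d ` dom_of d"
    and G: "smooth_on (F ` U) G" "\<forall>z\<in>U. G (F z) = z"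
    and z: "z \<in> U" and f_def: "f = (\<lambda>p. point d (F (coord c p)))"
  shows "point c z \<in> dom_of c" "f (point c z) \<in> dom_of d" "local_diffeo_at A (point c z) f"
    "jet1 c d f (point c z) = (z, F z, jac F z)" "jet2 c d f (point c z) = (z, F z, jac F z, hess F z)"
proof -
  have cz: "coord c (point c z) = z" "point c z \<in> dom_of c" if "z \<in> U" for z
    using coord_point[OF A c] point_in_dom[OF A c] U(2) that by auto
  have dz: "coord d (point d (F z)) = F z" "point d (F z) \<in> dom_of d" if "z \<in> U" for z
    using coord_point[OF A d] point_in_dom[OF A d] F(3) that by auto
  show "point c z \<in> dom_of c" "f (point c z) \<in> dom_of d" using cz dz z by (simp_all add: f_def)
  have "diffeo_on A (point c ` U) f"
    unfolding f_def by (rule diffeo_from_coordinates[OF A c d U F G(1)]) (use G(2) in blast)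
  then show "local_diffeo_at A (point c z) f"
    unfolding local_diffeo_at_def using z by blast
  have "in_charts c d f u = F u" if "u \<in> U" for u
    using that by (simp add: in_charts_def f_def cz dz)
  then have "jac (in_charts c d f) z = jac F z" "hess (in_charts c d f) z = hess F z"
    by (auto intro!: jac_cong[OF U(1) z] hess_cong[OF U(1) z])
  then show "jet1 c d f (point c z) = (z, F z, jac F z)" "jet2 c d f (point c z) = (z, F z, jac F z, hess F z)"
    using z by (simp_all add: jet1_def jet2_def f_def cz dz)
qed

text \<open>The quadratic polynomial with these Taylor coefficients is restricted first to where its
  values lie in the target chart and then, by the inverse function theorem, to where it has a smooth
  inverse.\<close>

lemma arrows_exist:
  assumes c: "c \<in> A" and d: "d \<in> A" and x: "x \<in> coord c ` dom_of c" and y: "y \<in> coord d ` dom_of d"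
    and B: "invertible B" and C: "\<And>i j k. C $ i $ j $ k = C $ i $ k $ j"
  shows "(x, y, B) \<in> U1 A c d" "(x, y, B, C) \<in> U2 A c d"
proof -
  let ?F = "quadratic_map x y B C"
  note jet = quadratic_map_jet[of C, OF C]
  define S where "S = coord c ` dom_of c \<inter> ?F -` (coord d ` dom_of d)"
  have S: "open S" "x \<in> S"
    unfolding S_def using x y jet(1)
    by (auto intro!: continuous_open_preimage open_coords[OF A c] open_coords[OF A d]
        smooth_on_imp_continuous_on smooth_on_subset[OF smooth_on_quadratic_map])
  obtain U G where U: "open U" "x \<in> U" "U \<subseteq> S" "open (?F ` U)" "smooth_on (?F ` U) G"
    "\<forall>z\<in>U. G (?F z) = z"
    using smooth_local_inverse[OF S smooth_on_subset[OF smooth_on_quadratic_map subset_UNIV], of x y B C]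
    unfolding jet(2) using B by metis
  have sub: "U \<subseteq> coord c ` dom_of c" "?F ` U \<subseteq> coord d ` dom_of d"
    using U(3) by (auto simp: S_def)
  note f = diffeo_jets[OF c d U(1) sub(1) smooth_on_subset[OF smooth_on_quadratic_map subset_UNIV] U(4) sub(2) U(5,6,2) refl]
  show "(x, y, B) \<in> U1 A c d"
    unfolding U1_def using f(1-4) by (force simp: jet)
  show "(x, y, B, C) \<in> U2 A c d"
    unfolding U2_def using f(1-3,5) by (force simp: jet)
qed

lemma U2_source_target:
  assumes c: "c \<in> A" and d: "d \<in> A" and "(x, y, B, C) \<in> U2 A c d"
  shows "x \<in> coord c ` dom_of c" "y \<in> coord d ` dom_of d" "invertible B"
proof -
  obtain f p where p: "p \<in> dom_of c" "f p \<in> dom_of d" "local_diffeo_at A p f" "(x, y, B, C) = jet2 c d f p"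
    using assms(3) by (auto simp: U2_def)
  show "x \<in> coord c ` dom_of c" "y \<in> coord d ` dom_of d" using p by (auto simp: jet2_def)
  show "invertible B"
    by (rule local_diffeo_coordinates[OF A c d p(1-3)]) (use p(4) in \<open>simp add: jet2_def\<close>)
qed

lemma affine_PHG_iff:
  "(x, y, p, q) \<in> affine_PHG A \<Gamma> c d \<longleftrightarrow> (x, y, p, q) \<in> U2 A c d \<and> q = PHG_system \<Gamma> c d (x, y, p)"
  by (auto simp: affine_PHG_def PHG_system_def vec_eq_iff)

lemma PHG_system_symmetric:
  assumes "c \<in> A" "d \<in> A" "z \<in> coord c ` dom_of c \<times> coord d ` dom_of d \<times> UNIV"
  shows "PHG_system \<Gamma> c d z $ i $ j $ k = PHG_system \<Gamma> c d z $ i $ k $ j"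
proof -
  have "bil (\<Gamma> c (fst z)) v w = bil (\<Gamma> c (fst z)) w v" for v w
    by (rule bil_sym) (use \<Gamma>_symmetric[OF assms(1)] assms(3) in auto)
  moreover have "bil (\<Gamma> d (fst (snd z))) v w = bil (\<Gamma> d (fst (snd z))) w v" for v w
    by (rule bil_sym) (use \<Gamma>_symmetric[OF assms(2)] assms(3) in auto)
  ultimately have "bil (PHG_system \<Gamma> c d z) v w = bil (PHG_system \<Gamma> c d z) w v" for v w
    unfolding bil_PHG_system by metis
  then show ?thesis unfolding bil_axis[symmetric] by metis
qed

lemma linear_system_symmetric:
  assumes "c \<in> A" "z \<in> coord c ` dom_of c \<times> UNIV \<times> UNIV"
  shows "linear_system \<Gamma> c z $ i $ j $ k = linear_system \<Gamma> c z $ i $ k $ j"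
proof -
  have x: "fst z \<in> coord c ` dom_of c" using assms(2) by auto
  note commute = bil_commute[of "coord c ` dom_of c" "\<Gamma> c", OF open_coords[OF A assms(1)] smooth_on_\<Gamma>[OF assms(1)]
      \<Gamma>_symmetric[OF assms(1)] x]
  have "bil (linear_system \<Gamma> c z) v w = bil (linear_system \<Gamma> c z) w v" for v w
    unfolding bil_linear_system[of \<Gamma> c, OF smooth_on_imp_differentiable[OF smooth_on_\<Gamma>[OF assms(1)] x]]
      dir_deriv_def[symmetric] commute(1)[of v w] commute(2)[of _ v w] by simp
  then show ?thesis unfolding bil_axis[symmetric] by metis
qed

text \<open>The dilations on which conditions 1, 2 and 3 are tested. Source, target and charts
  coincide, so the integrability object is compared with itself at a single point.\<close>

lemma doubling_arrow:
  assumes c: "c \<in> A" and x: "x \<in> coord c ` dom_of c"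
  shows "(x, x, mat 2, PHG_system \<Gamma> c c (x, x, mat 2)) \<in> affine_PHG A \<Gamma> c c" "(x, x, mat 2) \<in> U1 A c c"
proof -
  note e = arrows_exist[OF c c x x invertible_mat_2, of "PHG_system \<Gamma> c c (x, x, mat 2)"]
  have "PHG_system \<Gamma> c c (x, x, mat 2) $ i $ j $ k = PHG_system \<Gamma> c c (x, x, mat 2) $ i $ k $ j" for i j k
    using x by (intro PHG_system_symmetric[OF c c]) auto
  from e[OF this] show "(x, x, mat 2) \<in> U1 A c c"
    "(x, x, mat 2, PHG_system \<Gamma> c c (x, x, mat 2)) \<in> affine_PHG A \<Gamma> c c"
    by (simp_all add: affine_PHG_iff)
qed

section \<open>Conditions on the groupoid and its nonlinear curvature\<close>

lemma integrability_object_zero_iff: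
  "c \<in> A \<Longrightarrow> x \<in> coord c ` dom_of c \<Longrightarrow>
    integrability_object \<Gamma> c x = 0 \<longleftrightarrow> (\<forall>u v w. curvature_at (\<Gamma> c) x u v w = 0)"
  by (rule integrability_object_eq_0_iff[OF smooth_on_imp_differentiable[OF smooth_on_\<Gamma>]])

lemma nonlinear_curvature_vanishes_iff:
  "nonlinear_curvature_vanishes A \<Gamma> \<longleftrightarrow> integrability_object_vanishes A \<Gamma>"
proof
  assume R: "nonlinear_curvature_vanishes A \<Gamma>"
  show "integrability_object_vanishes A \<Gamma>"
    unfolding integrability_object_vanishes_def
  proof (intro ballI)
    fix c x assume cx: "c \<in> A" "x \<in> coord c ` dom_of c"
    then have "nonlinear_curvature \<Gamma> c c (x, x, mat 2) = 0"
      using R doubling_arrow(2) unfolding nonlinear_curvature_vanishes_def by blast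
    then show "integrability_object \<Gamma> c x = 0"
      by (intro transport_mat_2_fixed) (simp add: nonlinear_curvature_def)
  qed
next
  assume I: "integrability_object_vanishes A \<Gamma>"
  have "nonlinear_curvature \<Gamma> c d \<alpha> = 0" if "c \<in> A" "d \<in> A" "\<alpha> \<in> U1 A c d" for c d \<alpha>
    using I that by (auto simp: integrability_object_vanishes_def nonlinear_curvature_def U1_def jet1_def transport_0)
  then show "nonlinear_curvature_vanishes A \<Gamma>" by (simp add: nonlinear_curvature_vanishes_def)
qed

lemma invariance_iff:
  "PHG_leaves_integrability_object_invariant A \<Gamma> \<longleftrightarrow> integrability_object_vanishes A \<Gamma>"
proof
  assume R: "PHG_leaves_integrability_object_invariant A \<Gamma>"
  show "integrability_object_vanishes A \<Gamma>"
    unfolding integrability_object_vanishes_def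
  proof (intro ballI)
    fix c x assume cx: "c \<in> A" "x \<in> coord c ` dom_of c"
    then show "integrability_object \<Gamma> c x = 0"
      using R doubling_arrow(1)[OF cx] unfolding PHG_leaves_integrability_object_invariant_def
      by (intro transport_mat_2_fixed) fastforce
  qed
next
  assume I: "integrability_object_vanishes A \<Gamma>"
  show "PHG_leaves_integrability_object_invariant A \<Gamma>"
    unfolding PHG_leaves_integrability_object_invariant_def
  proof (intro ballI, clarify)
    fix c d x y f1 f2 assume cd: "c \<in> A" "d \<in> A" and "(x, y, f1, f2) \<in> affine_PHG A \<Gamma> c d"
    then have "(x, y, f1, f2) \<in> U2 A c d" unfolding affine_PHG_iff by blast
    from U2_source_target[OF cd this]
    have "integrability_object \<Gamma> c x = 0" "integrability_object \<Gamma> d y = 0"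
      using I cd unfolding integrability_object_vanishes_def by blast+
    then show "transport f1 (integrability_object \<Gamma> c x) = integrability_object \<Gamma> d y"
      by (simp add: transport_0)
  qed
qed

text \<open>Turns the germ condition on the manifold into a differential equation on an open set of
  coordinates, the intersection of a domain on which the local expression is smooth with the image
  of the neighbourhood where the 2-jets are controlled.\<close>

lemma PHG_solution_coordinates:
  assumes c: "c \<in> A" and d: "d \<in> A" and x: "x \<in> coord c ` dom_of c"
    and sol: "PHG_solution A \<Gamma> c d (x, y, B, C) f"
  obtains S where "open S" "x \<in> S" "S \<subseteq> coord c ` dom_of c" "smooth_on S (in_charts c d f)"
    "\<And>z. z \<in> S \<Longrightarrow> f (point c z) \<in> dom_of d"
    "\<And>z. z \<in> S \<Longrightarrow> hess (in_charts c d f) z = PHG_system \<Gamma> c d (z, in_charts c d f z, jac (in_charts c d f) z)"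
    "in_charts c d f x = y" "jac (in_charts c d f) x = B"
proof -
  let ?p = "point c x" and ?F = "in_charts c d f"
  have p: "?p \<in> dom_of c" "coord c ?p = x" using point_in_dom[OF A c x] coord_point[OF A c x] .
  have f: "local_diffeo_at A ?p f" "f ?p \<in> dom_of d" "jet2 c d f ?p = (x, y, B, C)"
    and ev: "\<forall>\<^sub>F q in nhds ?p. q \<in> dom_of c \<and> f q \<in> dom_of d \<and> jet2 c d f q \<in> affine_PHG A \<Gamma> c d"
    using sol by (auto simp: PHG_solution_def Let_def)
  obtain T where T: "open T" "x \<in> T" "T \<subseteq> coord c ` dom_of c" "smooth_on T ?F"
    "\<And>z. z \<in> T \<Longrightarrow> f (point c z) \<in> dom_of d"
    using local_diffeo_coordinates[OF A c d p(1) f(2,1)] unfolding p(2) by metis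
  obtain Q where Q: "open Q" "?p \<in> Q" "\<And>q. q \<in> Q \<Longrightarrow> jet2 c d f q \<in> affine_PHG A \<Gamma> c d"
    using ev unfolding eventually_nhds by blast
  define S where "S = T \<inter> coord c ` (Q \<inter> dom_of c)"
  have F: "?F z = coord d (f (point c z))" for z by (simp add: in_charts_def)
  show ?thesis
  proof (rule that[of S])
    show "open S" unfolding S_def by (intro open_Int T open_coord_image[OF A c] Q)
    show "x \<in> S" using T(2) Q(2) p unfolding S_def by force
    show "S \<subseteq> coord c ` dom_of c" "smooth_on S ?F"
      using T(3) smooth_on_subset[OF T(4)] unfolding S_def by auto
    show "f (point c z) \<in> dom_of d" if "z \<in> S" for z using that T(5) by (simp add: S_def)
    show "hess ?F z = PHG_system \<Gamma> c d (z, ?F z, jac ?F z)" if z: "z \<in> S" for z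
    proof -
      have "point c z \<in> Q" "coord c (point c z) = z"
        using z coord_image[OF A c, of Q] coord_point[OF A c, of z] by (auto simp: S_def)
      then have "(z, ?F z, jac ?F z, hess ?F z) \<in> affine_PHG A \<Gamma> c d"
        using Q(3)[of "point c z"] by (simp add: jet2_def F)
      then show ?thesis by (simp add: affine_PHG_iff)
    qed
    show "?F x = y" "jac ?F x = B" using f(3) by (simp_all add: jet2_def F p)
  qed
qed

lemma open_PHG_domain:
  "c \<in> A \<Longrightarrow> d \<in> A \<Longrightarrow> open (coord c ` dom_of c \<times> coord d ` dom_of d \<times> (UNIV :: (real^'n^'n) set))"
  by (intro open_Times open_UNIV open_coords[OF A])

lemma smooth_on_PHG:
  "c \<in> A \<Longrightarrow> d \<in> A \<Longrightarrow> smooth_on (coord c ` dom_of c \<times> coord d ` dom_of d \<times> UNIV) (PHG_system \<Gamma> c d)"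
  by (intro smooth_on_PHG_system open_coords[OF A] smooth_on_\<Gamma>)

lemma PHG_defect:
  assumes c: "c \<in> A" and d: "d \<in> A" and x: "x \<in> coord c ` dom_of c" and y: "y \<in> coord d ` dom_of d"
  shows "bil (frechet_derivative (PHG_system \<Gamma> c d) (at (x, y, p)) (prolongation (PHG_system \<Gamma> c d) (x, y, p) u)) v w
    - bil (frechet_derivative (PHG_system \<Gamma> c d) (at (x, y, p)) (prolongation (PHG_system \<Gamma> c d) (x, y, p) v)) u w
    = curvature_at (\<Gamma> d) y (p *v u) (p *v v) (p *v w) - p *v curvature_at (\<Gamma> c) x u v w"
proof (rule PHG_system_defect)
  show "\<Gamma> c differentiable at x" "\<Gamma> d differentiable at y"
    using smooth_on_imp_differentiable[OF smooth_on_\<Gamma>] c d x y by blast+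
  show "PHG_system \<Gamma> c d differentiable at (x, y, p)"
    by (rule smooth_on_imp_differentiable[OF smooth_on_PHG[OF c d]]) (use x y in auto)
qed (use \<Gamma>_symmetric[OF c] \<Gamma>_symmetric[OF d] x y in blast)+

lemma PHG_integrable_imp_vanishes:
  assumes R: "PHG_uniquely_locally_integrable A \<Gamma>"
  shows "integrability_object_vanishes A \<Gamma>"
  unfolding integrability_object_vanishes_def
proof (intro ballI)
  fix c x assume c: "c \<in> A" and x: "x \<in> coord c ` dom_of c"
  let ?H = "PHG_system \<Gamma> c c" and ?z = "(x, x, mat 2)"
  obtain f where "PHG_solution A \<Gamma> c c (x, x, mat 2, ?H ?z) f"
    using R c doubling_arrow(1)[OF c x] unfolding PHG_uniquely_locally_integrable_def by blast
  then obtain S where S: "open S" "x \<in> S" "smooth_on S (in_charts c c f)"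
    "\<And>z. z \<in> S \<Longrightarrow> hess (in_charts c c f) z = ?H (z, in_charts c c f z, jac (in_charts c c f) z)"
    "in_charts c c f x = x" "jac (in_charts c c f) x = mat 2"
    using PHG_solution_coordinates[OF c c x] by metis
  have "compatible ?H (x, in_charts c c f x, jac (in_charts c c f) x)"
    by (rule second_order_compatible[OF open_PHG_domain[OF c c] smooth_on_PHG[OF c c] S(1-4)]) (use S(5) x in auto)
  then have "compatible ?H ?z" by (simp only: S(5,6))
  then have eq: "curvature_at (\<Gamma> c) x (mat 2 *v axis r 1) (mat 2 *v axis j 1) (mat 2 *v axis k 1) =
      mat 2 *v curvature_at (\<Gamma> c) x (axis r 1) (axis j 1) (axis k 1)" for r j k
    using PHG_defect[OF c c x x, of "mat 2" "axis r 1" "axis j 1" "axis k 1"]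
    unfolding compatible_bil by simp
  have d: "\<Gamma> c differentiable at x" by (rule smooth_on_imp_differentiable[OF smooth_on_\<Gamma>[OF c] x])
  note lin = curv_linear[OF linear_frechet_derivative[OF d]]
  \<comment> \<open>The curvature is trilinear, so the three doubled arguments give 2 * 2 * 2 on the
    left, against the single factor 2 on the right.\<close>
  have "8 *\<^sub>R curvature_at (\<Gamma> c) x (axis r 1) (axis j 1) (axis k 1) = 2 *\<^sub>R curvature_at (\<Gamma> c) x (axis r 1) (axis j 1) (axis k 1)" for r j k
    using eq[of r j k] unfolding mat_mult_vec linear_scale[OF lin(1)] linear_scale[OF lin(2)] linear_scale[OF lin(3)] by simp
  then have "curvature_at (\<Gamma> c) x (axis r 1) (axis j 1) (axis k 1) = 0" for r j k
    by (metis scaleR_right_imp_eq numeral_eq_iff num.distinct(1) num.inject(1))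
  then show "integrability_object \<Gamma> c x = 0"
    by (simp add: vec_eq_iff integrability_object_curv[of \<Gamma> c, OF d])
qed

lemma vanishes_imp_PHG_integrable:
  assumes I: "integrability_object_vanishes A \<Gamma>"
  shows "PHG_uniquely_locally_integrable A \<Gamma>"
  unfolding PHG_uniquely_locally_integrable_def
proof (intro ballI)
  fix c d \<alpha> assume c: "c \<in> A" and d: "d \<in> A" and \<alpha>: "\<alpha> \<in> affine_PHG A \<Gamma> c d"
  let ?H = "PHG_system \<Gamma> c d" and ?\<Omega> = "coord c ` dom_of c \<times> coord d ` dom_of d \<times> (UNIV :: (real^'n^'n) set)"
  obtain x y B C where \<alpha>_eq: "\<alpha> = (x, y, B, C)" by (cases \<alpha>)
  have U2: "(x, y, B, C) \<in> U2 A c d" and C: "C = ?H (x, y, B)" using \<alpha> by (auto simp: \<alpha>_eq affine_PHG_iff)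
  note xyB = U2_source_target[OF c d U2]
  note system = open_PHG_domain[OF c d] smooth_on_PHG[OF c d]
  have comp: "compatible ?H z" if "z \<in> ?\<Omega>" for z
  proof -
    obtain x y p where z: "z = (x, y, p)" by (cases z)
    then have xy: "x \<in> coord c ` dom_of c" "y \<in> coord d ` dom_of d" using that by auto
    have "curvature_at (\<Gamma> c) x u v w = 0" "curvature_at (\<Gamma> d) y u v w = 0" for u v w
      using I integrability_object_zero_iff c d xy unfolding integrability_object_vanishes_def by blast+
    then have eq: "bil (frechet_derivative ?H (at z) (prolongation ?H z u)) v w
      - bil (frechet_derivative ?H (at z) (prolongation ?H z v)) u w = 0" for u v w
      unfolding z PHG_defect[OF c d xy] by simp
    show ?thesis
      unfolding compatible_bil by (intro allI, rule iffD2[OF eq_iff_diff_eq_0], rule eq)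
  qed
  have "(x, y, B) \<in> ?\<Omega>" using xyB by simp
  then obtain r F where r: "0 < r" and F: "smooth_on (ball x r) F" "F x = y" "jac F x = B"
    "\<And>z. z \<in> ball x r \<Longrightarrow> (z, F z, jac F z) \<in> ?\<Omega> \<and> hess F z = ?H (z, F z, jac F z)"
    using second_order_existence[OF system _ PHG_system_symmetric[OF c d] comp] by blast
  \<comment> \<open>The Jacobian of the solution at \<open>x\<close> is \<open>B\<close>, the linear
    part of an arrow and therefore invertible. Hence the solution is a local diffeomorphism near
    \<open>x\<close>.\<close>
  obtain U G where U: "open U" "x \<in> U" "U \<subseteq> ball x r" "open (F ` U)" "smooth_on (F ` U) G"
    "\<forall>z\<in>U. G (F z) = z"
    using smooth_local_inverse[OF open_ball _ F(1)] r xyB(3) unfolding F(3)[symmetric]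
    by (metis centre_in_ball)
  have sub: "U \<subseteq> coord c ` dom_of c" "F ` U \<subseteq> coord d ` dom_of d" using F(4) U(3) by blast+
  define f where "f = (\<lambda>p. point d (F (coord c p)))"
  note jets = diffeo_jets[OF c d U(1) sub(1) smooth_on_subset[OF F(1) U(3)] U(4) sub(2) U(5,6) _ f_def]
  have jet2: "jet2 c d f (point c z) \<in> affine_PHG A \<Gamma> c d" if "z \<in> U" for z
  proof -
    have "jet2 c d f (point c z) \<in> U2 A c d" using jets(1-3)[OF that] unfolding U2_def by blast
    then show ?thesis
      using F(4)[of z] that U(3) by (auto simp: jets(5)[OF that] affine_PHG_iff)
  qed
  have "\<forall>\<^sub>F q in nhds (point c x). q \<in> point c ` U"
    using U(1,2) by (intro eventually_nhds_in_open open_point_image[OF A c U(1) sub(1)]) auto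
  then have "\<forall>\<^sub>F q in nhds (point c x). q \<in> dom_of c \<and> f q \<in> dom_of d \<and> jet2 c d f q \<in> affine_PHG A \<Gamma> c d"
    by (rule eventually_mono) (use jets(1,2) jet2 in blast)
  then have sol: "PHG_solution A \<Gamma> c d \<alpha> f"
    using jets[OF U(2)] F(4)[of x] r by (simp add: PHG_solution_def Let_def \<alpha>_eq F(2,3) C)
  have uniq: "\<forall>\<^sub>F q in nhds (point c x). f q = g q"
    if f: "PHG_solution A \<Gamma> c d (x, y, B, C) f" and g: "PHG_solution A \<Gamma> c d (x, y, B, C) g" for f g
  proof -
    obtain S where S: "open S" "x \<in> S" "S \<subseteq> coord c ` dom_of c" "smooth_on S (in_charts c d f)"
      "\<And>z. z \<in> S \<Longrightarrow> f (point c z) \<in> dom_of d"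
      "\<And>z. z \<in> S \<Longrightarrow> hess (in_charts c d f) z = ?H (z, in_charts c d f z, jac (in_charts c d f) z)"
      "in_charts c d f x = y" "jac (in_charts c d f) x = B"
      using PHG_solution_coordinates[OF c d xyB(1) f] by blast
    obtain T where T: "open T" "x \<in> T" "T \<subseteq> coord c ` dom_of c" "smooth_on T (in_charts c d g)"
      "\<And>z. z \<in> T \<Longrightarrow> g (point c z) \<in> dom_of d"
      "\<And>z. z \<in> T \<Longrightarrow> hess (in_charts c d g) z = ?H (z, in_charts c d g z, jac (in_charts c d g) z)"
      "in_charts c d g x = y" "jac (in_charts c d g) x = B"
      using PHG_solution_coordinates[OF c d xyB(1) g] by blast
    \<comment> \<open>The two solutions are compared in the charts \<open>c, d\<close> on
      \<open>S \<inter> T\<close>, where both satisfy the same system with the same 1-jet at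
      \<open>x\<close>.\<close>
    have "\<forall>\<^sub>F z in nhds x. in_charts c d f z = in_charts c d g z"
    proof (rule second_order_uniqueness[OF system, of "S \<inter> T"])
      show "smooth_on (S \<inter> T) (in_charts c d f)" "smooth_on (S \<inter> T) (in_charts c d g)"
        by (rule smooth_on_subset[OF S(4)], simp, rule smooth_on_subset[OF T(4)], simp)
    qed (use S T xyB in auto)
    then obtain N where N: "open N" "x \<in> N" "\<And>z. z \<in> N \<Longrightarrow> in_charts c d f z = in_charts c d g z"
      unfolding eventually_nhds by blast
    let ?N = "S \<inter> T \<inter> N"
    have oN: "open ?N" "?N \<subseteq> coord c ` dom_of c" using S T N by auto
    have "\<forall>\<^sub>F q in nhds (point c x). q \<in> point c ` ?N"
      using S(2) T(2) N(2) by (intro eventually_nhds_in_open open_point_image[OF A c oN]) auto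
    then show ?thesis
    proof (rule eventually_mono)
      fix q assume "q \<in> point c ` ?N"
      then obtain z where z: "q = point c z" "z \<in> S" "z \<in> T" "z \<in> N" by blast
      have "coord d (f q) = coord d (g q)" using N(3)[OF z(4)] by (simp add: in_charts_def z(1))
      \<comment> \<open>Equal coordinates give equal points because both values lie in the domain of
        \<open>d\<close>, as the choice of \<open>S\<close> and \<open>T\<close> guarantees.\<close>
      then show "f q = g q"
        using S(5)[OF z(2)] T(5)[OF z(3)] point_coord[OF A d] unfolding z(1) by metis
    qed
  qed
  show "(\<exists>f. PHG_solution A \<Gamma> c d \<alpha> f) \<and> (\<forall>f g. PHG_solution A \<Gamma> c d \<alpha> f \<longrightarrow> PHG_solution A \<Gamma> c d \<alpha> g \<longrightarrow>
      (\<forall>\<^sub>F q in nhds (point c (fst \<alpha>)). f q = g q))"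
    using sol uniq unfolding \<alpha>_eq fst_conv by blast
qed

section \<open>Conditions on the linearization and its curvature\<close>

lemma field_jets:
  assumes c: "c \<in> A" and U: "open U" "U \<subseteq> coord c ` dom_of c" and X: "smooth_on U X" and z: "z \<in> U"
  shows "point c z \<in> dom_of c" "local_vector_field_at A (point c z) (coordinate_field c X)"
    "vjet1 c (coordinate_field c X) (point c z) = (z, X z, jac X z)"
    "vjet2 c (coordinate_field c X) (point c z) = (z, X z, jac X z, hess X z)"
proof -
  have z': "z \<in> coord c ` dom_of c" using z U(2) by blast
  show "point c z \<in> dom_of c" by (rule point_in_dom[OF A c z'])
  show "local_vector_field_at A (point c z) (coordinate_field c X)"
    unfolding local_vector_field_at_def using vector_field_coordinate_field[OF A c U X] z by blast
  note same = coordinate_field_same[OF A c]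
  have "jac (coordinate_field c X c) z = jac X z" "hess (coordinate_field c X c) z = hess X z"
    by (auto intro!: jac_cong[OF open_coords[OF A c] z'] hess_cong[OF open_coords[OF A c] z'] same)
  then show "vjet1 c (coordinate_field c X) (point c z) = (z, X z, jac X z)"
    "vjet2 c (coordinate_field c X) (point c z) = (z, X z, jac X z, hess X z)"
    by (simp_all add: vjet1_def vjet2_def coord_point[OF A c z'] same[OF z'])
qed

lemma field_jets_exist:
  assumes c: "c \<in> A" and x: "x \<in> coord c ` dom_of c"
  shows "(x, \<xi>, B) \<in> J1T A c"
    "(\<And>i j k. C $ i $ j $ k = C $ i $ k $ j) \<Longrightarrow> (x, \<xi>, B, C) \<in> J2T A c"
proof -
  have jets: "(x, \<xi>, B) \<in> J1T A c" "(x, \<xi>, B, C) \<in> J2T A c" if C: "\<And>i j k. C $ i $ j $ k = C $ i $ k $ j" for C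
  proof -
    note f = field_jets[OF c open_coords[OF A c] subset_refl
        smooth_on_subset[OF smooth_on_quadratic_map[of x \<xi> B C] subset_UNIV] x, unfolded quadratic_map_jet[of C, OF C]]
    show "(x, \<xi>, B) \<in> J1T A c" unfolding J1T_def using f(1-3) by force
    show "(x, \<xi>, B, C) \<in> J2T A c" unfolding J2T_def using f(1,2,4) by force
  qed
  \<comment> \<open>A 1-jet is completed by zero second derivatives.\<close>
  show "(x, \<xi>, B) \<in> J1T A c" by (rule jets(1)[of 0]) simp
  show "(x, \<xi>, B, C) \<in> J2T A c" if "\<And>i j k. C $ i $ j $ k = C $ i $ k $ j" using jets(2)[OF that] .
qed

lemma J2T_source: "c \<in> A \<Longrightarrow> (x, \<xi>, B, C) \<in> J2T A c \<Longrightarrow> x \<in> coord c ` dom_of c"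
  by (auto simp: J2T_def vjet2_def)

lemma linearization_iff:
  "(x, \<xi>, p, q) \<in> linearization A \<Gamma> c \<longleftrightarrow> (x, \<xi>, p, q) \<in> J2T A c \<and> q = linear_system \<Gamma> c (x, \<xi>, p)"
  by (simp add: linearization_def linear_system_def)

lemma linear_jet_exists:
  assumes c: "c \<in> A" and x: "x \<in> coord c ` dom_of c"
  shows "(x, \<xi>, p, linear_system \<Gamma> c (x, \<xi>, p)) \<in> linearization A \<Gamma> c"
  unfolding linearization_iff
  by (intro conjI refl field_jets_exist(2)[OF c x] linear_system_symmetric[OF c]) (use x in simp)

text \<open>Besides the coordinate equation this keeps the domain \<open>W\<close> of the field:
  uniqueness is claimed in every chart, and the transformation rule that leads to the other charts
  holds on \<open>W\<close>.\<close>

lemma linear_solution_coordinates: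
  assumes c: "c \<in> A" and x: "x \<in> coord c ` dom_of c"
    and sol: "linear_solution A \<Gamma> c (x, \<xi>, B, C) X"
  obtains W S where "vector_field_on A W X" "open S" "x \<in> S" "S \<subseteq> coord c ` (W \<inter> dom_of c)"
    "smooth_on S (X c)"
    "\<And>z. z \<in> S \<Longrightarrow> hess (X c) z = linear_system \<Gamma> c (z, X c z, jac (X c) z)"
    "X c x = \<xi>" "jac (X c) x = B"
proof -
  let ?p = "point c x"
  have p: "?p \<in> dom_of c" "coord c ?p = x" using point_in_dom[OF A c x] coord_point[OF A c x] .
  have X: "local_vector_field_at A ?p X" "vjet2 c X ?p = (x, \<xi>, B, C)"
    and ev: "\<forall>\<^sub>F q in nhds ?p. q \<in> dom_of c \<and> vjet2 c X q \<in> linearization A \<Gamma> c"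
    using sol by (auto simp: linear_solution_def Let_def)
  obtain W where W: "?p \<in> W" "vector_field_on A W X" using X(1) by (auto simp: local_vector_field_at_def)
  have oW: "open W" and sX: "smooth_on (coord c ` (W \<inter> dom_of c)) (X c)"
    using W(2) c by (auto simp: vector_field_on_def)
  obtain Q where Q: "open Q" "?p \<in> Q" "\<And>q. q \<in> Q \<Longrightarrow> vjet2 c X q \<in> linearization A \<Gamma> c"
    using ev unfolding eventually_nhds by blast
  define S where "S = coord c ` ((W \<inter> Q) \<inter> dom_of c)"
  have sub: "S \<subseteq> coord c ` (W \<inter> dom_of c)" by (auto simp: S_def)
  show ?thesis
  proof (rule that[OF W(2) _ _ sub])
    show "open S" unfolding S_def by (intro open_coord_image[OF A c] open_Int oW Q)
    show "x \<in> S" using W(1) Q(2) p unfolding S_def by force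
    show "smooth_on S (X c)" by (rule smooth_on_subset[OF sX sub])
    show "hess (X c) z = linear_system \<Gamma> c (z, X c z, jac (X c) z)" if z: "z \<in> S" for z
    proof -
      obtain q where q: "q \<in> Q" "z = coord c q" using z by (auto simp: S_def)
      then have "(z, X c z, jac (X c) z, hess (X c) z) \<in> linearization A \<Gamma> c"
        using Q(3)[OF q(1)] by (simp add: vjet2_def)
      then show ?thesis by (simp add: linearization_iff)
    qed
    show "X c x = \<xi>" "jac (X c) x = B" using X(2) by (simp_all add: vjet2_def p)
  qed
qed

lemma open_linear_domain: "c \<in> A \<Longrightarrow> open (coord c ` dom_of c \<times> (UNIV :: ((real^'n) \<times> (real^'n^'n)) set))"
  by (intro open_Times open_UNIV open_coords[OF A])

lemma smooth_on_linear: "c \<in> A \<Longrightarrow> smooth_on (coord c ` dom_of c \<times> UNIV) (linear_system \<Gamma> c)"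
  using smooth_on_linear_system[of "coord c ` dom_of c" \<Gamma> c, OF open_coords[OF A] smooth_on_\<Gamma>] by simp

lemma compatible_linear:
  assumes "integrability_object_vanishes A \<Gamma>" "c \<in> A" "x \<in> coord c ` dom_of c"
  shows "compatible (linear_system \<Gamma> c) (x, \<xi>, p)"
  by (rule compatible_linear_system[of "coord c ` dom_of c" \<Gamma> c, OF open_coords[OF A assms(2)]
        smooth_on_\<Gamma>[OF assms(2)] \<Gamma>_symmetric[OF assms(2)] _ assms(3)])
    (use assms(1,2) in \<open>auto simp: integrability_object_vanishes_def\<close>)

lemma vanishes_if_compatible_linear:
  assumes "c \<in> A" "x \<in> coord c ` dom_of c" "compatible (linear_system \<Gamma> c) (x, 0, mat 1)"
  shows "integrability_object \<Gamma> c x = 0"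
  by (rule integrability_object_eq_0I[of "coord c ` dom_of c" \<Gamma> c, OF open_coords[OF A assms(1)]
        smooth_on_\<Gamma>[OF assms(1)] \<Gamma>_symmetric[OF assms(1)] assms(2,3)])

lemma linear_curvature_vanishes_iff:
  "linear_curvature_vanishes A \<Gamma> \<longleftrightarrow> integrability_object_vanishes A \<Gamma>"
proof -
  have iff: "linear_curvature \<Gamma> c (x, \<xi>, p) = 0 \<longleftrightarrow> compatible (linear_system \<Gamma> c) (x, \<xi>, p)"
    if "c \<in> A" "x \<in> coord c ` dom_of c" for c x \<xi> p
    using linear_curvature_eq_0_iff[of "coord c ` dom_of c" \<Gamma> c, OF open_coords[OF A that(1)]
        smooth_on_\<Gamma>[OF that(1)] \<Gamma>_symmetric[OF that(1)] that(2)] .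
  show ?thesis
  proof
    assume R: "linear_curvature_vanishes A \<Gamma>"
    show "integrability_object_vanishes A \<Gamma>"
      unfolding integrability_object_vanishes_def
    proof (intro ballI)
      fix c x assume cx: "c \<in> A" "x \<in> coord c ` dom_of c"
      have "linear_curvature \<Gamma> c (x, 0, mat 1) = 0"
        using R field_jets_exist(1)[OF cx] cx(1) unfolding linear_curvature_vanishes_def by blast
      then show "integrability_object \<Gamma> c x = 0"
        by (intro vanishes_if_compatible_linear[OF cx]) (simp only: iff[OF cx])
    qed
  next
    assume I: "integrability_object_vanishes A \<Gamma>"
    show "linear_curvature_vanishes A \<Gamma>"
      unfolding linear_curvature_vanishes_def
    proof (intro ballI)
      fix c \<alpha> assume c: "c \<in> A" and "\<alpha> \<in> J1T A c"
      then obtain x \<xi> p where \<alpha>: "\<alpha> = (x, \<xi>, p)" "x \<in> coord c ` dom_of c"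
        by (auto simp: J1T_def vjet1_def)
      show "linear_curvature \<Gamma> c \<alpha> = 0"
        unfolding \<alpha>(1) iff[OF c \<alpha>(2)] by (rule compatible_linear[OF I c \<alpha>(2)])
    qed
  qed
qed

lemma linear_integrable_imp_vanishes:
  assumes R: "linearization_uniquely_locally_integrable A \<Gamma>"
  shows "integrability_object_vanishes A \<Gamma>"
  unfolding integrability_object_vanishes_def
proof (intro ballI)
  fix c x assume c: "c \<in> A" and x: "x \<in> coord c ` dom_of c"
  \<comment> \<open>The test element is the infinitesimal dilation at \<open>x\<close>; a solution
    through it makes the linear system compatible there.\<close>
  obtain X where X: "linear_solution A \<Gamma> c (x, 0, mat 1, linear_system \<Gamma> c (x, 0, mat 1)) X"
    using R c linear_jet_exists[OF c x] unfolding linearization_uniquely_locally_integrable_def by blast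
  obtain S where S: "open S" "x \<in> S" "smooth_on S (X c)"
    "\<And>z. z \<in> S \<Longrightarrow> hess (X c) z = linear_system \<Gamma> c (z, X c z, jac (X c) z)"
    "X c x = 0" "jac (X c) x = mat 1"
    using linear_solution_coordinates[OF c x X] by metis
  have "compatible (linear_system \<Gamma> c) (x, X c x, jac (X c) x)"
    by (rule second_order_compatible[OF open_linear_domain[OF c] smooth_on_linear[OF c] S(1-4)]) (use x in auto)
  then show "integrability_object \<Gamma> c x = 0"
    by (intro vanishes_if_compatible_linear[OF c x]) (simp only: S(5,6))
qed

lemma vanishes_imp_linear_integrable:
  assumes I: "integrability_object_vanishes A \<Gamma>"
  shows "linearization_uniquely_locally_integrable A \<Gamma>"
  unfolding linearization_uniquely_locally_integrable_def
proof (intro ballI)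
  fix c \<alpha> assume c: "c \<in> A" and \<alpha>: "\<alpha> \<in> linearization A \<Gamma> c"
  let ?H = "linear_system \<Gamma> c" and ?\<Omega> = "coord c ` dom_of c \<times> (UNIV :: ((real^'n) \<times> (real^'n^'n)) set)"
  obtain x \<xi> B C where \<alpha>_eq: "\<alpha> = (x, \<xi>, B, C)" by (cases \<alpha>)
  have J2: "(x, \<xi>, B, C) \<in> J2T A c" and C: "C = ?H (x, \<xi>, B)" using \<alpha> by (auto simp: \<alpha>_eq linearization_iff)
  have x: "x \<in> coord c ` dom_of c" by (rule J2T_source[OF c J2])
  note system = open_linear_domain[OF c] smooth_on_linear[OF c]
  have z: "(x, \<xi>, B) \<in> ?\<Omega>" using x by simp
  have sym: "?H z $ i $ j $ k = ?H z $ i $ k $ j" if "z \<in> ?\<Omega>" for z i j k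
    by (rule linear_system_symmetric[OF c]) (use that in auto)
  have comp: "compatible ?H z" if "z \<in> ?\<Omega>" for z
    using that compatible_linear[OF I c] by (cases z) auto
  obtain r F where r: "0 < r" and F: "smooth_on (ball x r) F" "F x = \<xi>" "jac F x = B"
    "\<And>z. z \<in> ball x r \<Longrightarrow> (z, F z, jac F z) \<in> ?\<Omega> \<and> hess F z = ?H (z, F z, jac F z)"
    using second_order_existence[OF system z sym comp] by blast
  have sub: "ball x r \<subseteq> coord c ` dom_of c" using F(4) by blast
  let ?X = "coordinate_field c F"
  note jets = field_jets[OF c open_ball sub F(1)]
  have jet2: "vjet2 c ?X (point c z) \<in> linearization A \<Gamma> c" if "z \<in> ball x r" for z
  proof -
    have "vjet2 c ?X (point c z) \<in> J2T A c" using jets(1,2)[OF that] unfolding J2T_def by blast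
    then show ?thesis
      using F(4)[OF that] by (simp add: jets(4)[OF that] linearization_iff)
  qed
  have xr: "x \<in> ball x r" using r by simp
  have "\<forall>\<^sub>F q in nhds (point c x). q \<in> point c ` ball x r"
    using xr by (intro eventually_nhds_in_open open_point_image[OF A c open_ball sub]) auto
  then have ev: "\<forall>\<^sub>F q in nhds (point c x). q \<in> dom_of c \<and> vjet2 c ?X q \<in> linearization A \<Gamma> c"
    by (rule eventually_mono) (use jets(1) jet2 in blast)
  have "hess F x = C" using F(4)[OF xr] by (simp add: F(2,3) C)
  then have sol: "linear_solution A \<Gamma> c \<alpha> ?X"
    using jets(2,4)[OF xr] ev by (simp add: linear_solution_def Let_def \<alpha>_eq F(2,3))
  have uniq: "\<forall>\<^sub>F q in nhds (point c x). \<forall>d\<in>A. q \<in> dom_of d \<longrightarrow> X d (coord d q) = Y d (coord d q)"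
    if X: "linear_solution A \<Gamma> c (x, \<xi>, B, C) X" and Y: "linear_solution A \<Gamma> c (x, \<xi>, B, C) Y" for X Y
  proof -
    obtain V S where V: "vector_field_on A V X" and S: "open S" "x \<in> S" "S \<subseteq> coord c ` (V \<inter> dom_of c)"
      "smooth_on S (X c)"
      "\<And>z. z \<in> S \<Longrightarrow> hess (X c) z = ?H (z, X c z, jac (X c) z)"
      "X c x = \<xi>" "jac (X c) x = B"
      using linear_solution_coordinates[OF c x X] by blast
    obtain W T where W: "vector_field_on A W Y" and T: "open T" "x \<in> T" "T \<subseteq> coord c ` (W \<inter> dom_of c)"
      "smooth_on T (Y c)"
      "\<And>z. z \<in> T \<Longrightarrow> hess (Y c) z = ?H (z, Y c z, jac (Y c) z)"
      "Y c x = \<xi>" "jac (Y c) x = B"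
      using linear_solution_coordinates[OF c x Y] by blast
    have "\<forall>\<^sub>F z in nhds x. X c z = Y c z"
    proof (rule second_order_uniqueness[OF system, of "S \<inter> T"])
      show "smooth_on (S \<inter> T) (X c)" "smooth_on (S \<inter> T) (Y c)"
        by (rule smooth_on_subset[OF S(4)], simp, rule smooth_on_subset[OF T(4)], simp)
    qed (use S T x in auto)
    then obtain N where N: "open N" "x \<in> N" "\<And>z. z \<in> N \<Longrightarrow> X c z = Y c z"
      unfolding eventually_nhds by blast
    let ?N = "S \<inter> T \<inter> N"
    have oN: "open ?N" "?N \<subseteq> coord c ` dom_of c" using S T N by auto
    have "\<forall>\<^sub>F q in nhds (point c x). q \<in> point c ` ?N"
      using S(2) T(2) N(2) by (intro eventually_nhds_in_open open_point_image[OF A c oN]) auto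
    then show ?thesis
    proof (rule eventually_mono, intro ballI impI)
      fix q d assume q: "q \<in> point c ` ?N" and d: "d \<in> A" "q \<in> dom_of d"
      then obtain z where z: "q = point c z" "z \<in> S" "z \<in> T" "z \<in> N" by blast
      have zc: "z \<in> coord c ` dom_of c" using oN z by blast
      have qc: "coord c q = z" "q \<in> dom_of c"
        using coord_point[OF A c zc] point_in_dom[OF A c zc] z(1) by auto
      have "q \<in> V" using z(2) S(3) coord_image[OF A c, of V] z(1) by blast
      moreover have "q \<in> W" using z(3) T(3) coord_image[OF A c, of W] z(1) by blast
      moreover have "transition c d z = coord d q" by (simp add: transition_def z(1))
      \<comment> \<open>Equality in the chart \<open>c\<close> passes to the chart \<open>d\<close>
        because both fields transform by the same Jacobian.\<close>
      ultimately have "X d (coord d q) = jac (transition c d) z *v X c z"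
        "Y d (coord d q) = jac (transition c d) z *v Y c z"
        using V W c d qc unfolding vector_field_on_def by (metis IntI imageI)+
      then show "X d (coord d q) = Y d (coord d q)" using N(3)[OF z(4)] by simp
    qed
  qed
  show "(\<exists>X. linear_solution A \<Gamma> c \<alpha> X) \<and> (\<forall>X Y. linear_solution A \<Gamma> c \<alpha> X \<longrightarrow> linear_solution A \<Gamma> c \<alpha> Y \<longrightarrow>
      (\<forall>\<^sub>F q in nhds (point c (fst \<alpha>)). \<forall>d\<in>A. q \<in> dom_of d \<longrightarrow> X d (coord d q) = Y d (coord d q)))"
    using sol uniq unfolding \<alpha>_eq fst_conv by blast
qed

lemma formal_Lie_derivative_vanishes_iff:
  "formal_Lie_derivative_vanishes A \<Gamma> \<longleftrightarrow> integrability_object_vanishes A \<Gamma>"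
proof
  assume R: "formal_Lie_derivative_vanishes A \<Gamma>"
  show "integrability_object_vanishes A \<Gamma>"
    unfolding integrability_object_vanishes_def
  proof (intro ballI)
    fix c x assume cx: "c \<in> A" "x \<in> coord c ` dom_of c"
    let ?T = "integrability_object \<Gamma> c x"
    have L: "formal_Lie_derivative \<Gamma> c (x, 0, mat 1) = 0"
      using R field_jets_exist(1)[OF cx] cx(1) unfolding formal_Lie_derivative_vanishes_def by blast
    have "?T $ i $ r $ j $ k = 0" for i r j k
    proof -
      have "formal_Lie_derivative \<Gamma> c (x, 0, mat 1) $ i $ r $ j $ k = 2 * ?T $ i $ r $ j $ k"
        by (simp add: formal_Lie_derivative_def Let_def sum_mat)
      then show ?thesis using L by simp
    qed
    then show "?T = 0" by (simp add: vec_eq_iff)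
  qed
next
  assume I: "integrability_object_vanishes A \<Gamma>"
  show "formal_Lie_derivative_vanishes A \<Gamma>"
    unfolding formal_Lie_derivative_vanishes_def
  proof (intro ballI)
    fix c \<alpha> assume c: "c \<in> A" and "\<alpha> \<in> J1T A c"
    then obtain x \<xi> p where \<alpha>: "\<alpha> = (x, \<xi>, p)" "x \<in> coord c ` dom_of c"
      by (auto simp: J1T_def vjet1_def)
    have 0: "integrability_object \<Gamma> c z = 0" if "z \<in> coord c ` dom_of c" for z
      using I c that unfolding integrability_object_vanishes_def by blast
    \<comment> \<open>The integrability object vanishes on the whole chart domain, so the derivative
      term of the Lie derivative vanishes along with the algebraic ones.\<close>
    have "pd a (\<lambda>z. integrability_object \<Gamma> c z $ i $ r $ j $ k) x = pd a (\<lambda>z. 0) x" for a i r j k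
      by (rule pd_cong[OF open_coords[OF A c] \<alpha>(2)]) (simp add: 0)
    then show "formal_Lie_derivative \<Gamma> c \<alpha> = 0"
      by (simp add: \<alpha>(1) formal_Lie_derivative_def Let_def 0[OF \<alpha>(2)] pd_eq[OF has_derivative_const] vec_eq_iff)
  qed
qed

end

theorem proposition19:
  fixes A :: "('m::{t2_space, second_countable_topology}, 'n::finite) chart set"
    and \<Gamma> :: "('m, 'n) gamma"
  assumes "smooth_manifold A"
    and "structure_object A \<Gamma>"
  shows "(nonlinear_curvature_vanishes A \<Gamma> \<longleftrightarrow> PHG_uniquely_locally_integrable A \<Gamma>) \<and>
    (PHG_uniquely_locally_integrable A \<Gamma> \<longleftrightarrow> PHG_leaves_integrability_object_invariant A \<Gamma>) \<and>
    (PHG_leaves_integrability_object_invariant A \<Gamma> \<longleftrightarrow> integrability_object_vanishes A \<Gamma>) \<and>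
    (integrability_object_vanishes A \<Gamma> \<longleftrightarrow> linear_curvature_vanishes A \<Gamma>) \<and>
    (linear_curvature_vanishes A \<Gamma> \<longleftrightarrow> linearization_uniquely_locally_integrable A \<Gamma>) \<and>
    (linearization_uniquely_locally_integrable A \<Gamma> \<longleftrightarrow> formal_Lie_derivative_vanishes A \<Gamma>)"
proof -
  have "PHG_uniquely_locally_integrable A \<Gamma> \<longleftrightarrow> integrability_object_vanishes A \<Gamma>"
    using PHG_integrable_imp_vanishes[OF assms] vanishes_imp_PHG_integrable[OF assms] by blast
  moreover have "linearization_uniquely_locally_integrable A \<Gamma> \<longleftrightarrow> integrability_object_vanishes A \<Gamma>"
    using linear_integrable_imp_vanishes[OF assms] vanishes_imp_linear_integrable[OF assms] by blast
  ultimately show ?thesis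
    by (simp add: nonlinear_curvature_vanishes_iff[OF assms] invariance_iff[OF assms]
        linear_curvature_vanishes_iff[OF assms] formal_Lie_derivative_vanishes_iff[OF assms])
qed

end
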